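(* Let $\{(\boldsymbol Y_i,\boldsymbol X_i,\boldsymbol Z_i)\}_{i=1}^n$ be i.i.d. copies of a triple of random vectors $(\boldsymbol Y,\boldsymbol X,\boldsymbol Z)\in\mathbb{R}^{d_Y}\times\mathbb{R}^{d_X}\times\mathbb{R}^{d_Z}$. Let $$T^{\mathrm{AC}}:=\frac{\int \mathrm{var}(\mathbb{P}(\boldsymbol Y\ge \boldsymbol y\mid \boldsymbol Z))\,d\tilde\mu_{\boldsymbol Y}(\boldsymbol y)}{\int \mathrm{var}(\mathbb{1}\{\boldsymbol Y\ge \boldsymbol y\})\,d\tilde\mu_{\boldsymbol Y}(\boldsymbol y)},\qquad T^{\mathrm{AC,cond}}:=\frac{\int \mathbb{E}(\mathrm{var}(\mathbb{P}(\boldsymbol Y\ge \boldsymbol y\mid \boldsymbol Z,\boldsymbol X)\mid \boldsymbol X))\,d\tilde\mu_{\boldsymbol Y}(\boldsymbol y)}{\int \mathbb{E}(\mathrm{var}(\mathbb{1}\{\boldsymbol Y\ge \boldsymbol y\}\mid \boldsymbol X))\,d\tilde\mu_{\boldsymbol Y}(\boldsymbol y)},$$ and $$\hat T^{\mathrm{AC}}:=\frac{\sum_{i=1}^n\big(n\tilde R(\boldsymbol Y_i\wedge\boldsymbol Y_{M_{\boldsymbol Z}(i)})-\check L_i^2\big)}{\sum_{i=1}^n(n-\check L_i)\check L_i},\qquad \hat T^{\mathrm{AC,cond}}:=\frac{\sum_{i=1}^n\big(\tilde R(\boldsymbol Y_i\wedge\boldsymbol Y_{M_{(\boldsymbol X,\boldsymbol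 Z)}(i)})-\tilde R(\boldsymbol Y_i\wedge\boldsymbol Y_{M_{\boldsymbol X}(i)})\big)}{\sum_{i=1}^n\big(\tilde R(\boldsymbol Y_i)-\tilde R(\boldsymbol Y_i\wedge\boldsymbol Y_{M_{\boldsymbol X}(i)})\big)}.$$ If $\boldsymbol Y$ is not almost surely a constant, then $\hat T^{\mathrm{AC}}\to T^{\mathrm{AC}}$ almost surely as $n\to\infty$. If $\boldsymbol Y$ is not almost surely a function of $\boldsymbol X$, then $\hat T^{\mathrm{AC,cond}}\to T^{\mathrm{AC,cond}}$ almost surely as $n\to\infty$.
   Context: For vectors, $\le,\ge$ are entrywise and $\boldsymbol a\wedge\boldsymbol b$ is the entrywise minimum. $\tilde\mu_{\boldsymbol Y}$ is the product of the one-dimensional marginal distributions of the coordinates of $\boldsymbol Y$. $M_{\boldsymbol Z}(i)$ is the index of the nearest neighbour of $\boldsymbol Z_i$ (Euclidean distance) among $\{\boldsymbol Z_j\}_{j\ne i}$, with ties broken uniformly at random (independently over $i$ and of the data); $M_{\boldsymbol X}(i)$ and $M_{(\boldsymbol X,\boldsymbol Z)}(i)$ are defined analogously using $\boldsymbol X_j$ and $(\boldsymbol X_j,\boldsymbol Z_j)$. For each $n$, $\pi_1,\dots,\pi_{d_Y}:[n]\to[n]$ are given (deterministic) permutations such that $\pi_{d_1}(i)\ne\pi_{d_2}(i)$ for all $i\in[n]$ and all $1\le d_1<d_2\le d_Y$. Writing $Y_{k,j}$ for the $j$-th coordinate of $\boldsymbol Y_k$, set $\tilde{\boldsymbol Y}_i:=(Y_{\pi_1(i),1},\dots,Y_{\pi_{d_Y}(i),d_Y})$,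 $$\tilde R(\boldsymbol y):=\sum_{i=1}^n\mathbb{1}\{\tilde{\boldsymbol Y}_i\le\boldsymbol y\},\qquad \check L_i:=\sum_{\ell=1}^n\mathbb{1}\{\boldsymbol Y_\ell\ge\tilde{\boldsymbol Y}_i\}.$$ *)

theory Defs
  imports "HOL-Probability.Probability"
begin

definition sigma_gen :: "'a measure \<Rightarrow> ('a \<Rightarrow> 'b) \<Rightarrow> 'b measure \<Rightarrow> 'a measure" where
  "sigma_gen M W N = vimage_algebra (space M) W N"

definition cond_prob_on :: "'a measure \<Rightarrow> 'a measure \<Rightarrow> 'a set \<Rightarrow> 'a \<Rightarrow> real" where
  "cond_prob_on M F A = real_cond_exp M F (indicator A)"

definition cond_var_on :: "'a measure \<Rightarrow> 'a measure \<Rightarrow> ('a \<Rightarrow> real) \<Rightarrow> 'a \<Rightarrow> real" where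
  "cond_var_on M F V = real_cond_exp M F (\<lambda>\<omega>. (V \<omega> - real_cond_exp M F V \<omega>)\<^sup>2)"

definition upper_event :: "'a measure \<Rightarrow> ('a \<Rightarrow> real ^ 'd) \<Rightarrow> real ^ 'd \<Rightarrow> 'a set" where
  "upper_event M Y y = {\<omega> \<in> space M. y \<le> Y \<omega>}"

definition marginal_product :: "'a measure \<Rightarrow> ('a \<Rightarrow> real ^ 'd) \<Rightarrow> (real ^ 'd) measure" where
  "marginal_product M Y =
     distr (\<Pi>\<^sub>M j\<in>UNIV. distr M borel (\<lambda>\<omega>. Y \<omega> $ j)) borel (\<lambda>f. \<chi> j. f j)"

definition T_AC :: "'a measure \<Rightarrow> ('a \<Rightarrow> real ^ 'dy) \<Rightarrow> ('a \<Rightarrow> real ^ 'dz) \<Rightarrow> real" where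
  "T_AC M Y Z =
     (\<integral>y. prob_space.variance M
            (cond_prob_on M (sigma_gen M Z borel) (upper_event M Y y)) \<partial>marginal_product M Y) /
     (\<integral>y. prob_space.variance M (indicator (upper_event M Y y)) \<partial>marginal_product M Y)"

definition T_AC_cond ::
    "'a measure \<Rightarrow> ('a \<Rightarrow> real ^ 'dy) \<Rightarrow> ('a \<Rightarrow> real ^ 'dx) \<Rightarrow> ('a \<Rightarrow> real ^ 'dz) \<Rightarrow> real" where
  "T_AC_cond M Y X Z =
     (\<integral>y. prob_space.expectation M
            (cond_var_on M (sigma_gen M X borel)
              (cond_prob_on M (sigma_gen M (\<lambda>\<omega>. (Z \<omega>, X \<omega>)) borel) (upper_event M Y y)))
        \<partial>marginal_product M Y) /
     (\<integral>y. prob_space.expectation M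
            (cond_var_on M (sigma_gen M X borel) (indicator (upper_event M Y y)))
        \<partial>marginal_product M Y)"

definition nearest_set :: "nat \<Rightarrow> (nat \<Rightarrow> 'b::metric_space) \<Rightarrow> nat \<Rightarrow> nat set" where
  "nearest_set n w i =
     {j \<in> {..<n} - {i}. \<forall>k \<in> {..<n} - {i}. dist (w i) (w j) \<le> dist (w i) (w k)}"

text \<open>
  \<open>D j\<close> is the \<open>j\<close>-th data record and \<open>g\<close> selects the part of a record that is used to measure
  distances. The random indices \<open>N 0, \<dots>, N (n - 1)\<close> are specified through their conditional law given
  the first \<open>n\<close> records: conditionally independent, and \<open>N i\<close> uniform on the set of nearest
  neighbours of point \<open>i\<close>. This requires \<open>n \<ge> 2\<close>, since otherwise there is no neighbour.
  Nothing is assumed about the dependence between different sample sizes or between the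
  indices for different choices of \<open>g\<close>.
\<close>

definition nearest_neighbours ::
    "'a measure \<Rightarrow> (nat \<Rightarrow> 'a \<Rightarrow> 'r::topological_space) \<Rightarrow> ('r \<Rightarrow> 'b::metric_space) \<Rightarrow> nat
      \<Rightarrow> (nat \<Rightarrow> 'a \<Rightarrow> nat) \<Rightarrow> bool" where
  "nearest_neighbours M D g n N \<longleftrightarrow>
     (\<forall>i<n. N i \<in> measurable M (count_space UNIV)) \<and>
     (\<forall>m. AE \<omega> in M.
        cond_prob_on M
          (sigma_gen M (\<lambda>\<omega>. \<lambda>j\<in>{..<n}. D j \<omega>) (\<Pi>\<^sub>M j\<in>{..<n}. borel))
          {\<omega> \<in> space M. \<forall>i<n. N i \<omega> = m i} \<omega> =
        (\<Prod>i<n. pmf (pmf_of_set (nearest_set n (\<lambda>j. g (D j \<omega>)) i)) (m i)))"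

text \<open>
  Sample indices range over \<open>{..<n}\<close>, and \<open>\<pi> d\<close> is the permutation attached to coordinate \<open>d\<close>.
  The infimum \<open>inf\<close> and the order \<open>\<le>\<close> on vectors are the library's entrywise ones.
\<close>

definition Y_tilde :: "('d \<Rightarrow> nat \<Rightarrow> nat) \<Rightarrow> (nat \<Rightarrow> real ^ 'd) \<Rightarrow> nat \<Rightarrow> real ^ 'd" where
  "Y_tilde \<pi> y i = (\<chi> d. y (\<pi> d i) $ d)"

definition R_tilde ::
    "nat \<Rightarrow> ('d \<Rightarrow> nat \<Rightarrow> nat) \<Rightarrow> (nat \<Rightarrow> real ^ 'd) \<Rightarrow> real ^ 'd \<Rightarrow> real" where
  "R_tilde n \<pi> y v = (\<Sum>i<n. of_bool (Y_tilde \<pi> y i \<le> v))"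

definition L_check :: "nat \<Rightarrow> ('d \<Rightarrow> nat \<Rightarrow> nat) \<Rightarrow> (nat \<Rightarrow> real ^ 'd) \<Rightarrow> nat \<Rightarrow> real" where
  "L_check n \<pi> y i = (\<Sum>l<n. of_bool (Y_tilde \<pi> y i \<le> y l))"

definition T_AC_hat ::
    "nat \<Rightarrow> ('d \<Rightarrow> nat \<Rightarrow> nat) \<Rightarrow> (nat \<Rightarrow> real ^ 'd) \<Rightarrow> (nat \<Rightarrow> nat) \<Rightarrow> real" where
  "T_AC_hat n \<pi> y mZ =
     (\<Sum>i<n. real n * R_tilde n \<pi> y (inf (y i) (y (mZ i))) - (L_check n \<pi> y i)\<^sup>2) /
     (\<Sum>i<n. (real n - L_check n \<pi> y i) * L_check n \<pi> y i)"

definition T_AC_cond_hat ::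
    "nat \<Rightarrow> ('d \<Rightarrow> nat \<Rightarrow> nat) \<Rightarrow> (nat \<Rightarrow> real ^ 'd) \<Rightarrow> (nat \<Rightarrow> nat) \<Rightarrow> (nat \<Rightarrow> nat) \<Rightarrow> real"
  where
  "T_AC_cond_hat n \<pi> y mX mXZ =
     (\<Sum>i<n. R_tilde n \<pi> y (inf (y i) (y (mXZ i))) - R_tilde n \<pi> y (inf (y i) (y (mX i)))) /
     (\<Sum>i<n. R_tilde n \<pi> y (y i) - R_tilde n \<pi> y (inf (y i) (y (mX i))))"

end

theory Submission
  imports Defs
begin

text \<open>
  After division by powers of \<open>n\<close>, every sum in the two statistics is an average
  \<open>(\<Sum>k<n. F (Y'\<^sub>k)) / n\<^sup>2\<close> over the permuted vectors \<open>Y'\<^sub>k\<close>, where \<open>F y\<close> is computed from the whole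
  sample: either the number of records with \<open>y \<le> Y\<^sub>i\<close>, or the number of \<open>i\<close> such that both \<open>Y\<^sub>i\<close>
  and the response at the neighbour of \<open>i\<close> dominate \<open>y\<close>. Averaging the random tie-breaking given the data
  turns the second count into the quadratic form \<open>nn_form\<close>, whose weights spread mass one uniformly
  over the set of nearest neighbours. Squares of counts are also such forms: if the feature is
  constant, all other points are tied, and \<open>nn_form\<close> is \<open>(L\<^sup>2 - L) / (n - 1)\<close> (\<open>nn_form_constant\<close>).

  The argument rests on stability: deleting one record changes \<open>F y\<close> by at most a constant, uniformly
  in the data. For \<open>nn_form\<close> this is deterministic and holds in the presence of ties, because the
  weights pointing at a single record have bounded sum (\<open>nn_in_degree_bounded\<close>) and deleting
  it moves no more than twice that mass (\<open>nn_weight_removal\<close>). Stability is used twice.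
  It gives bounded differences, hence concentration of the averages around their expectations
  (\<open>mcdiarmid_mgf\<close>). And it lets one delete the few records that enter \<open>Y'\<^sub>k\<close>: the rest of the sample is
  independent of \<open>Y'\<^sub>k\<close>, and the coordinates of \<open>Y'\<^sub>k\<close> come from distinct records, so its law is the
  product of the marginals (\<open>expectation_at_Y_tilde\<close>). Thus \<open>shuffled_average_tendsto\<close> reduces
  everything to the limit of the expectation of \<open>F y / n\<close> at a fixed \<open>y\<close>, without any uniformity in \<open>y\<close>.

  At a fixed \<open>y\<close>, conditioning on the features replaces indicators by the conditional probability
  \<open>h\<close> evaluated at the features, and it remains to see that \<open>h\<close> hardly changes between
  neighbours. This is clear for a uniformly continuous function, since all but boundedly many points of a
  bounded region have a close neighbour; the general case follows by approximation in mean, the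
  approximation error at the neighbour being controlled by the bounded in-degree again
  (\<open>expectation_nn_form_tendsto\<close>). So \<open>F y / n\<close> tends to the second moment of \<open>h\<close>.

  Replacing the randomly chosen neighbours by their conditional mean is a second application of
  exponential moments, now to independent choices given the data (\<open>tie_breaking_mgf\<close>).
  Finally the limits of the denominators are positive: if one vanished, almost every upper orthant
  event of the response would be a function of the conditioning variable, and these events
  determine the response (\<open>factor_if_upper_events_factor\<close>).
\<close>

section \<open>Nearest-neighbour weights\<close>

definition nn_set :: "'i set \<Rightarrow> ('i \<Rightarrow> 'b::metric_space) \<Rightarrow> 'i \<Rightarrow> 'i set" where
  "nn_set I z i = {j \<in> I - {i}. \<forall>k \<in> I - {i}. dist (z i) (z j) \<le> dist (z i) (z k)}"

text \<open>
  The probability of \<open>j\<close> when the neighbour of \<open>i\<close> is drawn uniformly from the tied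
  candidates. General index sets \<open>I\<close> make it possible to delete records.
\<close>

definition nn_weight :: "'i set \<Rightarrow> ('i \<Rightarrow> 'b::metric_space) \<Rightarrow> 'i \<Rightarrow> 'i \<Rightarrow> real" where
  "nn_weight I z i j = of_bool (j \<in> nn_set I z i) / real (card (nn_set I z i))"

lemma nearest_set_eq: "nearest_set n z i = nn_set {..<n} z i"
  by (simp add: nearest_set_def nn_set_def)

lemma nn_set_subset: "nn_set I z i \<subseteq> I - {i}"
  by (auto simp: nn_set_def)

lemma finite_nn_set: "finite I \<Longrightarrow> finite (nn_set I z i)"
  using nn_set_subset[of I z i] finite_subset by blast

lemma nn_set_nonempty:
  assumes "finite I" "I - {i} \<noteq> {}"
  shows "nn_set I z i \<noteq> {}"
proof -
  obtain j where "j \<in> I - {i}" "\<forall>k \<in> I - {i}. dist (z i) (z j) \<le> dist (z i) (z k)"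
    using ex_min_if_finite[of "(\<lambda>k. dist (z i) (z k)) ` (I - {i})"] assms
    by (auto simp: not_less)
  then show ?thesis by (auto simp: nn_set_def)
qed

lemma nn_weight_nonneg: "0 \<le> nn_weight I z i j"
  by (simp add: nn_weight_def)

lemma nn_weight_le_1: "nn_weight I z i j \<le> 1"
proof (cases "card (nn_set I z i) = 0")
  case False
  then have "1 \<le> real (card (nn_set I z i))" by linarith
  then show ?thesis by (simp add: nn_weight_def)
qed (simp add: nn_weight_def)

lemma nn_weight_self [simp]: "nn_weight I z i i = 0"
  by (simp add: nn_weight_def nn_set_def)

lemma nn_weight_outside: "j \<notin> I \<Longrightarrow> nn_weight I z i j = 0"
  by (simp add: nn_weight_def nn_set_def)

lemma nn_weight_cong:
  assumes "\<And>k. k \<in> I \<Longrightarrow> z k = z' k" "i \<in> I"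
  shows "nn_weight I z i j = nn_weight I z' i j"
proof -
  have "nn_set I z i = nn_set I z' i" using assms by (auto simp: nn_set_def)
  then show ?thesis by (simp add: nn_weight_def)
qed

lemma sum_nn_weight_eq:
  assumes "finite I"
  shows "(\<Sum>j\<in>I. nn_weight I z i j) = of_bool (nn_set I z i \<noteq> {})"
proof -
  have "(\<Sum>j\<in>I. nn_weight I z i j) = (\<Sum>j\<in>nn_set I z i. nn_weight I z i j)"
    using nn_set_subset[of I z i] assms
    by (intro sum.mono_neutral_right) (auto simp: nn_weight_def)
  also have "\<dots> = of_bool (nn_set I z i \<noteq> {})"
    using finite_nn_set[OF assms, of z i] by (simp add: nn_weight_def)
  finally show ?thesis .
qed

lemma sum_nn_weight_le_1: "finite I \<Longrightarrow> (\<Sum>j\<in>I. nn_weight I z i j) \<le> 1"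
  by (simp add: sum_nn_weight_eq)

lemma sum_nn_weight:
  assumes "finite I" "2 \<le> card I"
  shows "(\<Sum>j\<in>I. nn_weight I z i j) = 1"
proof -
  have "I - {i} \<noteq> {}"
  proof
    assume "I - {i} = {}"
    then have "card I \<le> card {i}" by (intro card_mono) auto
    then show False using assms by simp
  qed
  then show ?thesis using assms by (simp add: sum_nn_weight_eq nn_set_nonempty)
qed

text \<open>
  If neither of two points is closer to the other than to the origin, they subtend
  an angle of at least 60 degrees there, which for unit vectors is distance at least one.
\<close>

lemma unit_vectors_separated:
  fixes a b :: "'b::euclidean_space"
  assumes "a \<noteq> 0" "b \<noteq> 0" "norm a \<le> norm b" "norm b \<le> norm (b - a)"
  shows "1 \<le> dist (a /\<^sub>R norm a) (b /\<^sub>R norm b)"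
proof -
  have "(norm b)\<^sup>2 \<le> (norm (b - a))\<^sup>2" using assms(4) by (simp add: power_mono)
  then have "2 * (a \<bullet> b) \<le> (norm a)\<^sup>2"
    by (simp add: power2_norm_eq_inner inner_diff inner_commute)
  also have "\<dots> \<le> norm a * norm b"
    using assms(3) by (simp add: power2_eq_square mult_left_mono)
  finally have "2 * (a \<bullet> b) / (norm a * norm b) \<le> 1"
    using assms by (simp add: divide_le_eq)
  moreover have "(dist (a /\<^sub>R norm a) (b /\<^sub>R norm b))\<^sup>2 = 2 - 2 * (a \<bullet> b) / (norm a * norm b)"
  proof -
    have "norm (a /\<^sub>R norm a) = 1" "norm (b /\<^sub>R norm b) = 1" using assms by auto
    then have "(a /\<^sub>R norm a) \<bullet> (a /\<^sub>R norm a) = 1" "(b /\<^sub>R norm b) \<bullet> (b /\<^sub>R norm b) = 1"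
      by (metis norm_eq_1)+
    moreover have "(dist (a /\<^sub>R norm a) (b /\<^sub>R norm b))\<^sup>2 =
       (a /\<^sub>R norm a) \<bullet> (a /\<^sub>R norm a) + (b /\<^sub>R norm b) \<bullet> (b /\<^sub>R norm b)
         - 2 * ((a /\<^sub>R norm a) \<bullet> (b /\<^sub>R norm b))"
      by (simp only: dist_norm power2_norm_eq_inner inner_diff inner_commute)
    ultimately show ?thesis by (simp add: field_simps)
  qed
  ultimately have "1\<^sup>2 \<le> (dist (a /\<^sub>R norm a) (b /\<^sub>R norm b))\<^sup>2" by simp
  then show ?thesis by (rule power2_le_imp_le) simp
qed

lemma separated_card_bound:
  fixes S :: "'b::metric_space set"
  assumes "compact S" "0 < \<delta>"
  shows "\<exists>N. \<forall>(J :: nat set) u. (\<forall>i\<in>J. u i \<in> S) \<longrightarrow>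
       (\<forall>i\<in>J. \<forall>i'\<in>J. i \<noteq> i' \<longrightarrow> \<delta> \<le> dist (u i) (u i')) \<longrightarrow> card J \<le> N"
proof -
  obtain c where c: "finite c" "c \<subseteq> S" "S \<subseteq> (\<Union>x\<in>c. ball x (\<delta>/2))"
    using assms compactE_image[of S S "\<lambda>x. ball x (\<delta>/2)"] by force
  have "card J \<le> card c"
    if u: "\<forall>i\<in>J. u i \<in> S"
      and sep: "\<forall>i\<in>J. \<forall>i'\<in>J. i \<noteq> i' \<longrightarrow> \<delta> \<le> dist (u i) (u i')"
    for J :: "nat set" and u
  proof -
    have "\<forall>i\<in>J. \<exists>x\<in>c. u i \<in> ball x (\<delta>/2)" using u c(3) by blast
    then obtain f where f: "\<And>i. i \<in> J \<Longrightarrow> f i \<in> c \<and> u i \<in> ball (f i) (\<delta>/2)" by metis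
    have "inj_on f J"
    proof (rule inj_onI, rule ccontr)
      fix i i' assume "i \<in> J" "i' \<in> J" "f i = f i'" "i \<noteq> i'"
      then have "dist (f i) (u i) < \<delta>/2" "dist (f i) (u i') < \<delta>/2" "\<delta> \<le> dist (u i) (u i')"
        using f[of i] f[of i'] sep by auto
      then show False using dist_triangle2[of "u i" "u i'" "f i"] by (simp add: dist_commute)
    qed
    then show ?thesis using f c(1) by (intro card_inj_on_le[of f]) auto
  qed
  then show ?thesis by blast
qed

text \<open>
  Points at positive distance that have \<open>j\<close> as a nearest neighbour lie in separated directions from
  \<open>j\<close>, and the unit sphere has room for boundedly many of these. Points that coincide with \<open>j\<close> may be
  numerous, but each of them shares its weight among all other copies, so that together they
  contribute at most one.
\<close>

lemma nn_in_degree_bounded: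
  obtains C :: real where "0 \<le> C"
    "\<And>I (z :: nat \<Rightarrow> 'b::euclidean_space) j. finite I \<Longrightarrow> (\<Sum>i\<in>I. nn_weight I z i j) \<le> C"
proof -
  have "compact (sphere (0::'b) 1)" by simp
  from separated_card_bound[OF this zero_less_one] obtain N :: nat where
    N: "\<forall>(J :: nat set) (u :: nat \<Rightarrow> 'b). (\<forall>i\<in>J. u i \<in> sphere 0 1) \<longrightarrow>
       (\<forall>i\<in>J. \<forall>i'\<in>J. i \<noteq> i' \<longrightarrow> 1 \<le> dist (u i) (u i')) \<longrightarrow> card J \<le> N" ..
  have card_le: "card J \<le> N"
    if "\<And>i. i \<in> J \<Longrightarrow> u i \<in> sphere 0 1"
      "\<And>i i'. i \<in> J \<Longrightarrow> i' \<in> J \<Longrightarrow> i \<noteq> i' \<Longrightarrow> 1 \<le> dist (u i) (u i')"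
    for J :: "nat set" and u :: "nat \<Rightarrow> 'b"
    using that by (intro N[THEN spec[of _ J], THEN spec[of _ u], THEN mp, THEN mp]) auto
  have "(\<Sum>i\<in>I. nn_weight I z i j) \<le> N + 1" if I: "finite I"
    for I and z :: "nat \<Rightarrow> 'b" and j
  proof -
    define A where "A = {i\<in>I. j \<in> nn_set I z i \<and> z i = z j}"
    define B where "B = {i\<in>I. j \<in> nn_set I z i \<and> z i \<noteq> z j}"
    have fin: "finite A" "finite B" using I by (auto simp: A_def B_def)
    have "(\<Sum>i\<in>I. nn_weight I z i j) = (\<Sum>i\<in>A \<union> B. nn_weight I z i j)"
      using I by (intro sum.mono_neutral_right) (auto simp: A_def B_def nn_weight_def)
    also have "\<dots> = (\<Sum>i\<in>A. nn_weight I z i j) + (\<Sum>i\<in>B. nn_weight I z i j)"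
      using fin by (intro sum.union_disjoint) (auto simp: A_def B_def)
    also have "(\<Sum>i\<in>A. nn_weight I z i j) \<le> (\<Sum>i\<in>A. 1 / card A)"
    proof (rule sum_mono)
      fix i assume i: "i \<in> A"
      then have j: "j \<in> I" "i \<in> I" "z i = z j" "i \<noteq> j" by (auto simp: A_def nn_set_def)
      have "insert j (A - {i}) \<subseteq> nn_set I z i" using i by (auto simp: A_def nn_set_def)
      then have "card (insert j (A - {i})) \<le> card (nn_set I z i)"
        using I by (intro card_mono finite_nn_set)
      moreover have "j \<notin> A" by (auto simp: A_def nn_set_def)
      ultimately have "card A \<le> card (nn_set I z i)"
        using i fin by (simp add: card_gt_0_iff)
      moreover have "0 < card A" using i fin by (auto simp: card_gt_0_iff)
      ultimately show "nn_weight I z i j \<le> 1 / card A"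
        by (auto simp: nn_weight_def intro!: divide_left_mono mult_pos_pos)
    qed
    also have "(\<Sum>i\<in>A. 1 / card A) \<le> 1" by simp
    also have "(\<Sum>i\<in>B. nn_weight I z i j) \<le> (\<Sum>i\<in>B. 1)" by (intro sum_mono nn_weight_le_1)
    also have "\<dots> = card B" by simp
    also have "card B \<le> N"
    proof (rule card_le[of B "\<lambda>i. (z i - z j) /\<^sub>R norm (z i - z j)"])
      have le: "norm (z i' - z j) \<le> norm (z i' - z i)" if "i \<in> B" "i' \<in> B" "i \<noteq> i'" for i i'
        using that by (auto simp: B_def nn_set_def dist_norm)
      fix i i' assume *: "i \<in> B" "i' \<in> B" "i \<noteq> i'"
      have nz: "z i - z j \<noteq> 0" "z i' - z j \<noteq> 0" using * by (auto simp: B_def)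
      show "1 \<le> dist ((z i - z j) /\<^sub>R norm (z i - z j)) ((z i' - z j) /\<^sub>R norm (z i' - z j))"
      proof (cases "norm (z i - z j) \<le> norm (z i' - z j)")
        case True
        then show ?thesis
          using unit_vectors_separated[of "z i - z j" "z i' - z j"] nz le[of i i'] * by simp
      next
        case False
        then show ?thesis
          using unit_vectors_separated[of "z i' - z j" "z i - z j"] nz le[of i' i] *
          by (simp add: dist_commute)
      qed
    qed (auto simp: B_def)
    finally show ?thesis by simp
  qed
  then show thesis using that[of "N + 1"] by simp
qed

text \<open>
  Isolated points of the sample are separated from each other, so a bounded region contains
  boundedly many of them: in a large sample almost every point of the region has a close neighbour.
\<close>

lemma isolated_points_bounded:
  fixes R \<delta> :: real
  assumes "0 < \<delta>"
  obtains N :: nat where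
    "\<And>I (z :: nat \<Rightarrow> 'b::euclidean_space).
       card {i\<in>I. norm (z i) \<le> R \<and> (\<forall>j\<in>I - {i}. \<delta> \<le> dist (z i) (z j))} \<le> N"
proof -
  from separated_card_bound[OF compact_cball[of "0::'b" R] assms] obtain N :: nat where
    N: "\<forall>(J :: nat set) (u :: nat \<Rightarrow> 'b). (\<forall>i\<in>J. u i \<in> cball 0 R) \<longrightarrow>
       (\<forall>i\<in>J. \<forall>i'\<in>J. i \<noteq> i' \<longrightarrow> \<delta> \<le> dist (u i) (u i')) \<longrightarrow> card J \<le> N" ..
  have "card {i\<in>I. norm (z i) \<le> R \<and> (\<forall>j\<in>I - {i}. \<delta> \<le> dist (z i) (z j))} \<le> N"
    (is "card ?J \<le> N") for I and z :: "nat \<Rightarrow> 'b"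
  proof -
    have "\<forall>i\<in>?J. z i \<in> cball 0 R" by simp
    moreover have "\<forall>i\<in>?J. \<forall>i'\<in>?J. i \<noteq> i' \<longrightarrow> \<delta> \<le> dist (z i) (z i')" by blast
    ultimately show ?thesis by (intro N[THEN spec[of _ ?J], THEN spec[of _ z], THEN mp, THEN mp])
  qed
  then show thesis by (rule that)
qed

text \<open>
  The neighbour set of \<open>i\<close> changes only if \<open>k\<close> belongs to it. If other candidates remain, the mass
  of \<open>k\<close> is spread over them; if \<open>k\<close> was the only one, the entire mass of one moves.
\<close>

lemma nn_weight_removal:
  assumes I: "finite I" "k \<in> I" "i \<in> I" "i \<noteq> k"
  shows "(\<Sum>j\<in>I. \<bar>nn_weight I z i j - nn_weight (I - {k}) z i j\<bar>) \<le> 2 * nn_weight I z i k"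
proof -
  let ?S = "nn_set I z i" and ?T = "nn_set (I - {k}) z i"
  have ne: "?S \<noteq> {}" using I by (intro nn_set_nonempty) auto
  have fin: "finite ?S" "finite ?T" using I by (auto intro: finite_nn_set)
  show ?thesis
  proof (cases "?S = {k}")
    case True
    have "(\<Sum>j\<in>I. \<bar>nn_weight I z i j - nn_weight (I - {k}) z i j\<bar>)
       \<le> (\<Sum>j\<in>I. nn_weight I z i j + nn_weight (I - {k}) z i j)"
      by (intro sum_mono) (smt (verit) nn_weight_nonneg)
    also have "\<dots> = (\<Sum>j\<in>I. nn_weight I z i j) + (\<Sum>j\<in>I. nn_weight (I - {k}) z i j)"
      by (simp add: sum.distrib)
    also have "(\<Sum>j\<in>I. nn_weight (I - {k}) z i j) = (\<Sum>j\<in>I - {k}. nn_weight (I - {k}) z i j)"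
      using I by (intro sum.mono_neutral_right) (auto simp: nn_weight_outside)
    also have "(\<Sum>j\<in>I. nn_weight I z i j) + \<dots> \<le> 1 + 1"
      using I by (intro add_mono sum_nn_weight_le_1) auto
    also have "\<dots> = 2 * nn_weight I z i k" using True by (simp add: nn_weight_def)
    finally show ?thesis .
  next
    case False
    then obtain s where s: "s \<in> ?S" "s \<noteq> k" using ne by blast
    have T: "?T = ?S - {k}"
    proof
      show "?S - {k} \<subseteq> ?T" by (auto simp: nn_set_def)
      show "?T \<subseteq> ?S - {k}"
      proof
        fix j assume j: "j \<in> ?T"
        have "dist (z i) (z j) \<le> dist (z i) (z s)" using j s by (auto simp: nn_set_def)
        moreover have "dist (z i) (z s) \<le> dist (z i) (z m)" if "m \<in> I - {i}" for m
          using s that by (auto simp: nn_set_def)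
        ultimately show "j \<in> ?S - {k}" using j by (fastforce simp: nn_set_def)
      qed
    qed
    show ?thesis
    proof (cases "k \<in> ?S")
      case kS: False
      then have "?T = ?S" using T by simp
      then show ?thesis by (simp add: nn_weight_def)
    next
      case kS: True
      define m where "m = card ?S"
      have m: "card ?T = m - 1" using T kS fin by (simp add: m_def)
      have "card {k, s} \<le> m" unfolding m_def using kS s fin by (intro card_mono) auto
      then have m2: "2 \<le> m" using s by simp
      have "(\<Sum>j\<in>I. \<bar>nn_weight I z i j - nn_weight (I - {k}) z i j\<bar>)
          = (\<Sum>j\<in>?S. \<bar>nn_weight I z i j - nn_weight (I - {k}) z i j\<bar>)"
        using I T nn_set_subset[of I z i]
        by (intro sum.mono_neutral_right) (auto simp: nn_weight_def)
      also have "\<dots> = \<bar>nn_weight I z i k - nn_weight (I - {k}) z i k\<bar>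
          + (\<Sum>j\<in>?T. \<bar>nn_weight I z i j - nn_weight (I - {k}) z i j\<bar>)"
        unfolding T using fin(1) kS by (rule sum.remove)
      also have "(\<Sum>j\<in>?T. \<bar>nn_weight I z i j - nn_weight (I - {k}) z i j\<bar>)
          = (\<Sum>j\<in>?T. 1 / real (m - 1) - 1 / real m)"
      proof (rule sum.cong[OF refl])
        fix j assume j: "j \<in> ?T"
        have "1 / real m \<le> 1 / real (m - 1)" using m2 by (intro divide_left_mono) auto
        moreover have "j \<in> ?S" using j T by blast
        ultimately show "\<bar>nn_weight I z i j - nn_weight (I - {k}) z i j\<bar> = 1 / real (m - 1) - 1 / real m"
          using j by (simp add: nn_weight_def m m_def[symmetric])
      qed
      also have "\<dots> = 1 / real m" using m m2 by (simp add: field_simps of_nat_diff)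
      also have "\<bar>nn_weight I z i k - nn_weight (I - {k}) z i k\<bar> = 1 / real m"
        using kS T by (simp add: nn_weight_def m_def)
      finally show ?thesis using kS by (simp add: nn_weight_def m_def)
    qed
  qed
qed

text \<open>
  For \<open>f\<close> the indicator of a property, this is the expected number of \<open>i\<close> for which both \<open>i\<close> and
  its randomly chosen nearest neighbour have the property.
\<close>

definition nn_form :: "'i set \<Rightarrow> ('i \<Rightarrow> 'b::metric_space) \<Rightarrow> ('i \<Rightarrow> real) \<Rightarrow> real" where
  "nn_form I z f = (\<Sum>i\<in>I. \<Sum>j\<in>I. nn_weight I z i j * f i * f j)"

lemma nn_form_nonneg: "(\<And>i. 0 \<le> f i) \<Longrightarrow> 0 \<le> nn_form I z f"
  unfolding nn_form_def by (intro sum_nonneg mult_nonneg_nonneg nn_weight_nonneg)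

lemma nn_form_le_card:
  assumes "finite I" "\<And>i. 0 \<le> f i" "\<And>i. f i \<le> 1"
  shows "nn_form I z f \<le> card I"
proof -
  have "nn_form I z f \<le> (\<Sum>i\<in>I. \<Sum>j\<in>I. nn_weight I z i j * 1 * 1)"
    unfolding nn_form_def
    by (intro sum_mono mult_mono mult_nonneg_nonneg nn_weight_nonneg assms order_refl) auto
  also have "\<dots> \<le> (\<Sum>i\<in>I. 1)"
    by (intro sum_mono) (simp add: sum_nn_weight_le_1 assms)
  finally show ?thesis by simp
qed

lemma nn_form_cong:
  assumes "\<And>i. i \<in> I \<Longrightarrow> z i = z' i" "\<And>i. i \<in> I \<Longrightarrow> f i = f' i"
  shows "nn_form I z f = nn_form I z' f'"
  unfolding nn_form_def using assms
  by (intro sum.cong refl arg_cong2[where f="(*)"] nn_weight_cong) auto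

text \<open>
  Row \<open>k\<close> contributes at most one, and the other rows change by at most twice the weight that they
  put on \<open>k\<close>.
\<close>

lemma nn_form_removal:
  fixes z :: "nat \<Rightarrow> 'b::metric_space"
  assumes C: "(\<Sum>i\<in>I. nn_weight I z i k) \<le> C"
    and I: "finite I" "k \<in> I" and f: "\<And>i. 0 \<le> f i" "\<And>i. f i \<le> 1"
  shows "\<bar>nn_form I z f - nn_form (I - {k}) z f\<bar> \<le> 2 * C + 1"
proof -
  have ff: "\<bar>w * f i * f j\<bar> \<le> \<bar>w\<bar>" for w i j
  proof -
    have "\<bar>f i * f j\<bar> \<le> 1" using f by (simp add: abs_mult mult_le_one)
    then show ?thesis using mult_left_mono[of "\<bar>f i * f j\<bar>" 1 "\<bar>w\<bar>"] by (simp add: abs_mult mult.assoc)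
  qed
  have "nn_form (I - {k}) z f = (\<Sum>i\<in>I - {k}. \<Sum>j\<in>I. nn_weight (I - {k}) z i j * f i * f j)"
    unfolding nn_form_def using I
    by (intro sum.cong refl sum.mono_neutral_left) (auto simp: nn_weight_outside)
  moreover have "nn_form I z f = (\<Sum>j\<in>I. nn_weight I z k j * f k * f j)
      + (\<Sum>i\<in>I - {k}. \<Sum>j\<in>I. nn_weight I z i j * f i * f j)"
    unfolding nn_form_def using I by (rule sum.remove)
  ultimately have "nn_form I z f - nn_form (I - {k}) z f = (\<Sum>j\<in>I. nn_weight I z k j * f k * f j)
      + (\<Sum>i\<in>I - {k}. \<Sum>j\<in>I. (nn_weight I z i j - nn_weight (I - {k}) z i j) * f i * f j)"
    by (simp add: left_diff_distrib sum_subtractf)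
  moreover have "\<bar>\<Sum>j\<in>I. nn_weight I z k j * f k * f j\<bar> \<le> 1"
  proof -
    have "\<bar>\<Sum>j\<in>I. nn_weight I z k j * f k * f j\<bar> \<le> (\<Sum>j\<in>I. nn_weight I z k j)"
      by (rule order_trans[OF sum_abs], rule sum_mono)
        (metis ff abs_of_nonneg nn_weight_nonneg)
    also have "\<dots> \<le> 1" using I by (intro sum_nn_weight_le_1)
    finally show ?thesis .
  qed
  moreover have "\<bar>\<Sum>i\<in>I - {k}. \<Sum>j\<in>I. (nn_weight I z i j - nn_weight (I - {k}) z i j) * f i * f j\<bar>
      \<le> 2 * C"
  proof -
    have "\<bar>\<Sum>i\<in>I - {k}. \<Sum>j\<in>I. (nn_weight I z i j - nn_weight (I - {k}) z i j) * f i * f j\<bar>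
      \<le> (\<Sum>i\<in>I - {k}. \<Sum>j\<in>I. \<bar>nn_weight I z i j - nn_weight (I - {k}) z i j\<bar>)"
      by (rule order_trans[OF sum_abs], rule sum_mono, rule order_trans[OF sum_abs],
        rule sum_mono, rule ff)
    also have "\<dots> \<le> (\<Sum>i\<in>I - {k}. 2 * nn_weight I z i k)"
      using I by (intro sum_mono nn_weight_removal) auto
    also have "\<dots> = 2 * (\<Sum>i\<in>I. nn_weight I z i k)"
      using I by (subst sum.remove[of I k]) (simp_all add: sum_distrib_left)
    finally show ?thesis using C by simp
  qed
  ultimately show ?thesis by linarith
qed

text \<open>
  The weight is a quotient of finite sums of indicators, each of a finite conjunction of
  comparisons between distances.
\<close>

lemma borel_measurable_nn_weight:
  fixes z :: "'i \<Rightarrow> 'm \<Rightarrow> 'b::{second_countable_topology, metric_space}"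
  assumes I: "finite I" "i \<in> I" and z: "\<And>k. k \<in> I \<Longrightarrow> z k \<in> borel_measurable M"
  shows "(\<lambda>\<omega>. nn_weight I (\<lambda>k. z k \<omega>) i j) \<in> borel_measurable M"
proof -
  have mem: "Measurable.pred M (\<lambda>\<omega>. k \<in> nn_set I (\<lambda>k. z k \<omega>) i)" for k
  proof (cases "k \<in> I - {i}")
    case True
    note [measurable] = z[OF I(2)] z[of k]
    have "Measurable.pred M (\<lambda>\<omega>. \<forall>m\<in>I - {i}. dist (z i \<omega>) (z k \<omega>) \<le> dist (z i \<omega>) (z m \<omega>))"
    proof (intro pred_intros_finite)
      fix m assume "m \<in> I - {i}"
      then have [measurable]: "z m \<in> borel_measurable M" "z k \<in> borel_measurable M" using z True by auto
      show "Measurable.pred M (\<lambda>\<omega>. dist (z i \<omega>) (z k \<omega>) \<le> dist (z i \<omega>) (z m \<omega>))" by measurable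
    qed (use I in simp)
    then show ?thesis using True by (simp add: nn_set_def)
  next
    case False
    then have "k \<notin> nn_set I (\<lambda>k. z k \<omega>) i" for \<omega> using nn_set_subset[of I "\<lambda>k. z k \<omega>" i] by auto
    then show ?thesis by simp
  qed
  have "card (nn_set I (\<lambda>k. z k \<omega>) i) = (\<Sum>k\<in>I. of_bool (k \<in> nn_set I (\<lambda>k. z k \<omega>) i))" for \<omega>
  proof -
    have "I \<inter> nn_set I (\<lambda>k. z k \<omega>) i = nn_set I (\<lambda>k. z k \<omega>) i"
      using nn_set_subset[of I "\<lambda>k. z k \<omega>" i] by auto
    then show ?thesis using I by (simp add: Int_def[symmetric])
  qed
  then have "nn_weight I (\<lambda>k. z k \<omega>) i j = of_bool (j \<in> nn_set I (\<lambda>k. z k \<omega>) i)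
      / (\<Sum>k\<in>I. of_bool (k \<in> nn_set I (\<lambda>k. z k \<omega>) i))" for \<omega>
    by (simp add: nn_weight_def del: sum_of_bool_eq)
  moreover have "(\<lambda>\<omega>. of_bool (k \<in> nn_set I (\<lambda>k. z k \<omega>) i) :: real) \<in> borel_measurable M" for k
    using mem[of k] by measurable
  ultimately show ?thesis by (simp only:) (intro borel_measurable_divide borel_measurable_sum)
qed

lemma borel_measurable_nn_form:
  fixes z :: "'i \<Rightarrow> 'm \<Rightarrow> 'b::{second_countable_topology, metric_space}"
  assumes "finite I" "\<And>k. k \<in> I \<Longrightarrow> z k \<in> borel_measurable M"
    "\<And>k. k \<in> I \<Longrightarrow> f k \<in> borel_measurable M"
  shows "(\<lambda>\<omega>. nn_form I (\<lambda>k. z k \<omega>) (\<lambda>k. f k \<omega>)) \<in> borel_measurable M"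
  unfolding nn_form_def using assms
  by (intro borel_measurable_sum borel_measurable_times borel_measurable_nn_weight) auto

section \<open>Concentration of functions of independent records\<close>

text \<open>
  Hoeffding's lemma for both signs of \<open>l\<close>, in terms of the distance to a reference value \<open>a\<close>. With bounded
  differences, \<open>a\<close> is the value of \<open>f\<close> at any fixed point.
\<close>

lemma (in prob_space) hoeffding_mgf:
  fixes f :: "'a \<Rightarrow> real" and a c l :: real
  assumes f [measurable]: "f \<in> borel_measurable M"
    and c: "\<And>x. x \<in> space M \<Longrightarrow> \<bar>f x - a\<bar> \<le> c"
  shows "(\<integral>x. exp (l * (f x - expectation f)) \<partial>M) \<le> exp (l\<^sup>2 * c\<^sup>2 / 2)"
proof -
  have pos: "(\<integral>x. exp (l * (g x - expectation g)) \<partial>M) \<le> exp (l\<^sup>2 * c\<^sup>2 / 2)"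
    if [measurable]: "g \<in> borel_measurable M"
      and g: "\<And>x. x \<in> space M \<Longrightarrow> \<bar>g x - b\<bar> \<le> c" and l: "0 < l" for g and b l :: real
  proof -
    interpret interval_bounded_random_variable M g "b - c" "b + c"
      using g by unfold_locales (auto simp: abs_le_iff algebra_simps)
    have "(\<integral>\<^sup>+x. exp (l * (g x - expectation g)) \<partial>M) \<le> ennreal (exp (l\<^sup>2 * ((b + c) - (b - c))\<^sup>2 / 8))"
      by (rule Hoeffdings_lemma_nn_integral[OF l])
    also have "l\<^sup>2 * ((b + c) - (b - c))\<^sup>2 / 8 = l\<^sup>2 * c\<^sup>2 / 2"
      by (simp add: power2_eq_square algebra_simps)
    finally show ?thesis by (intro integral_real_bounded) auto
  qed
  show ?thesis
  proof (cases l "0 :: real" rule: linorder_cases)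
    case less
    have "(\<integral>x. exp ((- l) * (- f x - expectation (\<lambda>x. - f x))) \<partial>M) \<le> exp ((- l)\<^sup>2 * c\<^sup>2 / 2)"
    proof (rule pos[of "\<lambda>x. - f x" "- a" "- l"])
      show "\<bar>- f x - - a\<bar> \<le> c" if "x \<in> space M" for x using c[OF that] by linarith
    qed (use less in auto)
    then show ?thesis by (simp add: algebra_simps)
  next
    case equal
    then show ?thesis by (simp add: prob_space)
  next
    case greater
    then show ?thesis using pos[OF f c] by simp
  qed
qed

text \<open>
  McDiarmid's bounded difference inequality in exponential form. Integrating out one coordinate keeps
  the bounded differences of the remaining ones, and the fluctuation in that coordinate is handled
  by Hoeffding's lemma.
\<close>

lemma mcdiarmid_mgf:
  fixes f :: "('i \<Rightarrow> 'r) \<Rightarrow> real"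
  assumes "prob_space \<mu>" "finite I"
    and "f \<in> borel_measurable (\<Pi>\<^sub>M i\<in>I. \<mu>)"
    and "\<And>x. x \<in> space (\<Pi>\<^sub>M i\<in>I. \<mu>) \<Longrightarrow> \<bar>f x\<bar> \<le> B"
    and "\<And>x k v. x \<in> space (\<Pi>\<^sub>M i\<in>I. \<mu>) \<Longrightarrow> k \<in> I \<Longrightarrow> v \<in> space \<mu> \<Longrightarrow> \<bar>f (x(k := v)) - f x\<bar> \<le> c"
  shows "(\<integral>x. exp (l * (f x - (\<integral>x. f x \<partial>(\<Pi>\<^sub>M i\<in>I. \<mu>)))) \<partial>(\<Pi>\<^sub>M i\<in>I. \<mu>))
    \<le> exp (real (card I) * (l\<^sup>2 * c\<^sup>2 / 2))"
  using assms(2-)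
proof (induction I arbitrary: f rule: finite_induct)
  case empty
  then show ?case
    using prob_space.prob_space[OF prob_space_PiM, of "{}" "\<lambda>_. \<mu>"]
    by (simp add: PiM_empty lebesgue_integral_count_space_finite)
next
  case (insert k I)
  interpret mu: prob_space \<mu> by fact
  interpret product_prob_space "\<lambda>_::'i. \<mu>" by unfold_locales
  interpret PI: prob_space "\<Pi>\<^sub>M i\<in>I. \<mu>" by (rule prob_space_PiM) unfold_locales
  interpret PkI: prob_space "\<Pi>\<^sub>M i\<in>insert k I. \<mu>" by (rule prob_space_PiM) unfold_locales
  note f [measurable] = insert.prems(1) and B = insert.prems(2) and c = insert.prems(3)
  have sp: "x(k := v) \<in> space (\<Pi>\<^sub>M i\<in>insert k I. \<mu>)" if "x \<in> space (\<Pi>\<^sub>M i\<in>I. \<mu>)" "v \<in> space \<mu>" for x v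
    using that by (auto simp: space_PiM PiE_def extensional_def)
  have [measurable]: "(\<lambda>(x, v). x(k := v)) \<in> (\<Pi>\<^sub>M i\<in>I. \<mu>) \<Otimes>\<^sub>M \<mu> \<rightarrow>\<^sub>M (\<Pi>\<^sub>M i\<in>insert k I. \<mu>)"
    using measurable_add_dim[of k I "\<lambda>_. \<mu>"] by simp
  have [measurable]: "(\<lambda>(x, v). f (x(k := v))) \<in> borel_measurable ((\<Pi>\<^sub>M i\<in>I. \<mu>) \<Otimes>\<^sub>M \<mu>)"
    using measurable_compose[OF _ f, of "\<lambda>(x, v). x(k := v)" "(\<Pi>\<^sub>M i\<in>I. \<mu>) \<Otimes>\<^sub>M \<mu>"]
    by (simp add: split_beta')
  have [measurable]: "(\<lambda>v. f (x(k := v))) \<in> borel_measurable \<mu>" if "x \<in> space (\<Pi>\<^sub>M i\<in>I. \<mu>)" for x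
    using measurable_Pair2[of "\<lambda>(x, v). f (x(k := v))" "\<Pi>\<^sub>M i\<in>I. \<mu>" \<mu> borel x] that by simp
  have int1: "integrable \<mu> (\<lambda>v. f (x(k := v)))" if "x \<in> space (\<Pi>\<^sub>M i\<in>I. \<mu>)" for x
    using B sp that by (intro mu.integrable_const_bound[of _ B] AE_I2) auto
  have B0: "0 \<le> B"
    using PkI.not_empty B by (meson abs_ge_zero ex_in_conv order_trans)
  define g where "g x = (\<integral>v. f (x(k := v)) \<partial>\<mu>)" for x
  have [measurable]: "g \<in> borel_measurable (\<Pi>\<^sub>M i\<in>I. \<mu>)" unfolding g_def by measurable
  have gB: "\<bar>g x\<bar> \<le> B" if "x \<in> space (\<Pi>\<^sub>M i\<in>I. \<mu>)" for x
  proof -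
    have "\<bar>g x\<bar> \<le> (\<integral>v. \<bar>f (x(k := v))\<bar> \<partial>\<mu>)" unfolding g_def by (rule integral_abs_bound)
    also have "\<dots> \<le> (\<integral>v. B \<partial>\<mu>)" using that B sp int1 by (intro integral_mono) auto
    finally show ?thesis by (simp add: mu.prob_space)
  qed
  have intf: "integrable (\<Pi>\<^sub>M i\<in>insert k I. \<mu>) f"
    using B by (intro PkI.integrable_const_bound[of _ B] AE_I2) auto
  have Ef: "(\<integral>x. f x \<partial>(\<Pi>\<^sub>M i\<in>insert k I. \<mu>)) = (\<integral>x. g x \<partial>(\<Pi>\<^sub>M i\<in>I. \<mu>))"
    unfolding g_def by (rule product_integral_insert) (use insert intf in auto)
  define E where "E = (\<integral>x. g x \<partial>(\<Pi>\<^sub>M i\<in>I. \<mu>))"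
  have EB: "\<bar>E\<bar> \<le> B"
  proof -
    have "\<bar>E\<bar> \<le> (\<integral>x. \<bar>g x\<bar> \<partial>(\<Pi>\<^sub>M i\<in>I. \<mu>))" unfolding E_def by (rule integral_abs_bound)
    also have "\<dots> \<le> (\<integral>x. B \<partial>(\<Pi>\<^sub>M i\<in>I. \<mu>))"
      using gB B0 by (intro integral_mono PI.integrable_const_bound[of _ B] AE_I2) auto
    finally show ?thesis by (simp add: PI.prob_space)
  qed
  have expB: "\<bar>exp (l * (u - E))\<bar> \<le> exp (\<bar>l\<bar> * (2 * B))" if "\<bar>u\<bar> \<le> B" for u
  proof -
    have "l * (u - E) \<le> \<bar>l\<bar> * \<bar>u - E\<bar>" by (metis abs_ge_self abs_mult)
    also have "\<dots> \<le> \<bar>l\<bar> * (2 * B)" using that EB by (intro mult_left_mono) auto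
    finally show ?thesis by simp
  qed
  have inth: "(\<integral>x. exp (l * (g x - E)) \<partial>(\<Pi>\<^sub>M i\<in>I. \<mu>)) \<le> exp (real (card I) * (l\<^sup>2 * c\<^sup>2 / 2))"
    unfolding E_def
  proof (rule insert.IH)
    fix x j v assume x: "x \<in> space (\<Pi>\<^sub>M i\<in>I. \<mu>)" and j: "j \<in> I" and v: "v \<in> space \<mu>"
    have x': "x(j := v) \<in> space (\<Pi>\<^sub>M i\<in>I. \<mu>)"
      using x j v by (auto simp: space_PiM PiE_def extensional_def)
    have "g (x(j := v)) - g x = (\<integral>w. f (x(j := v, k := w)) - f (x(k := w)) \<partial>\<mu>)"
      unfolding g_def using int1 x x' by simp
    also have "\<bar>\<dots>\<bar> \<le> (\<integral>w. \<bar>f (x(j := v, k := w)) - f (x(k := w))\<bar> \<partial>\<mu>)"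
      by (rule integral_abs_bound)
    also have "\<dots> \<le> (\<integral>w. c \<partial>\<mu>)"
    proof (intro integral_mono)
      fix w assume w: "w \<in> space \<mu>"
      have "j \<noteq> k" using insert j by auto
      then have "x(j := v, k := w) = x(k := w, j := v)" by (rule fun_upd_twist)
      moreover have "\<bar>f (x(k := w, j := v)) - f (x(k := w))\<bar> \<le> c"
        by (rule c[OF sp[OF x w]]) (use j v in auto)
      ultimately show "\<bar>f (x(j := v, k := w)) - f (x(k := w))\<bar> \<le> c" by (simp only:)
    qed (use int1 x x' in auto)
    finally show "\<bar>g (x(j := v)) - g x\<bar> \<le> c" by (simp add: mu.prob_space)
  qed (use gB in auto)
  have inner: "(\<integral>v. exp (l * (f (x(k := v)) - E)) \<partial>\<mu>) \<le> exp (l\<^sup>2 * c\<^sup>2 / 2) * exp (l * (g x - E))"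
    if x: "x \<in> space (\<Pi>\<^sub>M i\<in>I. \<mu>)" for x
  proof -
    obtain w where w: "w \<in> space \<mu>" using mu.not_empty by auto
    have "(\<integral>v. exp (l * (f (x(k := v)) - mu.expectation (\<lambda>v. f (x(k := v))))) \<partial>\<mu>) \<le> exp (l\<^sup>2 * c\<^sup>2 / 2)"
    proof (rule mu.hoeffding_mgf[where a = "f (x(k := w))"])
      fix v assume "v \<in> space \<mu>"
      then have "\<bar>f (x(k := w, k := v)) - f (x(k := w))\<bar> \<le> c"
        by (intro c[OF sp[OF x w]]) auto
      then show "\<bar>f (x(k := v)) - f (x(k := w))\<bar> \<le> c" by (simp only: fun_upd_upd)
    qed (use x in measurable)
    moreover have "(\<integral>v. exp (l * (f (x(k := v)) - E)) \<partial>\<mu>)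
      = (\<integral>v. exp (l * (f (x(k := v)) - g x)) * exp (l * (g x - E)) \<partial>\<mu>)"
      by (simp add: exp_add[symmetric] algebra_simps)
    ultimately show ?thesis by (simp add: g_def mult_right_mono)
  qed
  have "(\<integral>x. exp (l * (f x - E)) \<partial>(\<Pi>\<^sub>M i\<in>insert k I. \<mu>))
     = (\<integral>x. (\<integral>v. exp (l * (f (x(k := v)) - E)) \<partial>\<mu>) \<partial>(\<Pi>\<^sub>M i\<in>I. \<mu>))"
    using insert expB B
    by (intro product_integral_insert PkI.integrable_const_bound[of _ "exp (\<bar>l\<bar> * (2 * B))"] AE_I2) auto
  also have "\<dots> \<le> (\<integral>x. exp (l\<^sup>2 * c\<^sup>2 / 2) * exp (l * (g x - E)) \<partial>(\<Pi>\<^sub>M i\<in>I. \<mu>))"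
  proof (rule integral_mono_AE)
    show "integrable (\<Pi>\<^sub>M i\<in>I. \<mu>) (\<lambda>x. exp (l\<^sup>2 * c\<^sup>2 / 2) * exp (l * (g x - E)))"
      using expB gB by (intro integrable_mult_right PI.integrable_const_bound[of _ "exp (\<bar>l\<bar> * (2 * B))"] AE_I2) auto
    have *: "\<bar>\<integral>v. exp (l * (f (x(k := v)) - E)) \<partial>\<mu>\<bar> \<le> exp (\<bar>l\<bar> * (2 * B))"
      if x: "x \<in> space (\<Pi>\<^sub>M i\<in>I. \<mu>)" for x
    proof -
      have "\<bar>\<integral>v. exp (l * (f (x(k := v)) - E)) \<partial>\<mu>\<bar> \<le> (\<integral>v. \<bar>exp (l * (f (x(k := v)) - E))\<bar> \<partial>\<mu>)"
        by (rule integral_abs_bound)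
      also have "\<dots> \<le> (\<integral>v. exp (\<bar>l\<bar> * (2 * B)) \<partial>\<mu>)"
        by (intro integral_mono mu.integrable_const_bound[of _ "exp (\<bar>l\<bar> * (2 * B))"] AE_I2)
          (use expB[OF B[OF sp[OF x]]] x in \<open>simp_all del: fun_upd_apply\<close>)
      finally show ?thesis by (simp add: mu.prob_space)
    qed
    show "integrable (\<Pi>\<^sub>M i\<in>I. \<mu>) (\<lambda>x. \<integral>v. exp (l * (f (x(k := v)) - E)) \<partial>\<mu>)"
      using * by (intro PI.integrable_const_bound[of _ "exp (\<bar>l\<bar> * (2 * B))"] AE_I2) auto
    show "AE x in (\<Pi>\<^sub>M i\<in>I. \<mu>). (\<integral>v. exp (l * (f (x(k := v)) - E)) \<partial>\<mu>)
        \<le> exp (l\<^sup>2 * c\<^sup>2 / 2) * exp (l * (g x - E))"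
      using inner by (intro AE_I2) auto
  qed
  also have "\<dots> \<le> exp (l\<^sup>2 * c\<^sup>2 / 2) * exp (real (card I) * (l\<^sup>2 * c\<^sup>2 / 2))"
    using inth by simp
  also have "\<dots> = exp (real (card (insert k I)) * (l\<^sup>2 * c\<^sup>2 / 2))"
    using insert by (simp add: exp_add[symmetric] algebra_simps)
  finally show ?case unfolding Ef E_def .
qed

text \<open>
  The Chernoff bound makes the tail probabilities geometric in \<open>n\<close>, so the Borel-Cantelli lemma
  applies. The bound concerns each \<open>n\<close> separately, so the conclusion also serves indices that are drawn
  anew for each sample size, whatever their joint law.
\<close>

lemma (in prob_space) subgaussian_tendsto_0:
  fixes A :: "nat \<Rightarrow> 'a \<Rightarrow> real"
  assumes A [measurable]: "\<And>n. n \<ge> n0 \<Longrightarrow> A n \<in> borel_measurable M"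
    and int: "\<And>n l. n \<ge> n0 \<Longrightarrow> integrable M (\<lambda>\<omega>. exp (l * A n \<omega>))"
    and mgf: "\<And>n l. n \<ge> n0 \<Longrightarrow> (\<integral>\<omega>. exp (l * A n \<omega>) \<partial>M) \<le> exp (K * l\<^sup>2 / real n)"
    and K: "0 < K"
  shows "AE \<omega> in M. (\<lambda>n. A n \<omega>) \<longlonglongrightarrow> 0"
proof -
  define n1 where "n1 = Suc n0"
  have ev: "AE \<omega> in M. eventually (\<lambda>n. \<bar>A n \<omega>\<bar> < \<epsilon>) sequentially" if \<epsilon>: "0 < \<epsilon>" for \<epsilon>
  proof -
    have tail: "prob {\<omega> \<in> space M. s * A n \<omega> \<ge> \<epsilon>} \<le> exp (- (\<epsilon>\<^sup>2 / (4 * K)) * n)"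
      if n: "n \<ge> n1" and s: "s = 1 \<or> s = -1" for n s
    proof -
      have n': "n \<ge> n0" "0 < n" using n by (auto simp: n1_def)
      note [measurable] = A[OF n'(1)]
      \<comment> \<open>The minimiser of \<open>K * l\<^sup>2 / n - l * \<epsilon>\<close>.\<close>
      define l where "l = \<epsilon> * n / (2 * K)"
      have l: "0 < l" using \<epsilon> K n' by (simp add: l_def)
      have "{\<omega> \<in> space M. s * A n \<omega> \<ge> \<epsilon>} = {\<omega> \<in> space M. exp (l * \<epsilon>) \<le> exp (l * s * A n \<omega>)}"
        using l by (auto simp: mult.assoc)
      then have "prob {\<omega> \<in> space M. s * A n \<omega> \<ge> \<epsilon>} \<le> (\<integral>\<omega>. exp (l * s * A n \<omega>) \<partial>M) / exp (l * \<epsilon>)"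
        using integral_Markov_inequality_measure[OF int[OF n'(1), of "l * s"], of "space M" "exp (l * \<epsilon>)"]
        by auto
      also have "\<dots> \<le> exp (K * (l * s)\<^sup>2 / n) / exp (l * \<epsilon>)"
        using mgf[OF n'(1), of "l * s"] by (intro divide_right_mono) auto
      also have "(l * s)\<^sup>2 = l\<^sup>2" using s by (auto simp: power_mult_distrib)
      also have "exp (K * l\<^sup>2 / n) / exp (l * \<epsilon>) = exp (K * l\<^sup>2 / n - l * \<epsilon>)" by (simp add: exp_diff)
      also have "K * l\<^sup>2 / n - l * \<epsilon> = - (\<epsilon>\<^sup>2 / (4 * K)) * n"
        using K n' by (simp add: l_def power2_eq_square field_simps)
      finally show ?thesis .
    qed
    define r where "r = exp (- (\<epsilon>\<^sup>2 / (4 * K)))"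
    have r: "0 < r" "r < 1" using \<epsilon> K by (auto simp: r_def)
    have r_pow: "exp (- (\<epsilon>\<^sup>2 / (4 * K)) * real n) = r ^ n" for n
      by (simp add: r_def exp_of_nat_mult[symmetric] mult.commute)
    define S where "S n = (if n \<ge> n1 then {\<omega> \<in> space M. \<bar>A n \<omega>\<bar> \<ge> \<epsilon>} else {})" for n
    have [measurable]: "S n \<in> sets M" for n
    proof (cases "n \<ge> n1")
      case True
      then have [measurable]: "A n \<in> borel_measurable M" by (intro A) (simp add: n1_def)
      show ?thesis using True by (simp add: S_def)
    qed (simp add: S_def)
    have "AE \<omega> in M. eventually (\<lambda>n. \<omega> \<in> space M - S n) sequentially"
    proof (rule borel_cantelli_AE1)
      show "summable (\<lambda>n. measure M (S n))"
      proof (rule summable_comparison_test')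
        show "summable (\<lambda>n. 2 * r ^ n)" using r by (intro summable_mult summable_geometric) auto
        fix n assume n: "n \<ge> n1"
        then have [measurable]: "A n \<in> borel_measurable M" by (intro A) (simp add: n1_def)
        have "measure M (S n) = prob ({\<omega> \<in> space M. 1 * A n \<omega> \<ge> \<epsilon>} \<union> {\<omega> \<in> space M. -1 * A n \<omega> \<ge> \<epsilon>})"
          using n by (intro arg_cong[of _ _ prob]) (auto simp: S_def)
        also have "\<dots> \<le> prob {\<omega> \<in> space M. 1 * A n \<omega> \<ge> \<epsilon>} + prob {\<omega> \<in> space M. -1 * A n \<omega> \<ge> \<epsilon>}"
          by (rule measure_Un_le) auto
        also have "\<dots> \<le> r ^ n + r ^ n"
          using tail[OF n, of 1] tail[OF n, of "-1"] unfolding r_pow by (intro add_mono) simp_all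
        finally show "norm (measure M (S n)) \<le> 2 * r ^ n" by simp
      qed
    qed (auto simp: less_top[symmetric])
    then show ?thesis
    proof eventually_elim
      case (elim \<omega>)
      show ?case using elim eventually_ge_at_top[of n1]
        by eventually_elim (auto simp: S_def not_le)
    qed
  qed
  have "AE \<omega> in M. \<forall>m. eventually (\<lambda>n. \<bar>A n \<omega>\<bar> < inverse (real (Suc m))) sequentially"
    unfolding AE_all_countable using ev by simp
  then show ?thesis
  proof eventually_elim
    case (elim \<omega>)
    show ?case
    proof (rule tendstoI)
      fix e :: real assume "0 < e"
      then obtain m where m: "inverse (real (Suc m)) < e" using reals_Archimedean by blast
      show "eventually (\<lambda>n. dist (A n \<omega>) 0 < e) sequentially"
        using elim[rule_format, of m] by eventually_elim (use m in simp)
    qed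
  qed
qed

section \<open>Averages over vectors with permuted coordinates\<close>

lemma borel_measurable_vec_lambda [measurable (raw)]:
  fixes f :: "'a \<Rightarrow> 'd::finite \<Rightarrow> real"
  assumes "\<And>d. (\<lambda>x. f x d) \<in> borel_measurable M"
  shows "(\<lambda>x. \<chi> d. f x d) \<in> borel_measurable M"
  using assms
  by (subst borel_measurable_euclidean_space) (auto simp: Basis_vec_def inner_axis)

lemma borel_measurable_vec_nth_comp [measurable (raw)]:
  fixes f :: "'a \<Rightarrow> real ^ 'd"
  assumes "f \<in> borel_measurable M"
  shows "(\<lambda>x. f x $ i) \<in> borel_measurable M"
  using measurable_compose[OF assms borel_measurable_nth] .

lemma measurable_vec_le [measurable]:
  fixes f g :: "'a \<Rightarrow> real ^ 'd"
  assumes [measurable]: "f \<in> borel_measurable M" "g \<in> borel_measurable M"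
  shows "Measurable.pred M (\<lambda>x. f x \<le> g x)"
proof -
  have "Measurable.pred M (\<lambda>x. \<forall>i\<in>UNIV. f x $ i \<le> g x $ i)"
    by (intro pred_intros_finite) measurable
  then show ?thesis by (simp add: less_eq_vec_def)
qed

lemma prob_space_marginal_product:
  assumes "prob_space M" "Y \<in> borel_measurable M"
  shows "prob_space (marginal_product M Y)"
  unfolding marginal_product_def
proof (rule prob_space.prob_space_distr)
  have [measurable]: "Y \<in> borel_measurable M" by fact
  show "prob_space (\<Pi>\<^sub>M j\<in>UNIV. distr M borel (\<lambda>\<omega>. Y \<omega> $ j))"
    by (intro prob_space_PiM prob_space.prob_space_distr assms(1)) measurable
qed measurable

lemma sets_marginal_product [measurable_cong, simp]: "sets (marginal_product M Y) = sets borel"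
  by (simp add: marginal_product_def)

lemma space_marginal_product [simp]: "space (marginal_product M Y) = UNIV"
  by (simp add: marginal_product_def)

lemma marginal_product_distr:
  assumes "D \<in> M \<rightarrow>\<^sub>M N" "yv \<in> borel_measurable N"
  shows "marginal_product (distr M N D) yv = marginal_product M (\<lambda>\<omega>. yv (D \<omega>))"
proof -
  note [measurable] = assms
  have "distr (distr M N D) borel (\<lambda>\<omega>. yv \<omega> $ j) = distr M borel (\<lambda>\<omega>. yv (D \<omega>) $ j)" for j
    by (subst distr_distr) (simp_all add: comp_def)
  then show ?thesis by (simp add: marginal_product_def)
qed

text \<open>
  Coordinate \<open>d\<close> is read off record \<open>p d\<close>; for injective \<open>p\<close> the coordinates are thus independent,
  each with its marginal law.
\<close>

lemma distr_distinct_coordinates: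
  fixes yv :: "'r \<Rightarrow> real ^ 'd" and p :: "'d \<Rightarrow> nat"
  assumes "prob_space \<mu>" and [measurable]: "yv \<in> borel_measurable \<mu>" and p: "inj p"
  shows "distr (\<Pi>\<^sub>M i\<in>range p. \<mu>) borel (\<lambda>x. \<chi> d. yv (x (p d)) $ d) = marginal_product \<mu> yv"
proof -
  interpret mu: prob_space \<mu> by fact
  interpret P: product_prob_space "\<lambda>_::nat. \<mu>" UNIV by unfold_locales
  let ?N = "\<lambda>d::'d. distr \<mu> borel (\<lambda>r. yv r $ d)"
  interpret N: product_prob_space ?N UNIV
    by (intro product_prob_spaceI mu.prob_space_distr) measurable
  have "distr (\<Pi>\<^sub>M i\<in>range p. \<mu>) (\<Pi>\<^sub>M d\<in>UNIV. borel) (\<lambda>x. \<lambda>d\<in>UNIV. yv (x (p d)) $ d) = (\<Pi>\<^sub>M d\<in>UNIV. ?N d)"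
  proof (rule N.PiM_eqI)
    fix A :: "'d \<Rightarrow> real set" assume "\<And>d. d \<in> UNIV \<Longrightarrow> A d \<in> sets (?N d)"
    then have A [measurable]: "\<And>d. A d \<in> sets borel" by simp
    define B where "B j = {r \<in> space \<mu>. yv r $ (inv p j) \<in> A (inv p j)}" for j
    have B: "B j \<in> sets \<mu>" for j unfolding B_def by measurable
    have "(\<lambda>x. \<lambda>d\<in>UNIV. yv (x (p d)) $ d) -` (Pi\<^sub>E UNIV A) \<inter> space (\<Pi>\<^sub>M i\<in>range p. \<mu>) = Pi\<^sub>E (range p) B"
      using p by (auto simp: space_PiM PiE_iff B_def)
    then have "emeasure (distr (\<Pi>\<^sub>M i\<in>range p. \<mu>) (\<Pi>\<^sub>M d\<in>UNIV. borel) (\<lambda>x. \<lambda>d\<in>UNIV. yv (x (p d)) $ d)) (Pi\<^sub>E UNIV A)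
       = emeasure (\<Pi>\<^sub>M i\<in>range p. \<mu>) (Pi\<^sub>E (range p) B)"
      by (subst emeasure_distr) (auto intro!: sets_PiM_I_finite)
    also have "\<dots> = (\<Prod>j\<in>range p. emeasure \<mu> (B j))"
      using B by (intro P.emeasure_PiM) auto
    also have "\<dots> = (\<Prod>d\<in>UNIV. emeasure \<mu> (B (p d)))"
      using p by (subst prod.reindex) auto
    also have "\<dots> = (\<Prod>d\<in>UNIV. emeasure (?N d) (A d))"
      using p by (intro prod.cong refl, subst emeasure_distr) (auto simp: B_def intro!: arg_cong[where f = "emeasure \<mu>"])
    finally show "emeasure (distr (\<Pi>\<^sub>M i\<in>range p. \<mu>) (\<Pi>\<^sub>M d\<in>UNIV. borel) (\<lambda>x. \<lambda>d\<in>UNIV. yv (x (p d)) $ d)) (Pi\<^sub>E UNIV A)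
       = (\<Prod>d\<in>UNIV. emeasure (?N d) (A d))" .
  qed (auto intro!: sets_PiM_cong)
  then have "marginal_product \<mu> yv = distr (distr (\<Pi>\<^sub>M i\<in>range p. \<mu>) (\<Pi>\<^sub>M d\<in>UNIV. borel)
      (\<lambda>x. \<lambda>d\<in>UNIV. yv (x (p d)) $ d)) borel (\<lambda>f. \<chi> j. f j)"
    unfolding marginal_product_def by simp
  also have "\<dots> = distr (\<Pi>\<^sub>M i\<in>range p. \<mu>) borel (\<lambda>x. \<chi> d. yv (x (p d)) $ d)"
  proof -
    have m: "(\<lambda>x. \<lambda>d\<in>UNIV. yv (x (p d)) $ d) \<in> (\<Pi>\<^sub>M i\<in>range p. \<mu>) \<rightarrow>\<^sub>M (\<Pi>\<^sub>M d\<in>UNIV. borel)"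
      by (intro measurable_restrict) measurable
    have "(\<lambda>f::'d \<Rightarrow> real. \<chi> j. f j) \<in> (\<Pi>\<^sub>M d\<in>UNIV. borel) \<rightarrow>\<^sub>M borel" by measurable
    from distr_distr[OF this m] show ?thesis by (simp add: comp_def restrict_def)
  qed
  finally show ?thesis by simp
qed

text \<open>
  The instances are the number of records whose response dominates \<open>y\<close> and the form \<open>nn_form\<close>. The index
  set \<open>I\<close> is an argument so that deleting records becomes passing to a smaller set.
\<close>

locale stable_functional = mu: prob_space \<mu> for \<mu> :: "'r measure" +
  fixes yv :: "'r \<Rightarrow> real ^ 'd"
    and F :: "nat set \<Rightarrow> (nat \<Rightarrow> 'r) \<Rightarrow> real ^ 'd \<Rightarrow> real"
    and K :: real
  assumes yv [measurable]: "yv \<in> borel_measurable \<mu>"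
    and F_measurable: "finite I \<Longrightarrow> (\<lambda>(x, y). F I x y) \<in> borel_measurable ((\<Pi>\<^sub>M i\<in>I. \<mu>) \<Otimes>\<^sub>M borel)"
    and F_nonneg: "finite I \<Longrightarrow> 0 \<le> F I x y"
    and F_le_card: "finite I \<Longrightarrow> F I x y \<le> card I"
    and F_removal: "finite I \<Longrightarrow> k \<in> I \<Longrightarrow> \<bar>F I x y - F (I - {k}) x y\<bar> \<le> K"
    and F_cong: "(\<And>i. i \<in> I \<Longrightarrow> x i = x' i) \<Longrightarrow> F I x y = F I x' y"
begin

sublocale P: product_prob_space "\<lambda>_::nat. \<mu>" UNIV by unfold_locales

abbreviation PI :: "nat set \<Rightarrow> (nat \<Rightarrow> 'r) measure" where
  "PI I \<equiv> (\<Pi>\<^sub>M i\<in>I. \<mu>)"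

lemma prob_space_PI: "prob_space (PI I)"
  by (intro prob_space_PiM) (rule mu.prob_space_axioms)

lemma F_removal_set:
  assumes "finite I" "J \<subseteq> I"
  shows "\<bar>F I x y - F (I - J) x y\<bar> \<le> K * card J"
proof -
  have "finite J" using assms finite_subset by blast
  then show ?thesis using assms(2)
  proof (induction J rule: finite_induct)
    case (insert k J)
    have "I - J - {k} = I - insert k J" by blast
    then have "\<bar>F (I - J) x y - F (I - insert k J) x y\<bar> \<le> K"
      using F_removal[of "I - J" k x y] insert assms by auto
    then show ?case using insert by (simp add: algebra_simps abs_le_iff)
  qed simp
qed

lemma K_nonneg: "0 \<le> K"
  using F_removal[of "{0}" 0] by (meson abs_ge_zero finite.intros order_trans insertI1)

lemma F_update:
  assumes "finite I" "k \<in> I"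
  shows "\<bar>F I (x(k := v)) y - F I x y\<bar> \<le> 2 * K"
proof -
  have "F (I - {k}) (x(k := v)) y = F (I - {k}) x y" by (rule F_cong) auto
  then show ?thesis
    using F_removal[OF assms, of "x(k := v)" y] F_removal[OF assms, of x y] by (simp add: abs_le_iff)
qed

lemma Y_tilde_measurable [measurable]:
  assumes "\<And>d. \<pi> d k \<in> I"
  shows "(\<lambda>x. Y_tilde \<pi> (\<lambda>i. yv (x i)) k) \<in> borel_measurable (PI I)"
  unfolding Y_tilde_def using assms
  by (intro borel_measurable_vec_lambda measurable_compose[OF _ borel_measurable_nth]
      measurable_compose[OF _ yv] measurable_component_singleton)

lemma F_at_Y_tilde_measurable:
  assumes "finite I" "I \<subseteq> I'" "\<And>d. \<pi> d k \<in> I'"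
  shows "(\<lambda>x. F I x (Y_tilde \<pi> (\<lambda>i. yv (x i)) k)) \<in> borel_measurable (PI I')"
proof -
  have [measurable]: "(\<lambda>x. Y_tilde \<pi> (\<lambda>i. yv (x i)) k) \<in> borel_measurable (PI I')"
    by (rule Y_tilde_measurable) fact
  have "(\<lambda>x. (restrict x I, Y_tilde \<pi> (\<lambda>i. yv (x i)) k)) \<in> PI I' \<rightarrow>\<^sub>M PI I \<Otimes>\<^sub>M borel"
    using assms(2) by (intro measurable_Pair measurable_restrict_subset) auto
  from measurable_compose[OF this F_measurable[OF assms(1)]]
  have "(\<lambda>x. F I (restrict x I) (Y_tilde \<pi> (\<lambda>i. yv (x i)) k)) \<in> borel_measurable (PI I')" by simp
  moreover have "F I (restrict x I) y = F I x y" for x y by (rule F_cong) auto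
  ultimately show ?thesis by simp
qed

lemma F_measurable_fst:
  assumes "finite I"
  shows "(\<lambda>x. F I x y) \<in> borel_measurable (PI I)"
proof -
  have "(\<lambda>x. (x, y)) \<in> PI I \<rightarrow>\<^sub>M PI I \<Otimes>\<^sub>M borel" by simp
  from measurable_compose[OF this F_measurable[OF assms]] show ?thesis by simp
qed

lemma F_abs_le: "finite I \<Longrightarrow> \<bar>F I x y\<bar> \<le> card I"
  using F_nonneg F_le_card by (simp add: abs_le_iff order_trans[of _ 0])

text \<open>
  Deleting the records \<open>J\<close> that enter the permuted vector costs at most \<open>K\<close> for each of them. What is
  left depends on independent records only, so the vector can be integrated out against its own
  law; then the deleted records are put back at the same cost.
\<close>

lemma expectation_at_Y_tilde:
  assumes I: "finite I" and p: "inj (\<lambda>d. \<pi> d k)" "\<And>d. \<pi> d k \<in> I"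
  shows "\<bar>(\<integral>x. F I x (Y_tilde \<pi> (\<lambda>i. yv (x i)) k) \<partial>PI I)
      - (\<integral>y. (\<integral>x. F I x y \<partial>PI I) \<partial>marginal_product \<mu> yv)\<bar> \<le> 2 * (K * CARD('d))"
proof -
  define J where "J = range (\<lambda>d. \<pi> d k)"
  have J: "finite J" "J \<subseteq> I" "card J = CARD('d)" using p by (auto simp: J_def card_image)
  define L where "L = I - J"
  have L: "finite L" "L \<inter> J = {}" "L \<union> J = I" "L \<subseteq> I" using J I by (auto simp: L_def)
  let ?nu = "marginal_product \<mu> yv"
  interpret nu: prob_space ?nu by (rule prob_space_marginal_product) (auto intro: mu.prob_space_axioms)
  interpret PI: prob_space "PI I" by (rule prob_space_PI)
  interpret PL: prob_space "PI L" by (rule prob_space_PI)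
  interpret PJ: prob_space "PI J" by (rule prob_space_PI)
  interpret pr: pair_prob_space "PI I" ?nu ..
  let ?y = "\<lambda>x. Y_tilde \<pi> (\<lambda>i. yv (x i)) k"
  have removal: "\<bar>F I x y - F L x y\<bar> \<le> K * CARD('d)" for x y
    unfolding L_def using F_removal_set[OF I J(2), of x y] J(3) by simp
  have [measurable]: "(\<lambda>x. F I x (?y x)) \<in> borel_measurable (PI I)"
    "(\<lambda>x. F L x (?y x)) \<in> borel_measurable (PI I)"
    using F_at_Y_tilde_measurable I L p by auto
  have FI [measurable]: "(\<lambda>(x, y). F I x y) \<in> borel_measurable (PI I \<Otimes>\<^sub>M ?nu)"
    using F_measurable[OF I] by (subst measurable_cong_sets) (auto intro!: sets_pair_measure_cong)
  have FL [measurable]: "(\<lambda>(x, y). F L x y) \<in> borel_measurable (PI L \<Otimes>\<^sub>M ?nu)"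
    using F_measurable[OF L(1)] by (subst measurable_cong_sets) (auto intro!: sets_pair_measure_cong)
  have Fy: "(\<lambda>y. F L x y) \<in> borel_measurable borel" if "x \<in> space (PI L)" for x
    using measurable_Pair2[OF F_measurable[OF L(1)], of x] that by simp
  have FLr: "F L (restrict x L) y = F L x y" for x y by (rule F_cong) auto
  have FLI [measurable]: "(\<lambda>(x, y). F L x y) \<in> borel_measurable (PI I \<Otimes>\<^sub>M ?nu)"
  proof -
    have "(\<lambda>(x, y). (restrict x L, y)) \<in> PI I \<Otimes>\<^sub>M ?nu \<rightarrow>\<^sub>M PI L \<Otimes>\<^sub>M ?nu"
      using L by (auto simp: split_beta' intro!: measurable_Pair measurable_compose[OF measurable_fst measurable_restrict_subset])
    from measurable_compose[OF this FL] show ?thesis by (simp add: split_beta' FLr)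
  qed
  have bI: "\<bar>F I x y\<bar> \<le> card I" for x y by (rule F_abs_le[OF I])
  have bL: "\<bar>F L x y\<bar> \<le> card I" for x y
    using F_abs_le[OF L(1), of x y] card_mono[OF I L(4)] by linarith
  have intI: "integrable (PI I) (\<lambda>x. F I x (?y x))" "integrable (PI I) (\<lambda>x. F L x (?y x))"
    using bI bL by (auto intro!: PI.integrable_const_bound[of _ "card I"])
  have step1: "\<bar>(\<integral>x. F I x (?y x) \<partial>PI I) - (\<integral>x. F L x (?y x) \<partial>PI I)\<bar> \<le> K * CARD('d)"
  proof -
    have "(\<integral>x. F I x (?y x) \<partial>PI I) - (\<integral>x. F L x (?y x) \<partial>PI I) = (\<integral>x. F I x (?y x) - F L x (?y x) \<partial>PI I)"
      using intI by simp
    also have "\<bar>\<dots>\<bar> \<le> (\<integral>x. \<bar>F I x (?y x) - F L x (?y x)\<bar> \<partial>PI I)" by (rule integral_abs_bound)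
    also have "\<dots> \<le> (\<integral>x. K * CARD('d) \<partial>PI I)"
      using intI removal by (intro integral_mono integrable_abs Bochner_Integration.integrable_diff) auto
    finally show ?thesis by (simp add: PI.prob_space)
  qed
  have "(\<integral>x. F L x (?y x) \<partial>PI I) = (\<integral>x. (\<integral>w. F L (merge L J (x, w)) (?y (merge L J (x, w))) \<partial>PI J) \<partial>PI L)"
    using P.product_integral_fold[of L J "\<lambda>x. F L x (?y x)"] L J intI by auto
  also have "\<dots> = (\<integral>x. (\<integral>w. F L x (?y w) \<partial>PI J) \<partial>PI L)"
  proof (intro Bochner_Integration.integral_cong refl)
    fix x w
    have "?y (merge L J (x, w)) = ?y w" using L(2) by (auto simp: Y_tilde_def J_def merge_def vec_eq_iff)
    moreover have "F L (merge L J (x, w)) y = F L x y" for y by (rule F_cong) (simp add: merge_def)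
    ultimately show "F L (merge L J (x, w)) (?y (merge L J (x, w))) = F L x (?y w)" by simp
  qed
  also have "\<dots> = (\<integral>x. (\<integral>y. F L x y \<partial>?nu) \<partial>PI L)"
  proof (intro Bochner_Integration.integral_cong refl)
    fix x assume x: "x \<in> space (PI L)"
    have "?nu = distr (PI J) borel ?y"
      using distr_distinct_coordinates[of \<mu> yv "\<lambda>d. \<pi> d k"] p mu.prob_space_axioms
      by (simp add: J_def Y_tilde_def)
    then show "(\<integral>w. F L x (?y w) \<partial>PI J) = (\<integral>y. F L x y \<partial>?nu)"
      using Fy[OF x] by (simp add: integral_distr Y_tilde_measurable J_def)
  qed
  also have "\<dots> = (\<integral>x. (\<integral>y. F L x y \<partial>?nu) \<partial>PI I)"
  proof -
    have "PI L = distr (PI I) (PI L) (\<lambda>x. restrict x L)"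
      using P.distr_restrict[of L I] L I by simp
    then have "(\<integral>x. (\<integral>y. F L x y \<partial>?nu) \<partial>PI L) = (\<integral>x. (\<integral>y. F L x y \<partial>?nu) \<partial>distr (PI I) (PI L) (\<lambda>x. restrict x L))"
      by simp
    also have "\<dots> = (\<integral>x. (\<integral>y. F L (restrict x L) y \<partial>?nu) \<partial>PI I)"
      using L by (intro integral_distr measurable_restrict_subset nu.borel_measurable_lebesgue_integral FL) auto
    finally show ?thesis by (simp add: FLr)
  qed
  finally have step2: "(\<integral>x. F L x (?y x) \<partial>PI I) = (\<integral>x. (\<integral>y. F L x y \<partial>?nu) \<partial>PI I)" .
  have ip: "integrable (PI I \<Otimes>\<^sub>M ?nu) (\<lambda>(x, y). F I x y)" "integrable (PI I \<Otimes>\<^sub>M ?nu) (\<lambda>(x, y). F L x y)"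
    using bI bL by (auto intro!: pr.integrable_const_bound[of _ "card I"])
  have "\<bar>(\<integral>z. (\<lambda>(x, y). F I x y) z \<partial>(PI I \<Otimes>\<^sub>M ?nu)) - (\<integral>z. (\<lambda>(x, y). F L x y) z \<partial>(PI I \<Otimes>\<^sub>M ?nu))\<bar> \<le> K * CARD('d)"
  proof -
    have "(\<integral>z. (\<lambda>(x, y). F I x y) z \<partial>(PI I \<Otimes>\<^sub>M ?nu)) - (\<integral>z. (\<lambda>(x, y). F L x y) z \<partial>(PI I \<Otimes>\<^sub>M ?nu))
       = (\<integral>z. (\<lambda>(x, y). F I x y) z - (\<lambda>(x, y). F L x y) z \<partial>(PI I \<Otimes>\<^sub>M ?nu))"
      using ip by (rule Bochner_Integration.integral_diff[symmetric])
    also have "\<bar>\<dots>\<bar> \<le> (\<integral>z. \<bar>(\<lambda>(x, y). F I x y) z - (\<lambda>(x, y). F L x y) z\<bar> \<partial>(PI I \<Otimes>\<^sub>M ?nu))"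
      by (rule integral_abs_bound)
    also have "\<dots> \<le> (\<integral>z. K * CARD('d) \<partial>(PI I \<Otimes>\<^sub>M ?nu))"
      using ip removal by (intro integral_mono integrable_abs Bochner_Integration.integrable_diff) auto
    finally show ?thesis by (simp add: pr.prob_space)
  qed
  moreover have "(\<integral>z. (\<lambda>(x, y). F L x y) z \<partial>(PI I \<Otimes>\<^sub>M ?nu)) = (\<integral>x. (\<integral>y. F L x y \<partial>?nu) \<partial>PI I)"
    using pr.integral_fst'[OF ip(2)] by simp
  moreover have "(\<integral>z. (\<lambda>(x, y). F I x y) z \<partial>(PI I \<Otimes>\<^sub>M ?nu)) = (\<integral>y. (\<integral>x. F I x y \<partial>PI I) \<partial>?nu)"
    using pr.integral_snd[OF ip(1)] by simp
  ultimately show ?thesis using step1 step2 by (simp add: abs_le_iff)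
qed

definition shuffled_average :: "nat \<Rightarrow> ('d \<Rightarrow> nat \<Rightarrow> nat) \<Rightarrow> (nat \<Rightarrow> 'r) \<Rightarrow> real" where
  "shuffled_average n \<pi> x = (\<Sum>k<n. F {..<n} x (Y_tilde \<pi> (\<lambda>i. yv (x i)) k)) / (real n)\<^sup>2"

lemma average_borel_measurable:
  "(\<lambda>y. (\<integral>x. F {..<n} x y \<partial>PI {..<n}) / n) \<in> borel_measurable (marginal_product \<mu> yv)"
proof -
  let ?nu = "marginal_product \<mu> yv"
  interpret PI: prob_space "PI {..<n}" by (rule prob_space_PI)
  have "(\<lambda>(x, y). F {..<n} x y) \<in> borel_measurable (PI {..<n} \<Otimes>\<^sub>M ?nu)"
    using F_measurable[of "{..<n}"] by (subst measurable_cong_sets) (auto intro!: sets_pair_measure_cong)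
  from measurable_pair_swap[OF this]
  have "(\<lambda>(y, x). F {..<n} x y) \<in> borel_measurable (?nu \<Otimes>\<^sub>M PI {..<n})" by (simp add: split_beta')
  then have [measurable]: "(\<lambda>y. \<integral>x. F {..<n} x y \<partial>PI {..<n}) \<in> borel_measurable ?nu"
    by (rule PI.borel_measurable_lebesgue_integral)
  show ?thesis by measurable
qed

text \<open>
  The limit is later an integral over \<open>y\<close> of conditional probabilities that are only chosen separately
  for each \<open>y\<close>. Being a limit of measurable functions makes it measurable in \<open>y\<close> all the same.
\<close>

lemma limit_borel_measurable:
  assumes lim: "\<And>y. (\<lambda>n. (\<integral>x. F {..<n} x y \<partial>PI {..<n}) / n) \<longlonglongrightarrow> q y"
  shows "q \<in> borel_measurable (marginal_product \<mu> yv)"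
  by (rule borel_measurable_LIMSEQ_real[OF lim average_borel_measurable])

lemma expectation_shuffled_average_tendsto:
  assumes bij: "\<And>n d. n \<ge> CARD('d) \<Longrightarrow> bij_betw (\<pi> n d) {..<n} {..<n}"
    and dist: "\<And>n d1 d2 i. n \<ge> CARD('d) \<Longrightarrow> i < n \<Longrightarrow> d1 \<noteq> d2 \<Longrightarrow> \<pi> n d1 i \<noteq> \<pi> n d2 i"
    and lim: "\<And>y. (\<lambda>n. (\<integral>x. F {..<n} x y \<partial>PI {..<n}) / n) \<longlonglongrightarrow> q y"
  shows "(\<lambda>n. \<integral>x. shuffled_average n (\<pi> n) x \<partial>PI {..<n}) \<longlonglongrightarrow> (\<integral>y. q y \<partial>marginal_product \<mu> yv)"
proof -
  let ?nu = "marginal_product \<mu> yv"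
  interpret nu: prob_space ?nu by (rule prob_space_marginal_product) (auto intro: mu.prob_space_axioms)
  define G where "G n y = (\<integral>x. F {..<n} x y \<partial>PI {..<n}) / n" for n y
  have Gb: "\<bar>G n y\<bar> \<le> 1" for n y
  proof -
    interpret PI: prob_space "PI {..<n}" by (rule prob_space_PI)
    have "\<bar>\<integral>x. F {..<n} x y \<partial>PI {..<n}\<bar> \<le> (\<integral>x. \<bar>F {..<n} x y\<bar> \<partial>PI {..<n})" by (rule integral_abs_bound)
    also have "\<dots> \<le> (\<integral>x. n \<partial>PI {..<n})"
      using F_abs_le[of "{..<n}"] F_measurable_fst[of "{..<n}"]
      by (intro integral_mono PI.integrable_const_bound[of _ n]) auto
    finally show ?thesis by (cases "n = 0") (auto simp: G_def PI.prob_space)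
  qed
  have [measurable]: "G n \<in> borel_measurable ?nu" for n
    unfolding G_def by (rule average_borel_measurable)
  have limG: "(\<lambda>n. \<integral>y. G n y \<partial>?nu) \<longlonglongrightarrow> (\<integral>y. q y \<partial>?nu)"
  proof (rule integral_dominated_convergence[where w = "\<lambda>_. 1"])
    show "AE y in ?nu. (\<lambda>n. G n y) \<longlonglongrightarrow> q y" using lim by (simp add: G_def)
    show "q \<in> borel_measurable ?nu" using lim by (rule limit_borel_measurable)
  qed (use Gb in auto)
  have close: "\<bar>(\<integral>x. shuffled_average n (\<pi> n) x \<partial>PI {..<n}) - (\<integral>y. G n y \<partial>?nu)\<bar> \<le> 2 * (K * CARD('d)) / n"
    if n: "n \<ge> CARD('d)" for n
  proof -
    interpret PI: prob_space "PI {..<n}" by (rule prob_space_PI)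
    have n0: "0 < n" using n zero_less_card_finite[where 'a='d] by linarith
    have mem: "\<pi> n d k \<in> {..<n}" if "k < n" for d k
      using bij_betw_apply[OF bij[OF n]] that by auto
    let ?y = "\<lambda>k x. Y_tilde (\<pi> n) (\<lambda>i. yv (x i)) k"
    have int: "integrable (PI {..<n}) (\<lambda>x. F {..<n} x (?y k x))" if "k < n" for k
      using F_at_Y_tilde_measurable[of "{..<n}" "{..<n}" "\<pi> n" k] mem[OF that] F_abs_le[of "{..<n}"]
      by (intro PI.integrable_const_bound[of _ n]) auto
    define a where "a = (\<integral>y. (\<integral>x. F {..<n} x y \<partial>PI {..<n}) \<partial>?nu)"
    have E: "\<bar>(\<integral>x. F {..<n} x (?y k x) \<partial>PI {..<n}) - a\<bar> \<le> 2 * (K * CARD('d))" if "k < n" for k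
      unfolding a_def using dist[OF n that] mem[OF that]
      by (intro expectation_at_Y_tilde) (auto simp: inj_on_def)
    have "\<bar>(\<Sum>k<n. \<integral>x. F {..<n} x (?y k x) \<partial>PI {..<n}) - n * a\<bar> = \<bar>\<Sum>k<n. (\<integral>x. F {..<n} x (?y k x) \<partial>PI {..<n}) - a\<bar>"
      by (simp add: sum_subtractf)
    also have "\<dots> \<le> (\<Sum>k<n. \<bar>(\<integral>x. F {..<n} x (?y k x) \<partial>PI {..<n}) - a\<bar>)" by (rule sum_abs)
    also have "\<dots> \<le> (\<Sum>k<n. 2 * (K * CARD('d)))" using E by (intro sum_mono) auto
    finally have s: "\<bar>(\<Sum>k<n. \<integral>x. F {..<n} x (?y k x) \<partial>PI {..<n}) - n * a\<bar> \<le> n * (2 * (K * CARD('d)))" by simp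
    have "(\<integral>x. shuffled_average n (\<pi> n) x \<partial>PI {..<n}) = (\<Sum>k<n. \<integral>x. F {..<n} x (?y k x) \<partial>PI {..<n}) / (real n)\<^sup>2"
      unfolding shuffled_average_def using int by (simp add: Bochner_Integration.integral_sum)
    moreover have "(\<integral>y. G n y \<partial>?nu) = n * a / (real n)\<^sup>2"
      unfolding G_def a_def using n0 by (simp add: power2_eq_square)
    ultimately have "\<bar>(\<integral>x. shuffled_average n (\<pi> n) x \<partial>PI {..<n}) - (\<integral>y. G n y \<partial>?nu)\<bar>
       = \<bar>(\<Sum>k<n. \<integral>x. F {..<n} x (?y k x) \<partial>PI {..<n}) - n * a\<bar> / (real n)\<^sup>2"
      by (simp add: diff_divide_distrib[symmetric])
    also have "\<dots> \<le> n * (2 * (K * CARD('d))) / (real n)\<^sup>2" using s by (rule divide_right_mono) simp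
    also have "\<dots> = 2 * (K * CARD('d)) / n" using n0 by (simp add: power2_eq_square)
    finally show ?thesis .
  qed
  have "(\<lambda>n. (\<integral>x. shuffled_average n (\<pi> n) x \<partial>PI {..<n}) - (\<integral>y. G n y \<partial>?nu)) \<longlonglongrightarrow> 0"
  proof (rule Lim_null_comparison)
    show "\<forall>\<^sub>F n in sequentially. norm ((\<integral>x. shuffled_average n (\<pi> n) x \<partial>PI {..<n}) - (\<integral>y. G n y \<partial>?nu))
       \<le> 2 * (K * CARD('d)) / n"
      using eventually_ge_at_top[of "CARD('d)"] by eventually_elim (use close in simp)
  qed (rule lim_const_over_n)
  from tendsto_add[OF this limG] show ?thesis by simp
qed

lemma shuffled_average_measurable [measurable]:
  assumes "\<And>d k. k < n \<Longrightarrow> \<pi> d k < n"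
  shows "shuffled_average n \<pi> \<in> borel_measurable (PI {..<n})"
  unfolding shuffled_average_def using assms
  by (intro borel_measurable_divide borel_measurable_sum F_at_Y_tilde_measurable) auto

lemma shuffled_average_bounded: "\<bar>shuffled_average n \<pi> x\<bar> \<le> 1"
proof -
  have "\<bar>\<Sum>k<n. F {..<n} x (Y_tilde \<pi> (\<lambda>i. yv (x i)) k)\<bar> \<le> (\<Sum>k<n. real n)"
    using F_abs_le[of "{..<n}"] by (intro order_trans[OF sum_abs] sum_mono) auto
  also have "\<dots> = (real n)\<^sup>2" by (simp add: power2_eq_square)
  finally show ?thesis by (cases "n = 0") (auto simp: shuffled_average_def divide_le_eq)
qed

text \<open>
  A change of record \<open>k\<close> affects each value of \<open>F\<close> by at most \<open>2 * K\<close> as long as the permuted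
  vector stays the same. The vector changes for at most one index per coordinate, and there the trivial
  bound \<open>n\<close> suffices.
\<close>

lemma shuffled_average_update:
  assumes bij: "\<And>d. bij_betw (\<pi> d) {..<n} {..<n}" and k: "k < n"
  shows "\<bar>shuffled_average n \<pi> (x(k := v)) - shuffled_average n \<pi> x\<bar> \<le> (2 * K + CARD('d)) / n"
proof -
  let ?x = "x(k := v)"
  let ?y = "\<lambda>x m. Y_tilde \<pi> (\<lambda>i. yv (x i)) m"
  define A where "A = {m. m < n \<and> (\<exists>d. \<pi> d m = k)}"
  have "A = (\<Union>d. {m. m < n \<and> \<pi> d m = k})" by (auto simp: A_def)
  also have "card \<dots> \<le> (\<Sum>d\<in>UNIV. card {m. m < n \<and> \<pi> d m = k})" by (rule card_UN_le) simp
  also have "\<dots> \<le> (\<Sum>d\<in>(UNIV::'d set). 1)"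
  proof (rule sum_mono)
    fix d
    have "inj_on (\<pi> d) {..<n}" using bij[of d] by (simp add: bij_betw_def)
    then show "card {m. m < n \<and> \<pi> d m = k} \<le> 1"
      unfolding One_nat_def by (subst card_le_Suc0_iff_eq) (auto simp: inj_on_def)
  qed
  finally have cA: "card A \<le> CARD('d)" by simp
  have each: "\<bar>F {..<n} ?x (?y ?x m) - F {..<n} x (?y x m)\<bar> \<le> 2 * K + n * of_bool (m \<in> A)" if m: "m < n" for m
  proof (cases "m \<in> A")
    case True
    have "\<bar>F {..<n} ?x (?y ?x m) - F {..<n} x (?y x m)\<bar> \<le> n"
      using F_nonneg[of "{..<n}"] F_le_card[of "{..<n}"] by (simp add: abs_le_iff) (smt (verit))
    then show ?thesis using True K_nonneg by simp
  next
    case False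
    then have "?y ?x m = ?y x m" using m by (auto simp: A_def Y_tilde_def vec_eq_iff)
    then show ?thesis using False F_update[of "{..<n}" k x v] k by simp
  qed
  have "\<bar>(\<Sum>m<n. F {..<n} ?x (?y ?x m)) - (\<Sum>m<n. F {..<n} x (?y x m))\<bar>
     \<le> (\<Sum>m<n. \<bar>F {..<n} ?x (?y ?x m) - F {..<n} x (?y x m)\<bar>)"
    unfolding sum_subtractf[symmetric] by (rule sum_abs)
  also have "\<dots> \<le> (\<Sum>m<n. 2 * K + n * of_bool (m \<in> A))" using each by (intro sum_mono) auto
  also have "\<dots> = n * (2 * K) + n * (\<Sum>m<n. of_bool (m \<in> A))"
    by (simp add: sum.distrib sum_distrib_left)
  also have "\<dots> \<le> n * (2 * K) + n * real CARD('d)"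
  proof -
    have "{..<n} \<inter> {m. m \<in> A} = A" by (auto simp: A_def)
    then have "(\<Sum>m<n. of_bool (m \<in> A)) = real (card A)" by simp
    moreover have "real (card A) \<le> real CARD('d)" using cA by simp
    ultimately show ?thesis by (simp add: mult_left_mono del: of_nat_le_iff)
  qed
  also have "\<dots> = (2 * K + CARD('d)) / n * (real n)\<^sup>2"
    using k by (simp add: power2_eq_square field_simps)
  finally have "\<bar>(\<Sum>m<n. F {..<n} ?x (?y ?x m)) - (\<Sum>m<n. F {..<n} x (?y x m))\<bar> / (real n)\<^sup>2
      \<le> (2 * K + CARD('d)) / n"
    using k by (subst pos_divide_le_eq) (simp_all del: fun_upd_apply)
  then show ?thesis
    by (simp only: shuffled_average_def diff_divide_distrib[symmetric] abs_divide abs_power2)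
qed

text \<open>
  Bounded differences of order \<open>1 / n\<close> in \<open>n\<close> independent records give a moment generating function of
  order \<open>exp (C * l\<^sup>2 / n)\<close>, so the averages follow their expectations.
\<close>

theorem shuffled_average_tendsto:
  fixes M :: "'a measure"
  assumes M: "prob_space M" and D: "\<And>i. D i \<in> M \<rightarrow>\<^sub>M \<mu>"
    and law: "\<And>n. n > 0 \<Longrightarrow> distr M (PI {..<n}) (\<lambda>\<omega>. \<lambda>i\<in>{..<n}. D i \<omega>) = PI {..<n}"
    and bij: "\<And>n d. n \<ge> CARD('d) \<Longrightarrow> bij_betw (\<pi> n d) {..<n} {..<n}"
    and dist: "\<And>n d1 d2 i. n \<ge> CARD('d) \<Longrightarrow> i < n \<Longrightarrow> d1 \<noteq> d2 \<Longrightarrow> \<pi> n d1 i \<noteq> \<pi> n d2 i"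
    and lim: "\<And>y. (\<lambda>n. (\<integral>x. F {..<n} x y \<partial>PI {..<n}) / n) \<longlonglongrightarrow> q y"
  shows "AE \<omega> in M. (\<lambda>n. shuffled_average n (\<pi> n) (\<lambda>i. D i \<omega>)) \<longlonglongrightarrow> (\<integral>y. q y \<partial>marginal_product \<mu> yv)"
proof -
  interpret M: prob_space M by fact
  let ?S = "\<lambda>n. shuffled_average n (\<pi> n)"
  let ?E = "\<lambda>n. \<integral>x. ?S n x \<partial>PI {..<n}"
  let ?D = "\<lambda>n \<omega>. \<lambda>i\<in>{..<n}. D i \<omega>"
  have mem: "\<pi> n d k < n" if "n \<ge> CARD('d)" "k < n" for n d k
    using bij_betw_apply[OF bij[OF that(1)]] that by auto
  have SD: "?S n (\<lambda>i. D i \<omega>) = ?S n (?D n \<omega>)" if n: "n \<ge> CARD('d)" for n \<omega>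
  proof -
    have "F {..<n} (\<lambda>i. D i \<omega>) y = F {..<n} (?D n \<omega>) y" for y by (rule F_cong) simp
    moreover have "Y_tilde (\<pi> n) (\<lambda>i. yv (D i \<omega>)) k = Y_tilde (\<pi> n) (\<lambda>i. yv (?D n \<omega> i)) k" if "k < n" for k
      using mem[OF n that] by (simp add: Y_tilde_def vec_eq_iff)
    ultimately show ?thesis by (simp add: shuffled_average_def)
  qed
  have [measurable]: "?D n \<in> M \<rightarrow>\<^sub>M PI {..<n}" for n using D by (intro measurable_restrict)
  have Sm: "?S n \<in> borel_measurable (PI {..<n})" if "n \<ge> CARD('d)" for n
    using mem[OF that] by (rule shuffled_average_measurable)
  have Eb: "\<bar>?E n\<bar> \<le> 1" if "n \<ge> CARD('d)" for n
  proof -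
    interpret PI: prob_space "PI {..<n}" by (rule prob_space_PI)
    have "\<bar>?E n\<bar> \<le> (\<integral>x. \<bar>?S n x\<bar> \<partial>PI {..<n})" by (rule integral_abs_bound)
    also have "\<dots> \<le> (\<integral>x. 1 \<partial>PI {..<n})"
      using shuffled_average_bounded Sm[OF that] by (intro integral_mono PI.integrable_const_bound[of _ 1]) auto
    finally show ?thesis by (simp add: PI.prob_space)
  qed
  define C where "C = (2 * K + CARD('d))\<^sup>2 / 2"
  have "0 < 2 * K + CARD('d)"
    using K_nonneg zero_less_card_finite[where 'a='d] by (intro add_nonneg_pos) auto
  then have "0 < C" by (simp add: C_def)
  have "AE \<omega> in M. (\<lambda>n. ?S n (\<lambda>i. D i \<omega>) - ?E n) \<longlonglongrightarrow> 0"
  proof (rule M.subgaussian_tendsto_0[where ?n0.0 = "CARD('d)" and K = C])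
    fix n assume n: "n \<ge> CARD('d)"
    then have n0: "n > 0" using zero_less_card_finite[where 'a='d] by linarith
    interpret PI: prob_space "PI {..<n}" by (rule prob_space_PI)
    note [measurable] = Sm[OF n]
    show "(\<lambda>\<omega>. ?S n (\<lambda>i. D i \<omega>) - ?E n) \<in> borel_measurable M"
      unfolding SD[OF n] by measurable
    fix l
    have "\<bar>exp (l * (?S n x - ?E n))\<bar> \<le> exp (\<bar>l\<bar> * 2)" for x
    proof -
      have "l * (?S n x - ?E n) \<le> \<bar>l\<bar> * \<bar>?S n x - ?E n\<bar>" by (metis abs_ge_self abs_mult)
      also have "\<dots> \<le> \<bar>l\<bar> * 2"
        using shuffled_average_bounded[of n "\<pi> n" x] Eb[OF n] by (intro mult_left_mono) auto
      finally show ?thesis by simp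
    qed
    then show "integrable M (\<lambda>\<omega>. exp (l * (?S n (\<lambda>i. D i \<omega>) - ?E n)))"
      unfolding SD[OF n] by (intro M.integrable_const_bound[of _ "exp (\<bar>l\<bar> * 2)"] AE_I2) auto
    have "(\<integral>\<omega>. exp (l * (?S n (\<lambda>i. D i \<omega>) - ?E n)) \<partial>M)
       = (\<integral>x. exp (l * (?S n x - ?E n)) \<partial>distr M (PI {..<n}) (?D n))"
      unfolding SD[OF n] by (subst integral_distr) auto
    also have "\<dots> = (\<integral>x. exp (l * (?S n x - ?E n)) \<partial>PI {..<n})" by (simp add: law[OF n0])
    also have "\<dots> \<le> exp (real (card {..<n}) * (l\<^sup>2 * ((2 * K + CARD('d)) / n)\<^sup>2 / 2))"
      by (rule mcdiarmid_mgf[where B = 1])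
        (use shuffled_average_bounded shuffled_average_update bij[OF n] mu.prob_space_axioms in auto)
    also have "real (card {..<n}) * (l\<^sup>2 * ((2 * K + CARD('d)) / n)\<^sup>2 / 2) = C * l\<^sup>2 / n"
      using n0 by (simp add: C_def power2_eq_square field_simps)
    finally show "(\<integral>\<omega>. exp (l * (?S n (\<lambda>i. D i \<omega>) - ?E n)) \<partial>M) \<le> exp (C * l\<^sup>2 / n)" .
  qed fact
  then show ?thesis
  proof eventually_elim
    case (elim \<omega>)
    have "?E \<longlonglongrightarrow> (\<integral>y. q y \<partial>marginal_product \<mu> yv)"
      using bij dist lim by (rule expectation_shuffled_average_tendsto)
    from tendsto_add[OF elim this] show ?case by simp
  qed
qed

end

section \<open>The weighted count of neighbours above a threshold\<close>

lemma stable_functional_nn_form: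
  fixes yv :: "'r \<Rightarrow> real ^ 'd" and gv :: "'r \<Rightarrow> 'b::euclidean_space"
  assumes "prob_space \<mu>" and [measurable]: "yv \<in> borel_measurable \<mu>" "gv \<in> borel_measurable \<mu>"
  shows "\<exists>K. stable_functional \<mu> yv
    (\<lambda>I x y. nn_form I (\<lambda>i. gv (x i)) (\<lambda>i. of_bool (y \<le> yv (x i)))) K"
proof -
  interpret prob_space \<mu> by fact
  obtain C :: real where C0: "0 \<le> C" and C: "\<And>I (z :: nat \<Rightarrow> 'b) j. finite I \<Longrightarrow> (\<Sum>i\<in>I. nn_weight I z i j) \<le> C"
    by (rule nn_in_degree_bounded[where 'b='b], rule that)
  have "stable_functional \<mu> yv (\<lambda>I x y. nn_form I (\<lambda>i. gv (x i)) (\<lambda>i. of_bool (y \<le> yv (x i)))) (2 * C + 1)"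
  proof unfold_locales
    fix I :: "nat set" and k x x' y
    assume I: "finite I"
    have "(\<lambda>z. nn_form I (\<lambda>i. gv (fst z i)) (\<lambda>i. of_bool (snd z \<le> yv (fst z i))))
        \<in> borel_measurable ((\<Pi>\<^sub>M i\<in>I. \<mu>) \<Otimes>\<^sub>M borel)"
      using I by (intro borel_measurable_nn_form) measurable
    then show "(\<lambda>(x, y). nn_form I (\<lambda>i. gv (x i)) (\<lambda>i. of_bool (y \<le> yv (x i))))
        \<in> borel_measurable ((\<Pi>\<^sub>M i\<in>I. \<mu>) \<Otimes>\<^sub>M borel)" by (simp add: split_beta')
    show "nn_form I (\<lambda>i. gv (x i)) (\<lambda>i. of_bool (y \<le> yv (x i))) \<le> card I"
      using I by (intro nn_form_le_card) auto
    show "\<bar>nn_form I (\<lambda>i. gv (x i)) (\<lambda>i. of_bool (y \<le> yv (x i)))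
        - nn_form (I - {k}) (\<lambda>i. gv (x i)) (\<lambda>i. of_bool (y \<le> yv (x i)))\<bar> \<le> 2 * C + 1" if "k \<in> I"
      using I that by (intro nn_form_removal C) auto
  qed (auto intro: nn_form_nonneg nn_form_cong)
  then show ?thesis by blast
qed

lemma stable_functional_count:
  fixes yv :: "'r \<Rightarrow> real ^ 'd"
  assumes "prob_space \<mu>" and [measurable]: "yv \<in> borel_measurable \<mu>"
  shows "stable_functional \<mu> yv (\<lambda>I x y. \<Sum>i\<in>I. of_bool (y \<le> yv (x i))) 1"
proof -
  interpret prob_space \<mu> by fact
  show ?thesis
  proof unfold_locales
    fix I :: "nat set" and k x x' y
    assume I: "finite I"
    have "(\<lambda>z. \<Sum>i\<in>I. of_bool (snd z \<le> yv (fst z i)) :: real) \<in> borel_measurable ((\<Pi>\<^sub>M i\<in>I. \<mu>) \<Otimes>\<^sub>M borel)"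
      using I by measurable
    then show "(\<lambda>(x, y). \<Sum>i\<in>I. of_bool (y \<le> yv (x i)) :: real)
        \<in> borel_measurable ((\<Pi>\<^sub>M i\<in>I. \<mu>) \<Otimes>\<^sub>M borel)" by (simp add: split_beta')
    have "(\<Sum>i\<in>I. of_bool (y \<le> yv (x i)) :: real) \<le> (\<Sum>i\<in>I. 1)" by (intro sum_mono) auto
    then show "(\<Sum>i\<in>I. of_bool (y \<le> yv (x i))) \<le> real (card I)" by (simp del: sum_of_bool_eq)
    show "\<bar>(\<Sum>i\<in>I. of_bool (y \<le> yv (x i)) :: real) - (\<Sum>i\<in>I - {k}. of_bool (y \<le> yv (x i)))\<bar> \<le> 1" if "k \<in> I"
      using I that by (subst sum.remove[of I k]) (auto simp del: sum_of_bool_eq)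
  qed (auto intro!: sum_nonneg simp del: sum_of_bool_eq)
qed

lemma abs_diff_unit_interval: "\<bar>a - b\<bar> \<le> 1" if "0 \<le> a" "a \<le> 1" "0 \<le> b" "b \<le> 1" for a b :: real
  using that by linarith

text \<open>
  Inner regularity gives a compact subset of almost the same measure, and the indicator of a compact set
  is the decreasing limit of Lipschitz functions of the distance to it.
\<close>

lemma indicator_approx_uniformly_continuous:
  fixes \<nu> :: "'b::euclidean_space measure" and \<epsilon> :: real
  assumes "finite_measure \<nu>" and sets: "sets \<nu> = sets borel" and B: "B \<in> sets borel" and \<epsilon>: "0 < \<epsilon>"
  shows "\<exists>u :: 'b \<Rightarrow> real. (\<forall>b. 0 \<le> u b \<and> u b \<le> 1) \<and> uniformly_continuous_on UNIV u \<and> (\<integral>b. \<bar>indicator B b - u b\<bar> \<partial>\<nu>) < \<epsilon>"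
proof -
  interpret finite_measure \<nu> by fact
  have space: "space \<nu> = UNIV" using sets_eq_imp_space_eq[OF sets] by simp
  note [measurable_cong] = sets
  have [measurable]: "B \<in> sets \<nu>" using B sets by simp
  have "emeasure \<nu> B = (SUP K\<in>{K. K \<subseteq> B \<and> compact K}. emeasure \<nu> K)"
    using sets B emeasure_finite by (intro inner_regular) (auto simp: less_top)
  moreover have "emeasure \<nu> B < emeasure \<nu> B + ennreal (\<epsilon> / 2)"
    using \<epsilon> emeasure_finite[of B] by (simp add: ennreal_add_left_cancel_less less_top[symmetric])
  ultimately have "\<exists>K\<in>{K. K \<subseteq> B \<and> compact K}. emeasure \<nu> B < emeasure \<nu> K + ennreal (\<epsilon> / 2)"
    using \<epsilon> emeasure_finite[of B]
    by (intro SUP_approx_ennreal) auto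
  then obtain K where K: "K \<subseteq> B" "compact K" and less: "emeasure \<nu> B < emeasure \<nu> K + ennreal (\<epsilon> / 2)" by blast
  have [measurable]: "K \<in> sets \<nu>" using K sets by (simp add: borel_compact)
  have "measure \<nu> B < measure \<nu> K + \<epsilon> / 2"
    using less \<epsilon> by (simp add: emeasure_eq_measure ennreal_plus[symmetric] ennreal_less_iff del: ennreal_plus)
  then have "measure \<nu> (B - K) < \<epsilon> / 2"
    using finite_measure_Diff[of B K] K by auto
  moreover have "(\<integral>b. \<bar>indicator B b - indicator K b\<bar> \<partial>\<nu>) = measure \<nu> (B - K)"
  proof -
    have "(\<lambda>b. \<bar>indicator B b - indicator K b\<bar> :: real) = indicator (B - K)"
      using K by (auto simp: indicator_def fun_eq_iff)
    then show ?thesis by simp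
  qed
  ultimately have BK: "(\<integral>b. \<bar>indicator B b - indicator K b\<bar> \<partial>\<nu>) < \<epsilon> / 2" by simp
  show ?thesis
  proof (cases "K = {}")
    case True
    then show ?thesis using BK \<epsilon>
      by (intro exI[of _ "\<lambda>_. 0"]) (auto intro: uniformly_continuous_on_const)
  next
    case False
    define u where "u m b = max 0 (1 - real m * infdist b K)" for m b
    have u01: "0 \<le> u m b" "u m b \<le> 1" for m b by (auto simp: u_def infdist_nonneg)
    have [measurable]: "u m \<in> borel_measurable \<nu>" for m
      unfolding u_def by (intro borel_measurable_max borel_measurable_diff borel_measurable_times
          measurable_compose[OF _ borel_measurable_continuous_onI[OF continuous_on_infdist]]) auto
    have lim: "(\<lambda>m. u m b) \<longlonglongrightarrow> indicator K b" for b
    proof (cases "b \<in> K")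
      case True
      then show ?thesis by (simp add: u_def)
    next
      case bK: False
      then have pos: "0 < infdist b K"
        using K False by (metis compact_imp_closed in_closed_iff_infdist_zero infdist_nonneg less_eq_real_def)
      obtain m0 :: nat where m0: "1 / infdist b K < m0" using reals_Archimedean2 by blast
      have "eventually (\<lambda>m. u m b = 0) sequentially"
        using eventually_ge_at_top[of m0]
      proof eventually_elim
        case (elim m)
        then have "1 / infdist b K < real m" using m0 by linarith
        then show ?case using pos by (simp add: u_def divide_less_eq max_def)
      qed
      then show ?thesis using bK by (simp add: tendsto_eventually)
    qed
    have "(\<lambda>m. \<integral>b. \<bar>indicator K b - u m b\<bar> \<partial>\<nu>) \<longlonglongrightarrow> (\<integral>b. 0 \<partial>\<nu>)"
    proof (rule integral_dominated_convergence[where w = "\<lambda>_. 1"])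
      show "AE b in \<nu>. (\<lambda>m. \<bar>indicator K b - u m b\<bar>) \<longlonglongrightarrow> 0"
      proof (rule AE_I2)
        fix b show "(\<lambda>m. \<bar>indicator K b - u m b\<bar>) \<longlonglongrightarrow> 0"
          using tendsto_rabs[OF tendsto_diff[OF tendsto_const lim]] by (metis abs_zero diff_self)
      qed
      show "AE b in \<nu>. norm \<bar>indicator K b - u m b\<bar> \<le> 1" for m
        using u01 by (intro AE_I2) (simp add: abs_diff_unit_interval)
    qed (simp_all add: integrable_const)
    then obtain m where m: "(\<integral>b. \<bar>indicator K b - u m b\<bar> \<partial>\<nu>) < \<epsilon> / 2"
      using order_tendstoD(2)[of _ "0::real" sequentially "\<epsilon> / 2"] \<epsilon> by (auto simp: eventually_sequentially)
    have uc: "uniformly_continuous_on UNIV (u m)"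
      unfolding uniformly_continuous_on_def
    proof (intro allI impI)
      fix e :: real assume e: "0 < e"
      show "\<exists>d>0. \<forall>x\<in>UNIV. \<forall>x'\<in>UNIV. dist x' x < d \<longrightarrow> dist (u m x') (u m x) < e"
      proof (intro exI[of _ "e / (m + 1)"] conjI ballI impI)
        fix x x' :: 'b assume d: "dist x' x < e / (m + 1)"
        have "dist (u m x') (u m x) \<le> m * \<bar>infdist x' K - infdist x K\<bar>"
        proof -
          have "\<bar>max 0 (1 - s) - max 0 (1 - t)\<bar> \<le> \<bar>s - t\<bar>" for s t :: real by linarith
          from this[of "m * infdist x' K" "m * infdist x K"] show ?thesis
            by (simp add: u_def dist_real_def right_diff_distrib[symmetric] abs_mult)
        qed
        also have "\<dots> \<le> m * dist x' x"
          by (intro mult_left_mono infdist_triangle_abs) simp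
        also have "\<dots> \<le> (m + 1) * dist x' x" by (intro mult_right_mono) auto
        also have "\<dots> < e" using d by (simp add: field_simps)
        finally show "dist (u m x') (u m x) < e" .
      qed (use e in simp)
    qed
    have "(\<integral>b. \<bar>indicator B b - u m b\<bar> \<partial>\<nu>) \<le> (\<integral>b. \<bar>indicator B b - indicator K b\<bar> + \<bar>indicator K b - u m b\<bar> \<partial>\<nu>)"
    proof (rule integral_mono)
      show "integrable \<nu> (\<lambda>b. \<bar>indicator B b - u m b\<bar>)"
        "integrable \<nu> (\<lambda>b. \<bar>indicator B b - indicator K b\<bar> + \<bar>indicator K b - u m b\<bar>)"
        using u01
        by (intro Bochner_Integration.integrable_add integrable_const_bound[of _ 1] AE_I2;
            auto intro!: abs_diff_unit_interval)+
    qed auto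
    also have "\<dots> = (\<integral>b. \<bar>indicator B b - indicator K b\<bar> \<partial>\<nu>) + (\<integral>b. \<bar>indicator K b - u m b\<bar> \<partial>\<nu>)"
    proof (rule Bochner_Integration.integral_add)
      show "integrable \<nu> (\<lambda>b. \<bar>indicator B b - indicator K b\<bar> :: real)"
        by (intro integrable_const_bound[of _ 1] AE_I2) (auto intro!: abs_diff_unit_interval)
      show "integrable \<nu> (\<lambda>b. \<bar>indicator K b - u m b\<bar>)"
        using u01 by (intro integrable_const_bound[of _ 1] AE_I2) (auto intro!: abs_diff_unit_interval)
    qed
    also have "\<dots> < \<epsilon>" using BK m by simp
    finally show ?thesis using uc u01 by blast
  qed
qed

text \<open>
  Up to \<open>1 / m\<close>, a function with values in the unit interval is the mean of the indicators of its
  superlevel sets at heights \<open>k / m\<close>.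
\<close>

lemma borel_approx_uniformly_continuous:
  fixes \<nu> :: "'b::euclidean_space measure" and \<epsilon> :: real and h :: "'b \<Rightarrow> real"
  assumes "prob_space \<nu>" and sets: "sets \<nu> = sets borel" and h [measurable]: "h \<in> borel_measurable borel"
    and h01: "\<And>b. 0 \<le> h b" "\<And>b. h b \<le> 1" and \<epsilon>: "0 < \<epsilon>"
  shows "\<exists>u :: 'b \<Rightarrow> real. (\<forall>b. 0 \<le> u b \<and> u b \<le> 1) \<and> uniformly_continuous_on UNIV u \<and> (\<integral>b. \<bar>h b - u b\<bar> \<partial>\<nu>) < \<epsilon>"
proof -
  interpret prob_space \<nu> by fact
  note [measurable_cong] = sets
  obtain m :: nat where m: "2 / \<epsilon> < m" using reals_Archimedean2 by blast
  have m0: "0 < m" using m \<epsilon> by (metis divide_pos_pos gr0I less_asym of_nat_0 zero_less_numeral)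
  have "\<forall>k. \<exists>u :: 'b \<Rightarrow> real. (\<forall>b. 0 \<le> u b \<and> u b \<le> 1) \<and> uniformly_continuous_on UNIV u \<and>
      (\<integral>b. \<bar>indicator {b. real k \<le> m * h b} b - u b\<bar> \<partial>\<nu>) < \<epsilon> / 2"
    using finite_measure_axioms sets \<epsilon> by (intro allI indicator_approx_uniformly_continuous) auto
  then obtain u where u01: "\<And>k b. 0 \<le> u k b" "\<And>k b. u k b \<le> (1::real)"
    and uc: "\<And>k. uniformly_continuous_on UNIV (u k)"
    and u: "\<And>k. (\<integral>b. \<bar>indicator {b. real k \<le> m * h b} b - u k b\<bar> \<partial>\<nu>) < \<epsilon> / 2"
    by metis
  have [measurable]: "u k \<in> borel_measurable borel" for k
    using uniformly_continuous_imp_continuous[OF uc] by (rule borel_measurable_continuous_onI)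
  define v where "v b = (\<Sum>k=1..m. u k b) / m" for b
  have level: "\<bar>h b - (\<Sum>k=1..m. indicator {b. real k \<le> m * h b} b) / m\<bar> \<le> 1 / m" for b
  proof -
    have nn: "0 \<le> m * h b" "m * h b \<le> m" using h01[of b] by (auto simp: mult_left_le)
    have "{k \<in> {1..m}. real k \<le> m * h b} = {1..nat \<lfloor>m * h b\<rfloor>}"
      using nn by (auto simp: le_nat_iff le_floor_iff)
    then have "(\<Sum>k=1..m. indicator {b. real k \<le> m * h b} b :: real) = nat \<lfloor>m * h b\<rfloor>"
      by (simp add: indicator_def sum.If_cases Int_def)
    moreover have "\<bar>m * h b - nat \<lfloor>m * h b\<rfloor>\<bar> \<le> 1" using nn by (simp add: abs_le_iff) linarith
    moreover have "\<bar>h b - s / m\<bar> = \<bar>m * h b - s\<bar> / m" for s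
    proof -
      have "h b - s / m = (m * h b - s) / m" using m0 by (simp add: diff_divide_distrib)
      then show ?thesis by (simp only: abs_divide abs_of_nat)
    qed
    ultimately show ?thesis by (simp add: divide_right_mono)
  qed
  have ii: "integrable \<nu> (\<lambda>b. \<bar>indicator {b. real k \<le> m * h b} b - u k b\<bar>)" for k
    using u01 by (intro integrable_const_bound[of _ 1] AE_I2) (auto intro!: abs_diff_unit_interval)
  have vb: "0 \<le> v b" "v b \<le> 1" for b
  proof -
    show "0 \<le> v b" unfolding v_def using u01 by (intro divide_nonneg_nonneg sum_nonneg) auto
    have "(\<Sum>k=1..m. u k b) \<le> (\<Sum>k=1..m. 1)" using u01 by (intro sum_mono) auto
    then show "v b \<le> 1" using m0 by (simp add: v_def)
  qed
  have [measurable]: "v \<in> borel_measurable borel" unfolding v_def by measurable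
  have "(\<integral>b. \<bar>h b - v b\<bar> \<partial>\<nu>) \<le> (\<integral>b. 1 / m + (\<Sum>k=1..m. \<bar>indicator {b. real k \<le> m * h b} b - u k b\<bar>) / m \<partial>\<nu>)"
  proof (rule integral_mono)
    show "integrable \<nu> (\<lambda>b. \<bar>h b - v b\<bar>)"
      using vb h01 by (intro integrable_const_bound[of _ 1] AE_I2) (auto intro!: abs_diff_unit_interval)
    show "integrable \<nu> (\<lambda>b. 1 / m + (\<Sum>k=1..m. \<bar>indicator {b. real k \<le> m * h b} b - u k b\<bar>) / m)"
      using ii by (intro Bochner_Integration.integrable_add integrable_divide_zero Bochner_Integration.integrable_sum) auto
    fix b
    have "(\<Sum>k=1..m. indicator {b. real k \<le> m * h b} b) / m - v b
       = (\<Sum>k=1..m. indicator {b. real k \<le> m * h b} b - u k b) / m"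
      by (simp add: v_def sum_subtractf diff_divide_distrib)
    also have "\<bar>\<dots>\<bar> \<le> (\<Sum>k=1..m. \<bar>indicator {b. real k \<le> m * h b} b - u k b\<bar>) / m"
      by (simp add: abs_divide divide_right_mono sum_abs)
    finally show "\<bar>h b - v b\<bar> \<le> 1 / m + (\<Sum>k=1..m. \<bar>indicator {b. real k \<le> m * h b} b - u k b\<bar>) / m"
      using level[of b] by linarith
  qed
  also have "\<dots> = 1 / m + (\<Sum>k=1..m. \<integral>b. \<bar>indicator {b. real k \<le> m * h b} b - u k b\<bar> \<partial>\<nu>) / m"
    using ii by (simp add: Bochner_Integration.integral_sum prob_space)
  also have "\<dots> \<le> 1 / m + (\<Sum>k=1..m. \<epsilon> / 2) / m"
    using u by (intro add_left_mono divide_right_mono sum_mono) (auto intro: less_imp_le)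
  also have "\<dots> = 1 / m + \<epsilon> / 2" using m0 by simp
  also have "\<dots> < \<epsilon>" using m m0 \<epsilon> by (simp add: field_simps)
  finally have "(\<integral>b. \<bar>h b - v b\<bar> \<partial>\<nu>) < \<epsilon>" .
  moreover have "uniformly_continuous_on UNIV v"
  proof -
    have "uniformly_continuous_on UNIV (\<lambda>b. \<Sum>k\<in>J. u k b)" if "finite J" for J
      using that by (induction J rule: finite_induct) (auto intro: uniformly_continuous_on_const uniformly_continuous_on_add uc)
    then have "uniformly_continuous_on UNIV (\<lambda>b. (1 / m) *\<^sub>R (\<Sum>k=1..m. u k b))"
      by (intro uniformly_continuous_on_cmul) simp
    moreover have "v = (\<lambda>b. (1 / m) *\<^sub>R (\<Sum>k=1..m. u k b))" by (auto simp: v_def)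
    ultimately show ?thesis by (simp only:)
  qed
  ultimately show ?thesis using vb by blast
qed

text \<open>
  A row whose point has some neighbour within \<open>\<delta>\<close> puts all its weight within \<open>\<delta>\<close>. The
  remaining rows belong to isolated points, of which there are few, or to points far out.
\<close>

lemma nn_form_dist_le:
  fixes z :: "nat \<Rightarrow> 'b::euclidean_space" and u :: "'b \<Rightarrow> real" and \<eta> \<delta> R :: real
  assumes I: "finite I" and u01: "\<And>b. 0 \<le> u b" "\<And>b. u b \<le> 1" and \<eta>: "0 \<le> \<eta>"
    and uc: "\<And>a b. dist a b < \<delta> \<Longrightarrow> \<bar>u a - u b\<bar> \<le> \<eta>"
    and N: "card {i\<in>I. norm (z i) \<le> R \<and> (\<forall>j\<in>I - {i}. \<delta> \<le> dist (z i) (z j))} \<le> N"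
  shows "(\<Sum>i\<in>I. \<Sum>j\<in>I. nn_weight I z i j * \<bar>u (z i) - u (z j)\<bar>)
    \<le> \<eta> * card I + N + (\<Sum>i\<in>I. of_bool (R < norm (z i)))"
proof -
  define S where "S = {i\<in>I. norm (z i) \<le> R \<and> (\<forall>j\<in>I - {i}. \<delta> \<le> dist (z i) (z j))}"
  have row: "(\<Sum>j\<in>I. nn_weight I z i j * \<bar>u (z i) - u (z j)\<bar>)
      \<le> \<eta> + of_bool (i \<in> S) + of_bool (R < norm (z i))" if i: "i \<in> I" for i
  proof -
    have bnd: "(\<Sum>j\<in>I. nn_weight I z i j * \<bar>u (z i) - u (z j)\<bar>) \<le> c"
      if c: "0 \<le> c" "\<And>j. j \<in> nn_set I z i \<Longrightarrow> \<bar>u (z i) - u (z j)\<bar> \<le> c" for c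
    proof -
      have "(\<Sum>j\<in>I. nn_weight I z i j * \<bar>u (z i) - u (z j)\<bar>) \<le> (\<Sum>j\<in>I. nn_weight I z i j * c)"
      proof (rule sum_mono)
        fix j assume "j \<in> I"
        show "nn_weight I z i j * \<bar>u (z i) - u (z j)\<bar> \<le> nn_weight I z i j * c"
        proof (cases "j \<in> nn_set I z i")
          case True
          then show ?thesis using c by (intro mult_left_mono nn_weight_nonneg) auto
        next
          case False
          then show ?thesis by (simp add: nn_weight_def)
        qed
      qed
      also have "\<dots> = (\<Sum>j\<in>I. nn_weight I z i j) * c" by (simp add: sum_distrib_right)
      also have "\<dots> \<le> 1 * c" using I c by (intro mult_right_mono sum_nn_weight_le_1) auto
      finally show ?thesis by simp
    qed
    show ?thesis
    proof (cases "i \<in> S \<or> R < norm (z i)")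
      case True
      have "(\<Sum>j\<in>I. nn_weight I z i j * \<bar>u (z i) - u (z j)\<bar>) \<le> 1"
        using u01 by (intro bnd) (auto intro!: abs_diff_unit_interval)
      then show ?thesis using True \<eta> by auto
    next
      case False
      then obtain m where m: "m \<in> I - {i}" "dist (z i) (z m) < \<delta>"
        using i by (auto simp: S_def not_le)
      have "(\<Sum>j\<in>I. nn_weight I z i j * \<bar>u (z i) - u (z j)\<bar>) \<le> \<eta>"
      proof (rule bnd[OF \<eta>])
        fix j assume "j \<in> nn_set I z i"
        then have "dist (z i) (z j) \<le> dist (z i) (z m)" using m by (auto simp: nn_set_def)
        then show "\<bar>u (z i) - u (z j)\<bar> \<le> \<eta>" using m by (intro uc) auto
      qed
      then show ?thesis by simp
    qed
  qed
  have "(\<Sum>i\<in>I. \<Sum>j\<in>I. nn_weight I z i j * \<bar>u (z i) - u (z j)\<bar>)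
      \<le> (\<Sum>i\<in>I. \<eta> + of_bool (i \<in> S) + of_bool (R < norm (z i)))"
    using row by (rule sum_mono)
  also have "\<dots> = \<eta> * card I + (\<Sum>i\<in>I. of_bool (i \<in> S)) + (\<Sum>i\<in>I. of_bool (R < norm (z i)))"
    by (simp add: sum.distrib mult.commute del: sum_of_bool_eq)
  also have "(\<Sum>i\<in>I. of_bool (i \<in> S) :: real) = card S"
  proof -
    have "I \<inter> {i. i \<in> S} = S" by (auto simp: S_def)
    then show ?thesis using I by simp
  qed
  finally show ?thesis using N by (simp add: S_def[symmetric] del: sum_of_bool_eq)
qed

text \<open>
  The error at \<open>i\<close> is weighted by a row sum, the error at the neighbour \<open>j\<close> by a column sum. The bounded
  column sums are what makes approximation in mean sufficient.
\<close>

lemma nn_form_oscillation_approx: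
  fixes z :: "nat \<Rightarrow> 'b::metric_space" and u h :: "'b \<Rightarrow> real"
  assumes I: "finite I" and C: "\<And>j. (\<Sum>i\<in>I. nn_weight I z i j) \<le> C"
  shows "(\<Sum>i\<in>I. \<Sum>j\<in>I. nn_weight I z i j * \<bar>h (z i) - h (z j)\<bar>)
    \<le> (\<Sum>i\<in>I. \<Sum>j\<in>I. nn_weight I z i j * \<bar>u (z i) - u (z j)\<bar>) + (1 + C) * (\<Sum>i\<in>I. \<bar>h (z i) - u (z i)\<bar>)"
proof -
  let ?e = "\<lambda>i. \<bar>h (z i) - u (z i)\<bar>"
  have "(\<Sum>i\<in>I. \<Sum>j\<in>I. nn_weight I z i j * \<bar>h (z i) - h (z j)\<bar>)
     \<le> (\<Sum>i\<in>I. \<Sum>j\<in>I. nn_weight I z i j * \<bar>u (z i) - u (z j)\<bar> + nn_weight I z i j * ?e i + nn_weight I z i j * ?e j)"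
  proof (intro sum_mono)
    fix i j
    have "\<bar>h (z i) - h (z j)\<bar> \<le> \<bar>u (z i) - u (z j)\<bar> + ?e i + ?e j" by linarith
    from mult_left_mono[OF this nn_weight_nonneg[of I z i j]]
    show "nn_weight I z i j * \<bar>h (z i) - h (z j)\<bar>
       \<le> nn_weight I z i j * \<bar>u (z i) - u (z j)\<bar> + nn_weight I z i j * ?e i + nn_weight I z i j * ?e j"
      by (simp add: distrib_left)
  qed
  also have "\<dots> = (\<Sum>i\<in>I. \<Sum>j\<in>I. nn_weight I z i j * \<bar>u (z i) - u (z j)\<bar>)
      + (\<Sum>i\<in>I. (\<Sum>j\<in>I. nn_weight I z i j) * ?e i) + (\<Sum>j\<in>I. (\<Sum>i\<in>I. nn_weight I z i j) * ?e j)"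
    by (simp add: sum.distrib sum_distrib_right sum.swap[of "\<lambda>i j. nn_weight I z i j * ?e j" I I])
  finally have *: "(\<Sum>i\<in>I. \<Sum>j\<in>I. nn_weight I z i j * \<bar>h (z i) - h (z j)\<bar>)
     \<le> (\<Sum>i\<in>I. \<Sum>j\<in>I. nn_weight I z i j * \<bar>u (z i) - u (z j)\<bar>)
      + (\<Sum>i\<in>I. (\<Sum>j\<in>I. nn_weight I z i j) * ?e i) + (\<Sum>j\<in>I. (\<Sum>i\<in>I. nn_weight I z i j) * ?e j)" .
  have "(\<Sum>i\<in>I. (\<Sum>j\<in>I. nn_weight I z i j) * ?e i) \<le> (\<Sum>i\<in>I. 1 * ?e i)"
    using I by (intro sum_mono mult_right_mono sum_nn_weight_le_1) auto
  moreover have "(\<Sum>j\<in>I. (\<Sum>i\<in>I. nn_weight I z i j) * ?e j) \<le> (\<Sum>j\<in>I. C * ?e j)"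
    using C by (intro sum_mono mult_right_mono) auto
  ultimately show ?thesis using * by (simp add: distrib_right sum_distrib_left[symmetric])
qed

text \<open>
  Here \<open>h\<close> is a version of the conditional expectation of \<open>f\<close> given \<open>gv\<close>, characterised by test
  functions, which carries over to one coordinate of a product directly. If \<open>G\<close> depends on record \<open>i\<close> only through its feature, \<open>f\<close> at that record can be
  averaged for fixed values of all others.
\<close>

lemma PiM_replace_by_conditional_expectation:
  fixes f :: "'r \<Rightarrow> real" and h :: "'b::topological_space \<Rightarrow> real" and gv :: "'r \<Rightarrow> 'b"
  assumes "prob_space \<mu>" and I: "finite I" "i \<in> I"
    and [measurable]: "f \<in> borel_measurable \<mu>" "gv \<in> borel_measurable \<mu>" "h \<in> borel_measurable borel"
    and f01: "\<And>r. 0 \<le> f r" "\<And>r. f r \<le> 1" and h01: "\<And>b. 0 \<le> h b" "\<And>b. h b \<le> 1"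
    and cond: "\<And>\<phi>. \<phi> \<in> borel_measurable borel \<Longrightarrow> (\<And>b. \<bar>\<phi> b\<bar> \<le> 1)
      \<Longrightarrow> (\<integral>r. \<phi> (gv r) * f r \<partial>\<mu>) = (\<integral>r. \<phi> (gv r) * h (gv r) \<partial>\<mu>)"
    and G [measurable]: "G \<in> borel_measurable (\<Pi>\<^sub>M i\<in>I. \<mu>)" and G1: "\<And>x. \<bar>G x\<bar> \<le> 1"
    and \<phi>: "\<And>x v. x \<in> space (\<Pi>\<^sub>M i\<in>I - {i}. \<mu>) \<Longrightarrow> G (x(i := v)) = \<phi> x (gv v)"
      "\<And>x. x \<in> space (\<Pi>\<^sub>M i\<in>I - {i}. \<mu>) \<Longrightarrow> \<phi> x \<in> borel_measurable borel" "\<And>x b. \<bar>\<phi> x b\<bar> \<le> 1"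
  shows "(\<integral>x. G x * f (x i) \<partial>(\<Pi>\<^sub>M i\<in>I. \<mu>)) = (\<integral>x. G x * h (gv (x i)) \<partial>(\<Pi>\<^sub>M i\<in>I. \<mu>))"
proof -
  interpret mu: prob_space \<mu> by fact
  interpret product_prob_space "\<lambda>_. \<mu>" UNIV by unfold_locales
  interpret PI: prob_space "\<Pi>\<^sub>M i\<in>I. \<mu>" by (rule prob_space_PiM) unfold_locales
  have ins: "insert i (I - {i}) = I" using I by auto
  have Gf: "\<bar>G x * c\<bar> \<le> 1" if "0 \<le> c" "c \<le> 1" for x c
    using that G1[of x] by (simp add: abs_mult mult_le_one)
  have [measurable]: "(\<lambda>x. x i) \<in> (\<Pi>\<^sub>M i\<in>I. \<mu>) \<rightarrow>\<^sub>M \<mu>" using I by simp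
  have "(\<integral>x. G x * f (x i) \<partial>(\<Pi>\<^sub>M i\<in>I. \<mu>)) = (\<integral>x. (\<integral>v. G (x(i := v)) * f ((x(i := v)) i) \<partial>\<mu>) \<partial>(\<Pi>\<^sub>M i\<in>I - {i}. \<mu>))"
    using I f01 Gf
    by (subst product_integral_insert[of "I - {i}" i "\<lambda>x. G x * f (x i)", unfolded ins])
      (auto intro!: PI.integrable_const_bound[of _ 1])
  also have "\<dots> = (\<integral>x. (\<integral>v. G (x(i := v)) * h (gv ((x(i := v)) i)) \<partial>\<mu>) \<partial>(\<Pi>\<^sub>M i\<in>I - {i}. \<mu>))"
  proof (rule Bochner_Integration.integral_cong[OF refl])
    fix x assume x: "x \<in> space (\<Pi>\<^sub>M i\<in>I - {i}. \<mu>)"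
    show "(\<integral>v. G (x(i := v)) * f ((x(i := v)) i) \<partial>\<mu>) = (\<integral>v. G (x(i := v)) * h (gv ((x(i := v)) i)) \<partial>\<mu>)"
      using cond[OF \<phi>(2)[OF x] \<phi>(3)] by (simp add: \<phi>(1)[OF x] fun_upd_same del: fun_upd_apply)
  qed
  also have "\<dots> = (\<integral>x. G x * h (gv (x i)) \<partial>(\<Pi>\<^sub>M i\<in>I. \<mu>))"
    using I h01 Gf
    by (subst product_integral_insert[of "I - {i}" i "\<lambda>x. G x * h (gv (x i))", unfolded ins])
      (auto intro!: PI.integrable_const_bound[of _ 1])
  finally show ?thesis .
qed

text \<open>
  The weights are functions of the features, and there are no diagonal terms, so both indicators of a
  product can be averaged in turn.
\<close>

lemma expectation_nn_form_conditional:
  fixes f :: "'r \<Rightarrow> real" and h :: "'b::euclidean_space \<Rightarrow> real" and gv :: "'r \<Rightarrow> 'b" and I :: "nat set"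
  assumes \<mu>: "prob_space \<mu>" and I: "finite I"
    and f [measurable]: "f \<in> borel_measurable \<mu>" and gv [measurable]: "gv \<in> borel_measurable \<mu>"
    and h [measurable]: "h \<in> borel_measurable borel"
    and f01: "\<And>r. 0 \<le> f r" "\<And>r. f r \<le> 1" and h01: "\<And>b. 0 \<le> h b" "\<And>b. h b \<le> 1"
    and cond: "\<And>\<phi>. \<phi> \<in> borel_measurable borel \<Longrightarrow> (\<And>b. \<bar>\<phi> b\<bar> \<le> 1)
      \<Longrightarrow> (\<integral>r. \<phi> (gv r) * f r \<partial>\<mu>) = (\<integral>r. \<phi> (gv r) * h (gv r) \<partial>\<mu>)"
  shows "(\<integral>x. nn_form I (\<lambda>i. gv (x i)) (\<lambda>i. f (x i)) \<partial>(\<Pi>\<^sub>M i\<in>I. \<mu>))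
    = (\<integral>x. nn_form I (\<lambda>i. gv (x i)) (\<lambda>i. h (gv (x i))) \<partial>(\<Pi>\<^sub>M i\<in>I. \<mu>))"
proof -
  interpret mu: prob_space \<mu> by fact
  let ?P = "\<Pi>\<^sub>M i\<in>I. \<mu>"
  interpret PI: prob_space ?P by (rule prob_space_PiM) unfold_locales
  let ?w = "\<lambda>x i j. nn_weight I (\<lambda>i. gv (x i)) i j"
  have w [measurable]: "(\<lambda>x. ?w x i j) \<in> borel_measurable ?P" if "i \<in> I" for i j
    using I that by (intro borel_measurable_nn_weight) auto
  have wub: "(\<lambda>b. nn_weight I ((\<lambda>i. gv (x i))(k := b)) i j) \<in> borel_measurable borel"
    if "i \<in> I" for i j k and x :: "nat \<Rightarrow> 'r"
  proof -
    have "(\<lambda>b. nn_weight I (\<lambda>m. if m = k then b else gv (x m)) i j) \<in> borel_measurable borel"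
      using I that by (intro borel_measurable_nn_weight) auto
    then show ?thesis by (simp only: fun_upd_def)
  qed
  have upd: "?w (x(k := v)) i j = nn_weight I ((\<lambda>i. gv (x i))(k := gv v)) i j" for x k v i j
    by (rule arg_cong[where f = "\<lambda>z. nn_weight I z i j"]) auto
  have wf: "\<bar>nn_weight I z i j * c\<bar> \<le> 1" if "0 \<le> c" "c \<le> 1" for z :: "nat \<Rightarrow> 'b" and i j and c :: real
    using that nn_weight_nonneg[of I z i j] nn_weight_le_1[of I z i j] by (simp add: abs_mult mult_le_one)
  have wff: "\<bar>nn_weight I z i j * c * d\<bar> \<le> 1"
    if "0 \<le> c" "c \<le> 1" "0 \<le> d" "d \<le> 1" for z :: "nat \<Rightarrow> 'b" and i j and c d :: real
    using wf[of "c * d" z i j] that by (simp add: mult.assoc mult_le_one)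
  have pair: "(\<integral>x. ?w x i j * f (x i) * f (x j) \<partial>?P) = (\<integral>x. ?w x i j * h (gv (x i)) * h (gv (x j)) \<partial>?P)"
    if ij: "i \<in> I" "j \<in> I" for i j
  proof (cases "i = j")
    case False
    note [measurable] = ij
    have "(\<integral>x. ?w x i j * f (x i) * f (x j) \<partial>?P) = (\<integral>x. (?w x i j * f (x j)) * f (x i) \<partial>?P)"
      by (simp add: algebra_simps)
    also have "\<dots> = (\<integral>x. (?w x i j * f (x j)) * h (gv (x i)) \<partial>?P)"
    proof (rule PiM_replace_by_conditional_expectation[OF \<mu> I ij(1) f gv h f01 h01 cond,
          where \<phi> = "\<lambda>x b. nn_weight I ((\<lambda>i. gv (x i))(i := b)) i j * f (x j)"])
      show "(\<lambda>x. ?w x i j * f (x j)) \<in> borel_measurable ?P" using ij by measurable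
      show "?w (x(i := v)) i j * f ((x(i := v)) j) = nn_weight I ((\<lambda>i. gv (x i))(i := gv v)) i j * f (x j)" for x v
        using False by (simp only: upd) simp
      show "(\<lambda>b. nn_weight I ((\<lambda>i. gv (x i))(i := b)) i j * f (x j)) \<in> borel_measurable borel" for x
        using wub[OF ij(1)] by (intro borel_measurable_times) auto
    qed (use wf f01 in auto)
    also have "\<dots> = (\<integral>x. (?w x i j * h (gv (x i))) * f (x j) \<partial>?P)"
      by (simp add: algebra_simps)
    also have "\<dots> = (\<integral>x. (?w x i j * h (gv (x i))) * h (gv (x j)) \<partial>?P)"
    proof (rule PiM_replace_by_conditional_expectation[OF \<mu> I ij(2) f gv h f01 h01 cond,
          where \<phi> = "\<lambda>x b. nn_weight I ((\<lambda>i. gv (x i))(j := b)) i j * h (gv (x i))"])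
      show "(\<lambda>x. ?w x i j * h (gv (x i))) \<in> borel_measurable ?P" using ij by measurable
      show "?w (x(j := v)) i j * h (gv ((x(j := v)) i)) = nn_weight I ((\<lambda>i. gv (x i))(j := gv v)) i j * h (gv (x i))" for x v
        using False by (simp only: upd) simp
      show "(\<lambda>b. nn_weight I ((\<lambda>i. gv (x i))(j := b)) i j * h (gv (x i))) \<in> borel_measurable borel" for x
        using wub[OF ij(1)] by (intro borel_measurable_times) auto
    qed (use wf h01 in auto)
    finally show ?thesis .
  qed simp
  have "(\<integral>x. nn_form I (\<lambda>i. gv (x i)) (\<lambda>i. f (x i)) \<partial>?P) = (\<Sum>i\<in>I. \<Sum>j\<in>I. \<integral>x. ?w x i j * f (x i) * f (x j) \<partial>?P)"
    unfolding nn_form_def using wff f01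
    by (subst Bochner_Integration.integral_sum, force intro!: Bochner_Integration.integrable_sum PI.integrable_const_bound[of _ 1])
      (intro sum.cong refl Bochner_Integration.integral_sum PI.integrable_const_bound[of _ 1]; simp)
  also have "\<dots> = (\<Sum>i\<in>I. \<Sum>j\<in>I. \<integral>x. ?w x i j * h (gv (x i)) * h (gv (x j)) \<partial>?P)"
    using pair by (intro sum.cong refl)
  also have "\<dots> = (\<integral>x. nn_form I (\<lambda>i. gv (x i)) (\<lambda>i. h (gv (x i))) \<partial>?P)"
    unfolding nn_form_def using wff h01
    by (subst Bochner_Integration.integral_sum, force intro!: Bochner_Integration.integrable_sum PI.integrable_const_bound[of _ 1])
      (intro sum.cong refl Bochner_Integration.integral_sum[symmetric] PI.integrable_const_bound[of _ 1]; simp)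
  finally show ?thesis .
qed

lemma expectation_PiM_sum:
  fixes t :: "'r \<Rightarrow> real" and I :: "nat set"
  assumes "prob_space \<mu>" and I: "finite I" and [measurable]: "t \<in> borel_measurable \<mu>"
    and t: "\<And>r. \<bar>t r\<bar> \<le> B"
  shows "integrable (\<Pi>\<^sub>M i\<in>I. \<mu>) (\<lambda>x. \<Sum>i\<in>I. t (x i))"
    and "(\<integral>x. (\<Sum>i\<in>I. t (x i)) \<partial>(\<Pi>\<^sub>M i\<in>I. \<mu>)) = card I * (\<integral>r. t r \<partial>\<mu>)"
proof -
  interpret mu: prob_space \<mu> by fact
  interpret PI: prob_space "\<Pi>\<^sub>M i\<in>I. \<mu>" by (rule prob_space_PiM) unfold_locales
  have int: "integrable (\<Pi>\<^sub>M i\<in>I. \<mu>) (\<lambda>x. t (x i))" if i: "i \<in> I" for i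
    using i t by (intro PI.integrable_const_bound[of _ B]) auto
  then show "integrable (\<Pi>\<^sub>M i\<in>I. \<mu>) (\<lambda>x. \<Sum>i\<in>I. t (x i))" by (intro Bochner_Integration.integrable_sum)
  have E: "(\<integral>x. t (x i) \<partial>(\<Pi>\<^sub>M i\<in>I. \<mu>)) = (\<integral>r. t r \<partial>\<mu>)" if i: "i \<in> I" for i
  proof -
    have "\<mu> = distr (\<Pi>\<^sub>M i\<in>I. \<mu>) \<mu> (\<lambda>x. x i)"
      using distr_PiM_component[of I "\<lambda>_. \<mu>" i] i mu.prob_space_axioms by simp
    then have "(\<integral>r. t r \<partial>\<mu>) = (\<integral>r. t r \<partial>distr (\<Pi>\<^sub>M i\<in>I. \<mu>) \<mu> (\<lambda>x. x i))" by simp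
    also have "\<dots> = (\<integral>x. t (x i) \<partial>(\<Pi>\<^sub>M i\<in>I. \<mu>))" using i by (subst integral_distr) auto
    finally show ?thesis by simp
  qed
  show "(\<integral>x. (\<Sum>i\<in>I. t (x i)) \<partial>(\<Pi>\<^sub>M i\<in>I. \<mu>)) = card I * (\<integral>r. t r \<partial>\<mu>)"
    using int E by (simp add: Bochner_Integration.integral_sum)
qed


lemma norm_tail_small:
  fixes gv :: "'r \<Rightarrow> 'b::euclidean_space"
  assumes "prob_space \<mu>" and [measurable]: "gv \<in> borel_measurable \<mu>" and \<epsilon>: "0 < \<epsilon>"
  shows "\<exists>R. measure \<mu> {r \<in> space \<mu>. R < norm (gv r)} < \<epsilon>"
proof -
  interpret prob_space \<mu> by fact
  let ?A = "\<lambda>n::nat. {r \<in> space \<mu>. real n < norm (gv r)}"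
  have "(\<lambda>n. measure \<mu> (?A n)) \<longlonglongrightarrow> measure \<mu> (\<Inter>n. ?A n)"
    by (intro finite_Lim_measure_decseq) (auto simp: decseq_def)
  moreover have "(\<Inter>n. ?A n) = {}"
  proof -
    have False if r: "r \<in> (\<Inter>n. ?A n)" for r
    proof -
      obtain n :: nat where "norm (gv r) \<le> n" using real_arch_simple by blast
      moreover have "real n < norm (gv r)" using r by blast
      ultimately show False by simp
    qed
    then show ?thesis by blast
  qed
  ultimately have "(\<lambda>n. measure \<mu> (?A n)) \<longlonglongrightarrow> 0" by simp
  then have "eventually (\<lambda>n. measure \<mu> (?A n) < \<epsilon>) sequentially" using \<epsilon> by (rule order_tendstoD)
  then show ?thesis by (auto simp: eventually_sequentially)
qed

text \<open>
  By the unit row sums, the deviation from the sum of squares is at most the total oscillation of \<open>h\<close>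
  along the neighbour weights.
\<close>

theorem expectation_nn_form_tendsto:
  fixes f :: "'r \<Rightarrow> real" and h :: "'b::euclidean_space \<Rightarrow> real" and gv :: "'r \<Rightarrow> 'b"
  assumes \<mu>: "prob_space \<mu>"
    and f [measurable]: "f \<in> borel_measurable \<mu>" and gv [measurable]: "gv \<in> borel_measurable \<mu>"
    and h [measurable]: "h \<in> borel_measurable borel"
    and f01: "\<And>r. 0 \<le> f r" "\<And>r. f r \<le> 1" and h01: "\<And>b. 0 \<le> h b" "\<And>b. h b \<le> 1"
    and cond: "\<And>\<phi>. \<phi> \<in> borel_measurable borel \<Longrightarrow> (\<And>b. \<bar>\<phi> b\<bar> \<le> 1)
      \<Longrightarrow> (\<integral>r. \<phi> (gv r) * f r \<partial>\<mu>) = (\<integral>r. \<phi> (gv r) * h (gv r) \<partial>\<mu>)"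
  shows "(\<lambda>n. (\<integral>x. nn_form {..<n} (\<lambda>i. gv (x i)) (\<lambda>i. f (x i)) \<partial>(\<Pi>\<^sub>M i\<in>{..<n::nat}. \<mu>)) / real n)
    \<longlonglongrightarrow> (\<integral>r. (h (gv r))\<^sup>2 \<partial>\<mu>)"
proof -
  interpret mu: prob_space \<mu> by fact
  obtain C :: real where C0: "0 \<le> C"
    and C: "\<And>I (z :: nat \<Rightarrow> 'b) j. finite I \<Longrightarrow> (\<Sum>i\<in>I. nn_weight I z i j) \<le> C"
    by (rule nn_in_degree_bounded[where 'b='b], rule that)
  \<comment> \<open>The total oscillation of \<open>h\<close> along the neighbour weights.\<close>
  define osc where "osc n x = (\<Sum>i<n. \<Sum>j<n. nn_weight {..<n} (\<lambda>i. gv (x i)) i j * \<bar>h (gv (x i)) - h (gv (x j))\<bar>)"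
    for n and x :: "nat \<Rightarrow> 'r"
  let ?P = "\<lambda>n. \<Pi>\<^sub>M i\<in>{..<n::nat}. \<mu>"
  have P: "prob_space (?P n)" for n by (rule prob_space_PiM) unfold_locales
  have osc_m [measurable]: "osc n \<in> borel_measurable (?P n)" for n
    unfolding osc_def by (intro borel_measurable_sum borel_measurable_times borel_measurable_nn_weight) auto
  have osc_nonneg: "0 \<le> osc n x" for n x
    unfolding osc_def by (intro sum_nonneg mult_nonneg_nonneg nn_weight_nonneg) auto
  have osc_le: "osc n x \<le> n" for n x
  proof -
    have "osc n x \<le> (\<Sum>i<n. \<Sum>j<n. nn_weight {..<n} (\<lambda>i. gv (x i)) i j * 1)"
      unfolding osc_def using h01
      by (intro sum_mono mult_left_mono nn_weight_nonneg abs_diff_unit_interval) auto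
    also have "\<dots> \<le> (\<Sum>i<n. 1)" by (intro sum_mono) (simp add: sum_nn_weight_le_1)
    finally show ?thesis by simp
  qed
  have osc_int: "integrable (?P n) (osc n)" for n
    using osc_nonneg osc_le prob_space.finite_measure[OF P]
    by (intro finite_measure.integrable_const_bound[of _ _ "real n"]) (auto simp: abs_of_nonneg)
  have osc_small: "eventually (\<lambda>n. (\<integral>x. osc n x \<partial>?P n) / n < \<epsilon>) sequentially" if \<epsilon>: "0 < \<epsilon>" for \<epsilon>
  proof -
    let ?nu = "distr \<mu> borel gv"
    \<comment> \<open>A quarter of \<open>\<epsilon>\<close> each for the approximation, the continuity, the tail and the isolated points.\<close>
    have "0 < \<epsilon> / (4 * (1 + C))" using \<epsilon> C0 by simp
    then obtain u :: "'b \<Rightarrow> real" where u01: "\<And>b. 0 \<le> u b" "\<And>b. u b \<le> 1"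
      and uc: "uniformly_continuous_on UNIV u" and u': "(\<integral>b. \<bar>h b - u b\<bar> \<partial>?nu) < \<epsilon> / (4 * (1 + C))"
      using borel_approx_uniformly_continuous[of ?nu h "\<epsilon> / (4 * (1 + C))"] h01 mu.prob_space_distr[OF gv]
      by auto
    have [measurable]: "u \<in> borel_measurable borel"
      using uniformly_continuous_imp_continuous[OF uc] by (rule borel_measurable_continuous_onI)
    have u: "(\<integral>r. \<bar>h (gv r) - u (gv r)\<bar> \<partial>\<mu>) < \<epsilon> / (4 * (1 + C))"
      using u' by (subst (asm) integral_distr) auto
    obtain \<delta> where \<delta>: "0 < \<delta>" "\<And>a b. dist a b < \<delta> \<Longrightarrow> \<bar>u a - u b\<bar> \<le> \<epsilon> / 4"
    proof -
      have "0 < \<epsilon> / 4" using \<epsilon> by simp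
      then obtain d where "0 < d" "\<forall>x\<in>UNIV. \<forall>x'\<in>UNIV. dist x' x < d \<longrightarrow> dist (u x') (u x) < \<epsilon> / 4"
        using uc unfolding uniformly_continuous_on_def by blast
      then show thesis by (intro that[of d]) (auto simp: dist_real_def intro: less_imp_le)
    qed
    have "0 < \<epsilon> / 4" using \<epsilon> by simp
    from norm_tail_small[OF \<mu> gv this] obtain R
      where R: "measure \<mu> {r \<in> space \<mu>. R < norm (gv r)} < \<epsilon> / 4" ..
    obtain N where N: "\<And>I (z :: nat \<Rightarrow> 'b).
       card {i\<in>I. norm (z i) \<le> R \<and> (\<forall>j\<in>I - {i}. \<delta> \<le> dist (z i) (z j))} \<le> N"
      by (rule isolated_points_bounded[OF \<delta>(1), where 'b='b and R=R], rule that)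
    have bound: "osc n x \<le> \<epsilon> / 4 * n + N + (\<Sum>i<n. of_bool (R < norm (gv (x i))))
        + (1 + C) * (\<Sum>i<n. \<bar>h (gv (x i)) - u (gv (x i))\<bar>)" for n x
    proof -
      have "osc n x \<le> (\<Sum>i<n. \<Sum>j<n. nn_weight {..<n} (\<lambda>i. gv (x i)) i j * \<bar>u (gv (x i)) - u (gv (x j))\<bar>)
          + (1 + C) * (\<Sum>i<n. \<bar>h (gv (x i)) - u (gv (x i))\<bar>)"
        unfolding osc_def using C by (intro nn_form_oscillation_approx) auto
      moreover have "(\<Sum>i<n. \<Sum>j<n. nn_weight {..<n} (\<lambda>i. gv (x i)) i j * \<bar>u (gv (x i)) - u (gv (x j))\<bar>)
          \<le> \<epsilon> / 4 * card {..<n} + N + (\<Sum>i<n. of_bool (R < norm (gv (x i))))"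
        using u01 \<epsilon> \<delta> N[of "{..<n}" "\<lambda>i. gv (x i)"]
        by (intro nn_form_dist_le[where \<delta> = \<delta> and R = R]) auto
      ultimately show ?thesis by simp
    qed
    have E: "(\<integral>x. osc n x \<partial>?P n) / n < 3 * \<epsilon> / 4 + N / n" if n: "0 < n" for n
    proof -
      interpret PI: prob_space "?P n" by (rule P)
      have s1: "integrable (?P n) (\<lambda>x. \<Sum>i<n. of_bool (R < norm (gv (x i))) :: real)"
        "(\<integral>x. (\<Sum>i<n. of_bool (R < norm (gv (x i)))) \<partial>?P n) = n * measure \<mu> {r \<in> space \<mu>. R < norm (gv r)}"
      proof -
        have [measurable]: "(\<lambda>r. of_bool (R < norm (gv r)) :: real) \<in> borel_measurable \<mu>" by measurable
        show "integrable (?P n) (\<lambda>x. \<Sum>i<n. of_bool (R < norm (gv (x i))) :: real)"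
          by (rule expectation_PiM_sum(1)[OF \<mu>, where B = 1]) auto
        have "(\<integral>r. of_bool (R < norm (gv r)) \<partial>\<mu>) = (\<integral>r. indicator {r \<in> space \<mu>. R < norm (gv r)} r \<partial>\<mu>)"
          by (intro Bochner_Integration.integral_cong) (auto simp: indicator_def)
        also have "\<dots> = measure \<mu> {r \<in> space \<mu>. R < norm (gv r)}" by simp
        finally have "(\<integral>r. of_bool (R < norm (gv r)) \<partial>\<mu>) = measure \<mu> {r \<in> space \<mu>. R < norm (gv r)}" .
        moreover have "(\<integral>x. (\<Sum>i<n. of_bool (R < norm (gv (x i)))) \<partial>?P n) = card {..<n} * (\<integral>r. of_bool (R < norm (gv r)) \<partial>\<mu>)"
          by (rule expectation_PiM_sum(2)[OF \<mu>, where B = 1]) auto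
        ultimately show "(\<integral>x. (\<Sum>i<n. of_bool (R < norm (gv (x i)))) \<partial>?P n) = n * measure \<mu> {r \<in> space \<mu>. R < norm (gv r)}"
          by simp
      qed
      have s2: "integrable (?P n) (\<lambda>x. \<Sum>i<n. \<bar>h (gv (x i)) - u (gv (x i))\<bar>)"
        "(\<integral>x. (\<Sum>i<n. \<bar>h (gv (x i)) - u (gv (x i))\<bar>) \<partial>?P n) = n * (\<integral>r. \<bar>h (gv r) - u (gv r)\<bar> \<partial>\<mu>)"
        using expectation_PiM_sum[OF \<mu>, of "{..<n}" "\<lambda>r. \<bar>h (gv r) - u (gv r)\<bar>" 1] h01 u01
        by (auto intro!: abs_diff_unit_interval)
      have "(\<integral>x. osc n x \<partial>?P n) \<le> (\<integral>x. \<epsilon> / 4 * n + N + (\<Sum>i<n. of_bool (R < norm (gv (x i))))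
        + (1 + C) * (\<Sum>i<n. \<bar>h (gv (x i)) - u (gv (x i))\<bar>) \<partial>?P n)"
        using s1(1) s2(1) by (intro integral_mono osc_int bound Bochner_Integration.integrable_add integrable_mult_right) auto
      also have "\<dots> = \<epsilon> / 4 * n + N + n * measure \<mu> {r \<in> space \<mu>. R < norm (gv r)}
          + (1 + C) * (n * (\<integral>r. \<bar>h (gv r) - u (gv r)\<bar> \<partial>\<mu>))"
        using s1 s2 by (simp add: PI.prob_space del: sum_of_bool_eq)
      also have "\<dots> / n = \<epsilon> / 4 + N / n + measure \<mu> {r \<in> space \<mu>. R < norm (gv r)}
          + (1 + C) * (\<integral>r. \<bar>h (gv r) - u (gv r)\<bar> \<partial>\<mu>)"
        using n by (simp add: add_divide_distrib)
      finally have "(\<integral>x. osc n x \<partial>?P n) / n \<le> \<epsilon> / 4 + N / n + measure \<mu> {r \<in> space \<mu>. R < norm (gv r)}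
          + (1 + C) * (\<integral>r. \<bar>h (gv r) - u (gv r)\<bar> \<partial>\<mu>)"
        using n by (simp add: divide_right_mono)
      moreover have "(1 + C) * (\<integral>r. \<bar>h (gv r) - u (gv r)\<bar> \<partial>\<mu>) < \<epsilon> / 4"
        using u C0 by (simp add: field_simps)
      ultimately show ?thesis using R by linarith
    qed
    have "eventually (\<lambda>n. N / real n < \<epsilon> / 4) sequentially"
      using lim_const_over_n[of "real N"] \<epsilon> by (intro order_tendstoD) auto
    then show ?thesis using eventually_gt_at_top[of 0]
    proof eventually_elim
      case (elim n)
      then show ?case using E[of n] by linarith
    qed
  qed
  have osc_lim: "(\<lambda>n. (\<integral>x. osc n x \<partial>?P n) / n) \<longlonglongrightarrow> 0"
  proof (rule tendstoI)
    fix \<epsilon> :: real assume "0 < \<epsilon>"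
    from osc_small[OF this] show "eventually (\<lambda>n. dist ((\<integral>x. osc n x \<partial>?P n) / n) 0 < \<epsilon>) sequentially"
      by eventually_elim (simp add: abs_of_nonneg integral_nonneg osc_nonneg)
  qed
  let ?E = "\<lambda>n. \<integral>x. nn_form {..<n} (\<lambda>i. gv (x i)) (\<lambda>i. f (x i)) \<partial>?P n"
  have close: "\<bar>?E n / n - (\<integral>r. (h (gv r))\<^sup>2 \<partial>\<mu>)\<bar> \<le> (\<integral>x. osc n x \<partial>?P n) / n" if n: "2 \<le> n" for n
  proof -
    interpret PI: prob_space "?P n" by (rule P)
    let ?w = "\<lambda>x. nn_weight {..<n} (\<lambda>i. gv (x i))" and ?h = "\<lambda>x i. h (gv (x i))"
    let ?H = "\<lambda>x. nn_form {..<n} (\<lambda>i. gv (x i)) (?h x)"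
    have h2: "\<bar>(h b)\<^sup>2\<bar> \<le> 1" for b using h01[of b] by (simp add: power_le_one)
    have sq: "integrable (?P n) (\<lambda>x. \<Sum>i<n. (?h x i)\<^sup>2)"
      "(\<integral>x. (\<Sum>i<n. (?h x i)\<^sup>2) \<partial>?P n) = n * (\<integral>r. (h (gv r))\<^sup>2 \<partial>\<mu>)"
      using expectation_PiM_sum[OF \<mu>, of "{..<n}" "\<lambda>r. (h (gv r))\<^sup>2" 1] h2 by auto
    have "?H \<in> borel_measurable (?P n)" by (intro borel_measurable_nn_form) auto
    moreover have "norm (?H x) \<le> n" for x
      using nn_form_le_card[of "{..<n}" "?h x"] nn_form_nonneg[of "?h x" "{..<n}"] h01
      unfolding real_norm_def by (subst abs_of_nonneg) auto
    ultimately have Hint: "integrable (?P n) ?H"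
      by (intro PI.integrable_const_bound[of _ "real n"]) auto
    have pt: "\<bar>?H x - (\<Sum>i<n. (?h x i)\<^sup>2)\<bar> \<le> osc n x" for x
    proof -
      have "(\<Sum>i<n. (?h x i)\<^sup>2) = (\<Sum>i<n. \<Sum>j<n. ?w x i j * ?h x i * ?h x i)"
      proof (rule sum.cong[OF refl])
        fix i
        have "(\<Sum>j<n. ?w x i j * ?h x i * ?h x i) = (\<Sum>j<n. ?w x i j) * (?h x i * ?h x i)"
          by (simp add: sum_distrib_right mult.assoc)
        also have "(\<Sum>j<n. ?w x i j) = 1" using n by (intro sum_nn_weight) auto
        finally show "(?h x i)\<^sup>2 = (\<Sum>j<n. ?w x i j * ?h x i * ?h x i)" by (simp add: power2_eq_square)
      qed
      then have "?H x - (\<Sum>i<n. (?h x i)\<^sup>2) = (\<Sum>i<n. \<Sum>j<n. ?w x i j * ?h x i * (?h x j - ?h x i))"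
        by (simp add: nn_form_def sum_subtractf right_diff_distrib)
      also have "\<bar>\<dots>\<bar> \<le> (\<Sum>i<n. \<Sum>j<n. \<bar>?w x i j * ?h x i * (?h x j - ?h x i)\<bar>)"
        by (rule order_trans[OF sum_abs]) (intro sum_mono sum_abs)
      also have "\<dots> \<le> (\<Sum>i<n. \<Sum>j<n. ?w x i j * \<bar>?h x i - ?h x j\<bar>)"
      proof (intro sum_mono)
        fix i j
        have "\<bar>?w x i j * ?h x i * (?h x j - ?h x i)\<bar> = ?w x i j * (?h x i * \<bar>?h x i - ?h x j\<bar>)"
          using h01 by (simp add: abs_mult abs_of_nonneg nn_weight_nonneg abs_minus_commute)
        also have "\<dots> \<le> ?w x i j * (1 * \<bar>?h x i - ?h x j\<bar>)"
          using h01 by (intro mult_left_mono mult_right_mono nn_weight_nonneg) auto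
        finally show "\<bar>?w x i j * ?h x i * (?h x j - ?h x i)\<bar> \<le> ?w x i j * \<bar>?h x i - ?h x j\<bar>" by simp
      qed
      finally show ?thesis by (simp add: osc_def)
    qed
    have "?E n = (\<integral>x. ?H x \<partial>?P n)"
      using \<mu> f gv h f01 h01 cond by (intro expectation_nn_form_conditional) auto
    then have "\<bar>?E n - n * (\<integral>r. (h (gv r))\<^sup>2 \<partial>\<mu>)\<bar> = \<bar>\<integral>x. ?H x - (\<Sum>i<n. (?h x i)\<^sup>2) \<partial>?P n\<bar>"
      using Hint sq by simp
    also have "\<dots> \<le> (\<integral>x. \<bar>?H x - (\<Sum>i<n. (?h x i)\<^sup>2)\<bar> \<partial>?P n)" by (rule integral_abs_bound)
    also have "\<dots> \<le> (\<integral>x. osc n x \<partial>?P n)"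
      using Hint sq(1) pt by (intro integral_mono osc_int integrable_abs Bochner_Integration.integrable_diff) auto
    finally have "\<bar>?E n - n * (\<integral>r. (h (gv r))\<^sup>2 \<partial>\<mu>)\<bar> / n \<le> (\<integral>x. osc n x \<partial>?P n) / n"
      by (rule divide_right_mono) simp
    moreover have "?E n / n - (\<integral>r. (h (gv r))\<^sup>2 \<partial>\<mu>) = (?E n - n * (\<integral>r. (h (gv r))\<^sup>2 \<partial>\<mu>)) / n"
      using n by (simp add: diff_divide_distrib)
    ultimately show ?thesis by (simp only: abs_divide abs_of_nat)
  qed
  have "(\<lambda>n. ?E n / n - (\<integral>r. (h (gv r))\<^sup>2 \<partial>\<mu>)) \<longlonglongrightarrow> 0"
  proof (rule Lim_null_comparison[OF _ osc_lim])
    show "\<forall>\<^sub>F n in sequentially. norm (?E n / n - (\<integral>r. (h (gv r))\<^sup>2 \<partial>\<mu>)) \<le> (\<integral>x. osc n x \<partial>?P n) / n"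
      using eventually_ge_at_top[of 2] by eventually_elim (use close in simp)
  qed
  then show ?thesis by (simp add: LIM_zero_iff)
qed

section \<open>Conditioning on a random variable\<close>

lemma (in prob_space) sigma_gen_subalgebra:
  assumes "V \<in> M \<rightarrow>\<^sub>M N"
  shows "finite_measure_subalgebra M (sigma_gen M V N)"
proof
  show "subalgebra M (sigma_gen M V N)"
    using assms by (auto simp: subalgebra_def sigma_gen_def sets_vimage_algebra2 measurable_space Pi_iff)
qed

lemma (in prob_space) cond_exp_unit_interval:
  fixes u :: "'a \<Rightarrow> real"
  assumes V: "V \<in> M \<rightarrow>\<^sub>M N" and [measurable]: "u \<in> borel_measurable M"
    and u: "AE \<omega> in M. 0 \<le> u \<omega> \<and> u \<omega> \<le> 1"
  shows "integrable M u"
    and "AE \<omega> in M. 0 \<le> real_cond_exp M (sigma_gen M V N) u \<omega> \<and> real_cond_exp M (sigma_gen M V N) u \<omega> \<le> 1"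
proof -
  define F where "F = sigma_gen M V N"
  interpret F: finite_measure_subalgebra M F unfolding F_def by (rule sigma_gen_subalgebra[OF V])
  show int: "integrable M u" using u by (intro integrable_const_bound[of _ 1]) auto
  have "AE \<omega> in M. real_cond_exp M F u \<omega> \<ge> 0" using u by (intro F.real_cond_exp_pos) auto
  moreover have "AE \<omega> in M. real_cond_exp M F u \<omega> \<le> real_cond_exp M F (\<lambda>_. 1) \<omega>"
    using u int by (intro F.real_cond_exp_mono) auto
  moreover have "AE \<omega> in M. real_cond_exp M F (\<lambda>_. 1) \<omega> = 1" by (intro F.real_cond_exp_F_meas) auto
  ultimately show "AE \<omega> in M. 0 \<le> real_cond_exp M (sigma_gen M V N) u \<omega> \<and> real_cond_exp M (sigma_gen M V N) u \<omega> \<le> 1"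
    unfolding F_def by eventually_elim simp
qed

lemma measurable_sigma_gen: "V \<in> M \<rightarrow>\<^sub>M N \<Longrightarrow> V \<in> sigma_gen M V N \<rightarrow>\<^sub>M N"
  unfolding sigma_gen_def by (intro measurable_vimage_algebra1 Pi_I) (rule measurable_space)

text \<open>
  The factorisation of Doob and Dynkin, by the usual induction from indicators of preimages.
\<close>

lemma borel_measurable_sigma_gen_factor:
  fixes u :: "'a \<Rightarrow> real"
  assumes V: "V \<in> M \<rightarrow>\<^sub>M N" and u: "u \<in> borel_measurable (sigma_gen M V N)"
  shows "\<exists>h \<in> borel_measurable N. \<forall>\<omega>\<in>space M. u \<omega> = h (V \<omega>)"
proof -
  let ?F = "sigma_gen M V N"
  have space: "space ?F = space M" by (simp add: sigma_gen_def)
  have nonneg: "\<exists>h \<in> borel_measurable N. \<forall>\<omega>\<in>space M. v \<omega> = h (V \<omega>)"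
    if "v \<in> borel_measurable ?F" "\<And>\<omega>. 0 \<le> v \<omega>" for v :: "'a \<Rightarrow> real"
    using that
  proof (induction v rule: borel_measurable_induct_real)
    case (set A)
    then obtain B where "B \<in> sets N" "A = V -` B \<inter> space M"
      using V by (auto simp: sigma_gen_def sets_vimage_algebra2 measurable_space Pi_iff)
    then show ?case by (intro bexI[of _ "indicator B"]) (auto simp: indicator_def)
  next
    case (mult v c)
    then obtain h where "h \<in> borel_measurable N" "\<forall>\<omega>\<in>space M. v \<omega> = h (V \<omega>)" using mult.IH by blast
    then show ?case by (intro bexI[of _ "\<lambda>y. c * h y"]) auto
  next
    case (add v w)
    then obtain h k where "h \<in> borel_measurable N" "\<forall>\<omega>\<in>space M. v \<omega> = h (V \<omega>)"
      "k \<in> borel_measurable N" "\<forall>\<omega>\<in>space M. w \<omega> = k (V \<omega>)" using add.IH by blast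
    then show ?case by (intro bexI[of _ "\<lambda>y. k y + h y"]) auto
  next
    case (seq U)
    have "\<forall>i. \<exists>h. h \<in> borel_measurable N \<and> (\<forall>\<omega>\<in>space M. U i \<omega> = h (V \<omega>))" using seq.IH by blast
    from choice[OF this] obtain h
      where h: "\<And>i. h i \<in> borel_measurable N" "\<And>i \<omega>. \<omega> \<in> space M \<Longrightarrow> U i \<omega> = h i (V \<omega>)"
      by blast
    note [measurable] = h(1)
    show ?case
    proof (intro bexI ballI)
      fix \<omega> assume "\<omega> \<in> space M"
      then have "(\<lambda>i. h i (V \<omega>)) \<longlonglongrightarrow> v \<omega>" using seq.hyps(4) h(2) by (simp add: space)
      then show "v \<omega> = lim (\<lambda>i. h i (V \<omega>))" by (simp add: limI)
    qed measurable
  qed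
  have "\<exists>h \<in> borel_measurable N. \<forall>\<omega>\<in>space M. max 0 (u \<omega>) = h (V \<omega>)"
    using u by (intro nonneg) auto
  moreover have "\<exists>h \<in> borel_measurable N. \<forall>\<omega>\<in>space M. max 0 (- u \<omega>) = h (V \<omega>)"
    using u by (intro nonneg) auto
  ultimately obtain h k where hk: "h \<in> borel_measurable N" "\<And>\<omega>. \<omega> \<in> space M \<Longrightarrow> max 0 (u \<omega>) = h (V \<omega>)"
    "k \<in> borel_measurable N" "\<And>\<omega>. \<omega> \<in> space M \<Longrightarrow> max 0 (- u \<omega>) = k (V \<omega>)" by blast
  show ?thesis
  proof (intro bexI ballI)
    fix \<omega> assume "\<omega> \<in> space M"
    then show "u \<omega> = h (V \<omega>) - k (V \<omega>)" by (simp flip: hk(2,4))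
  qed (use hk in measurable)
qed

text \<open>
  Clipping the factor to the unit interval changes it on a null set only, and makes the bounds
  hold everywhere; this is convenient for integrals over product spaces.
\<close>

lemma (in prob_space) cond_exp_factor:
  fixes V :: "'a \<Rightarrow> 'b::topological_space" and u :: "'a \<Rightarrow> real"
  assumes V [measurable]: "V \<in> borel_measurable M" and u [measurable]: "u \<in> borel_measurable M"
    and u01: "\<And>\<omega>. 0 \<le> u \<omega>" "\<And>\<omega>. u \<omega> \<le> 1"
  shows "\<exists>h \<in> borel_measurable borel. (\<forall>b. 0 \<le> h b \<and> h b \<le> 1) \<and>
    (AE \<omega> in M. real_cond_exp M (sigma_gen M V borel) u \<omega> = h (V \<omega>)) \<and>
    (\<forall>\<phi> \<in> borel_measurable borel. \<forall>B. (\<forall>b. \<bar>\<phi> b\<bar> \<le> B) \<longrightarrow>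
      (\<integral>\<omega>. \<phi> (V \<omega>) * u \<omega> \<partial>M) = (\<integral>\<omega>. \<phi> (V \<omega>) * h (V \<omega>) \<partial>M))"
proof -
  define F where "F = sigma_gen M V borel"
  interpret F: finite_measure_subalgebra M F unfolding F_def by (rule sigma_gen_subalgebra[OF V])
  have VF: "V \<in> F \<rightarrow>\<^sub>M borel" unfolding F_def by (rule measurable_sigma_gen[OF V])
  have "real_cond_exp M F u \<in> borel_measurable (sigma_gen M V borel)" unfolding F_def[symmetric] by measurable
  from borel_measurable_sigma_gen_factor[OF V this] obtain k
    where k [measurable]: "k \<in> borel_measurable borel" and keq: "\<And>\<omega>. \<omega> \<in> space M \<Longrightarrow> real_cond_exp M F u \<omega> = k (V \<omega>)"
    by blast
  define h where "h b = max 0 (min 1 (k b))" for b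
  have h [measurable]: "h \<in> borel_measurable borel" unfolding h_def by measurable
  have h01: "0 \<le> h b" "h b \<le> 1" for b by (auto simp: h_def)
  have "AE \<omega> in M. 0 \<le> real_cond_exp M F u \<omega> \<and> real_cond_exp M F u \<omega> \<le> 1"
    unfolding F_def using u01 by (intro cond_exp_unit_interval V u AE_I2) auto
  then have eq: "AE \<omega> in M. real_cond_exp M F u \<omega> = h (V \<omega>)"
    using AE_space by eventually_elim (auto simp: h_def keq)
  have "(\<integral>\<omega>. \<phi> (V \<omega>) * u \<omega> \<partial>M) = (\<integral>\<omega>. \<phi> (V \<omega>) * h (V \<omega>) \<partial>M)"
    if \<phi> [measurable]: "\<phi> \<in> borel_measurable borel" and B: "\<And>b. \<bar>\<phi> b\<bar> \<le> B" for \<phi> B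
  proof -
    have "(\<integral>\<omega>. \<phi> (V \<omega>) * u \<omega> \<partial>M) = (\<integral>\<omega>. \<phi> (V \<omega>) * real_cond_exp M F u \<omega> \<partial>M)"
    proof (rule F.real_cond_exp_intg(2)[symmetric])
      have "\<bar>\<phi> (V \<omega>) * u \<omega>\<bar> \<le> B * 1" for \<omega>
        unfolding abs_mult using u01 B order_trans[OF abs_ge_zero B] by (intro mult_mono) auto
      then show "integrable M (\<lambda>\<omega>. \<phi> (V \<omega>) * u \<omega>)" by (intro integrable_const_bound[of _ B]) auto
      show "(\<lambda>\<omega>. \<phi> (V \<omega>)) \<in> borel_measurable F" using VF by measurable
    qed measurable
    also have "\<dots> = (\<integral>\<omega>. \<phi> (V \<omega>) * h (V \<omega>) \<partial>M)"
    proof (rule integral_cong_AE)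
      show "(\<lambda>\<omega>. \<phi> (V \<omega>) * real_cond_exp M F u \<omega>) \<in> borel_measurable M"
        by (intro borel_measurable_times measurable_compose[OF V \<phi>] borel_measurable_cond_exp2)
      show "AE \<omega> in M. \<phi> (V \<omega>) * real_cond_exp M F u \<omega> = \<phi> (V \<omega>) * h (V \<omega>)"
        using eq by eventually_elim simp
    qed measurable
    finally show ?thesis .
  qed
  then show ?thesis using h h01 eq unfolding F_def by blast
qed

text \<open>
  Pythagoras: the residual \<open>u - E(u | V)\<close> is orthogonal to \<open>E(u | V)\<close>.
\<close>

lemma (in prob_space) expectation_cond_var:
  fixes V :: "'a \<Rightarrow> 'b::topological_space" and u :: "'a \<Rightarrow> real"
  assumes V [measurable]: "V \<in> borel_measurable M" and u [measurable]: "u \<in> borel_measurable M"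
    and u01: "AE \<omega> in M. 0 \<le> u \<omega> \<and> u \<omega> \<le> 1"
  shows "expectation (cond_var_on M (sigma_gen M V borel) u)
    = expectation (\<lambda>\<omega>. (u \<omega>)\<^sup>2) - expectation (\<lambda>\<omega>. (real_cond_exp M (sigma_gen M V borel) u \<omega>)\<^sup>2)"
proof -
  define F where "F = sigma_gen M V borel"
  interpret F: finite_measure_subalgebra M F unfolding F_def by (rule sigma_gen_subalgebra[OF V])
  let ?c = "real_cond_exp M F u"
  have [measurable]: "?c \<in> borel_measurable M" by (rule borel_measurable_cond_exp2)
  have c01: "AE \<omega> in M. 0 \<le> ?c \<omega> \<and> ?c \<omega> \<le> 1"
    unfolding F_def by (rule cond_exp_unit_interval(2)[OF V u u01])
  have prods: "integrable M (\<lambda>\<omega>. a \<omega> * b \<omega>)"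
    if "AE \<omega> in M. 0 \<le> a \<omega> \<and> a \<omega> \<le> 1" "AE \<omega> in M. 0 \<le> b \<omega> \<and> b \<omega> \<le> 1"
      "a \<in> borel_measurable M" "b \<in> borel_measurable M" for a b :: "'a \<Rightarrow> real"
  proof (rule integrable_const_bound[of _ 1])
    show "AE \<omega> in M. norm (a \<omega> * b \<omega>) \<le> 1"
      using that(1,2) by eventually_elim (simp add: abs_mult mult_le_one)
  qed (use that in measurable)
  have i: "integrable M (\<lambda>\<omega>. u \<omega> * u \<omega>)" "integrable M (\<lambda>\<omega>. ?c \<omega> * u \<omega>)" "integrable M (\<lambda>\<omega>. ?c \<omega> * ?c \<omega>)"
    using u01 c01 by (auto intro!: prods)
  have cc: "expectation (\<lambda>\<omega>. ?c \<omega> * ?c \<omega>) = expectation (\<lambda>\<omega>. ?c \<omega> * u \<omega>)"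
    using i(2) by (intro F.real_cond_exp_intg(2)) auto
  have sq: "(u \<omega> - ?c \<omega>)\<^sup>2 = u \<omega> * u \<omega> - 2 * (?c \<omega> * u \<omega>) + ?c \<omega> * ?c \<omega>" for \<omega>
    by (simp add: power2_eq_square algebra_simps)
  have "expectation (cond_var_on M F u) = expectation (\<lambda>\<omega>. (u \<omega> - ?c \<omega>)\<^sup>2)"
    unfolding cond_var_on_def by (intro F.real_cond_exp_int) (use i in \<open>simp add: sq\<close>)
  also have "\<dots> = expectation (\<lambda>\<omega>. u \<omega> * u \<omega>) - expectation (\<lambda>\<omega>. ?c \<omega> * ?c \<omega>)"
    using i cc by (simp add: sq)
  finally show ?thesis by (simp add: F_def power2_eq_square)
qed

lemma (in prob_space) cond_prob_unit_interval:
  assumes V: "V \<in> M \<rightarrow>\<^sub>M N" and A: "A \<in> sets M"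
  shows "AE \<omega> in M. 0 \<le> cond_prob_on M (sigma_gen M V N) A \<omega> \<and> cond_prob_on M (sigma_gen M V N) A \<omega> \<le> 1"
    and "expectation (cond_prob_on M (sigma_gen M V N) A) = prob A"
    and "cond_prob_on M (sigma_gen M V N) A \<in> borel_measurable M"
proof -
  have u: "AE \<omega> in M. 0 \<le> (indicator A \<omega> :: real) \<and> indicator A \<omega> \<le> (1 :: real)"
    by (intro AE_I2) (simp add: indicator_def)
  have m: "(indicator A :: 'a \<Rightarrow> real) \<in> borel_measurable M" using A by simp
  note int = cond_exp_unit_interval(1)[OF V m u]
  show "AE \<omega> in M. 0 \<le> cond_prob_on M (sigma_gen M V N) A \<omega> \<and> cond_prob_on M (sigma_gen M V N) A \<omega> \<le> 1"
    unfolding cond_prob_on_def by (rule cond_exp_unit_interval(2)[OF V m u])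
  interpret F: finite_measure_subalgebra M "sigma_gen M V N" by (rule sigma_gen_subalgebra[OF V])
  show "expectation (cond_prob_on M (sigma_gen M V N) A) = prob A"
    using F.real_cond_exp_int(2)[OF int] A sets.sets_into_space[OF A]
    by (simp add: cond_prob_on_def Int_absorb2)
  show "cond_prob_on M (sigma_gen M V N) A \<in> borel_measurable M"
    unfolding cond_prob_on_def by (rule borel_measurable_cond_exp2)
qed

text \<open>
  Swapping the components is a homeomorphism, so it only relabels the generating preimages.
\<close>

lemma sigma_gen_swap:
  fixes V :: "'a \<Rightarrow> 'b::second_countable_topology" and W :: "'a \<Rightarrow> 'c::second_countable_topology"
  shows "sigma_gen M (\<lambda>\<omega>. (V \<omega>, W \<omega>)) borel = sigma_gen M (\<lambda>\<omega>. (W \<omega>, V \<omega>)) borel"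
proof -
  have sub: "{(\<lambda>\<omega>. (V \<omega>, W \<omega>)) -` A \<inter> X |A. A \<in> sets borel} \<subseteq> {(\<lambda>\<omega>. (W \<omega>, V \<omega>)) -` A \<inter> X |A. A \<in> sets borel}"
    for V :: "'a \<Rightarrow> 'u::second_countable_topology" and W :: "'a \<Rightarrow> 'v::second_countable_topology" and X
  proof
    fix S assume "S \<in> {(\<lambda>\<omega>. (V \<omega>, W \<omega>)) -` A \<inter> X |A. A \<in> sets borel}"
    then obtain A where A: "A \<in> sets borel" "S = (\<lambda>\<omega>. (V \<omega>, W \<omega>)) -` A \<inter> X" by blast
    have "(prod.swap :: 'v \<times> 'u \<Rightarrow> 'u \<times> 'v) \<in> borel_measurable borel"
      by (intro borel_measurable_continuous_onI continuous_on_swap)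
    from measurable_sets[OF this A(1)] have "prod.swap -` A \<in> sets borel" by simp
    moreover have "S = (\<lambda>\<omega>. (W \<omega>, V \<omega>)) -` (prod.swap -` A) \<inter> X" using A(2) by auto
    ultimately show "S \<in> {(\<lambda>\<omega>. (W \<omega>, V \<omega>)) -` A \<inter> X |A. A \<in> sets borel}" by blast
  qed
  have "{(\<lambda>\<omega>. (V \<omega>, W \<omega>)) -` A \<inter> X |A. A \<in> sets borel} = {(\<lambda>\<omega>. (W \<omega>, V \<omega>)) -` A \<inter> X |A. A \<in> sets borel}" for X
    using sub[of V W X] sub[of W V X] by (rule subset_antisym)
  then show ?thesis unfolding sigma_gen_def vimage_algebra_def by simp
qed

lemma (in prob_space) cond_prob_tower:
  fixes V :: "'a \<Rightarrow> 'b::second_countable_topology" and W :: "'a \<Rightarrow> 'c::second_countable_topology"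
  assumes V [measurable]: "V \<in> borel_measurable M" and W [measurable]: "W \<in> borel_measurable M" and A: "A \<in> sets M"
  shows "AE \<omega> in M. real_cond_exp M (sigma_gen M V borel)
      (cond_prob_on M (sigma_gen M (\<lambda>\<omega>. (W \<omega>, V \<omega>)) borel) A) \<omega> = cond_prob_on M (sigma_gen M V borel) A \<omega>"
proof -
  define F where "F = sigma_gen M V borel"
  define G where "G = sigma_gen M (\<lambda>\<omega>. (W \<omega>, V \<omega>)) borel"
  interpret F: finite_measure_subalgebra M F unfolding F_def by (rule sigma_gen_subalgebra[OF V])
  have VW: "(\<lambda>\<omega>. (W \<omega>, V \<omega>)) \<in> borel_measurable M" by measurable
  interpret G: finite_measure_subalgebra M G unfolding G_def by (rule sigma_gen_subalgebra[OF VW])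
  have "(\<lambda>\<omega>. snd (W \<omega>, V \<omega>)) \<in> borel_measurable G"
    unfolding G_def
    by (intro measurable_compose[OF measurable_sigma_gen[OF VW]] borel_measurable_continuous_onI continuous_intros)
  then have "V \<in> borel_measurable G" by simp
  then have "subalgebra G F"
    by (auto simp: subalgebra_def F_def G_def sigma_gen_def sets_vimage_algebra2 measurable_def)
  moreover have "integrable M (indicator A :: 'a \<Rightarrow> real)"
    using A by (intro integrable_real_indicator) (auto simp: less_top[symmetric])
  ultimately have "AE \<omega> in M. real_cond_exp M F (real_cond_exp M G (indicator A)) \<omega> = real_cond_exp M F (indicator A) \<omega>"
    using G.subalg by (intro F.real_cond_exp_nested_subalg)
  then show ?thesis by (simp add: cond_prob_on_def F_def G_def)
qed

lemma (in prob_space) prob_upper_event: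
  assumes [measurable]: "Y \<in> borel_measurable M"
  shows "upper_event M Y y \<in> events"
    and "expectation (indicator (upper_event M Y y)) = prob (upper_event M Y y)"
    and "(\<integral>\<omega>. of_bool (y \<le> Y \<omega>) \<partial>M) = prob (upper_event M Y y)"
proof -
  show A: "upper_event M Y y \<in> events" unfolding upper_event_def by measurable
  show E: "expectation (indicator (upper_event M Y y)) = prob (upper_event M Y y)"
    using sets.sets_into_space[OF A] by (simp add: Int_absorb2)
  have "(\<integral>\<omega>. of_bool (y \<le> Y \<omega>) \<partial>M) = (expectation (indicator (upper_event M Y y)) :: real)"
    by (intro Bochner_Integration.integral_cong) (auto simp: upper_event_def)
  then show "(\<integral>\<omega>. of_bool (y \<le> Y \<omega>) \<partial>M) = prob (upper_event M Y y)" by (simp only: E)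
qed

lemma (in prob_space) upper_event_factor:
  fixes Y :: "'a \<Rightarrow> real ^ 'd" and V :: "'a \<Rightarrow> 'b::topological_space"
  assumes Y [measurable]: "Y \<in> borel_measurable M" and V [measurable]: "V \<in> borel_measurable M"
  shows "\<exists>h :: real ^ 'd \<Rightarrow> 'b \<Rightarrow> real. \<forall>y. h y \<in> borel_measurable borel \<and> (\<forall>b. 0 \<le> h y b \<and> h y b \<le> 1)
    \<and> (AE \<omega> in M. cond_prob_on M (sigma_gen M V borel) (upper_event M Y y) \<omega> = h y (V \<omega>))
    \<and> (\<forall>\<phi> \<in> borel_measurable borel. (\<forall>b. \<bar>\<phi> b\<bar> \<le> 1) \<longrightarrow>
      (\<integral>\<omega>. \<phi> (V \<omega>) * of_bool (y \<le> Y \<omega>) \<partial>M) = (\<integral>\<omega>. \<phi> (V \<omega>) * h y (V \<omega>) \<partial>M))"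
proof (rule choice, rule allI)
  fix y
  let ?u = "indicator (upper_event M Y y) :: 'a \<Rightarrow> real"
  have u: "?u \<in> borel_measurable M" unfolding upper_event_def by measurable
  have eq: "(\<integral>\<omega>. \<phi> (V \<omega>) * of_bool (y \<le> Y \<omega>) \<partial>M) = (\<integral>\<omega>. \<phi> (V \<omega>) * ?u \<omega> \<partial>M)" for \<phi> :: "'b \<Rightarrow> real"
    by (intro Bochner_Integration.integral_cong) (auto simp: upper_event_def)
  obtain h where "h \<in> borel_measurable borel" "\<forall>b. 0 \<le> h b \<and> h b \<le> 1"
    "AE \<omega> in M. real_cond_exp M (sigma_gen M V borel) ?u \<omega> = h (V \<omega>)"
    "\<forall>\<phi> \<in> borel_measurable borel. \<forall>B. (\<forall>b. \<bar>\<phi> b\<bar> \<le> B) \<longrightarrow>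
      (\<integral>\<omega>. \<phi> (V \<omega>) * ?u \<omega> \<partial>M) = (\<integral>\<omega>. \<phi> (V \<omega>) * h (V \<omega>) \<partial>M)"
    using cond_exp_factor[OF V u] by auto
  then show "\<exists>h. h \<in> borel_measurable borel \<and> (\<forall>b. 0 \<le> h b \<and> h b \<le> 1)
    \<and> (AE \<omega> in M. cond_prob_on M (sigma_gen M V borel) (upper_event M Y y) \<omega> = h (V \<omega>))
    \<and> (\<forall>\<phi> \<in> borel_measurable borel. (\<forall>b. \<bar>\<phi> b\<bar> \<le> 1) \<longrightarrow>
      (\<integral>\<omega>. \<phi> (V \<omega>) * of_bool (y \<le> Y \<omega>) \<partial>M) = (\<integral>\<omega>. \<phi> (V \<omega>) * h (V \<omega>) \<partial>M))"
    unfolding eq cond_prob_on_def by blast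
qed

section \<open>Random tie-breaking\<close>

lemma nn_weight_eq_pmf:
  assumes "nn_set I z i \<noteq> {}" "finite I"
  shows "pmf (pmf_of_set (nn_set I z i)) j = nn_weight I z i j"
  using assms finite_nn_set[OF assms(2), of z i] by (simp add: nn_weight_def indicator_def)

text \<open>
  Hoeffding's lemma for one uniform choice among the nearest neighbours.
\<close>

lemma nn_weight_mgf:
  fixes z :: "nat \<Rightarrow> 'b::metric_space" and c :: "nat \<Rightarrow> real"
  assumes I: "finite I" "2 \<le> card I" and c: "\<And>j. \<bar>c j\<bar> \<le> B"
  shows "(\<Sum>j\<in>I. nn_weight I z i j * exp (l * (c j - (\<Sum>j\<in>I. nn_weight I z i j * c j)))) \<le> exp (l\<^sup>2 * B\<^sup>2 / 2)"
proof -
  let ?S = "nn_set I z i"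
  have "(\<Sum>j\<in>I. nn_weight I z i j) = 1" using I by (rule sum_nn_weight)
  then have S: "?S \<noteq> {}" using I by (auto simp: sum_nn_weight_eq)
  have fin: "finite ?S" using I by (intro finite_nn_set)
  let ?p = "measure_pmf (pmf_of_set ?S)"
  have E: "(\<Sum>j\<in>I. nn_weight I z i j * f j) = (\<integral>j. f j \<partial>?p)" for f :: "nat \<Rightarrow> real"
  proof -
    have "(\<Sum>j\<in>I. nn_weight I z i j * f j) = (\<Sum>j\<in>?S. nn_weight I z i j * f j)"
      using I nn_set_subset[of I z i] by (intro sum.mono_neutral_right) (auto simp: nn_weight_def)
    also have "\<dots> = (\<Sum>j\<in>?S. f j) / card ?S"
      unfolding sum_divide_distrib by (intro sum.cong refl) (simp add: nn_weight_def)
    also have "\<dots> = (\<integral>j. f j \<partial>?p)" using S fin by (simp add: integral_pmf_of_set)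
    finally show ?thesis .
  qed
  show ?thesis unfolding E
    by (rule prob_space.hoeffding_mgf[OF prob_space_measure_pmf, where a = 0]) (use c in auto)
qed

text \<open>
  Given the data, the indices are independent and uniform on the neighbour sets, so the moment generating
  function of the centred sum is a product over \<open>i\<close>. On a null set the indices may leave
  \<open>{..<n}\<close>, where \<open>c0\<close> is arbitrary, so the bounds are stated for a measurable modification \<open>A'\<close>
  of the centred sum \<open>A\<close>.
\<close>

lemma tie_breaking_mgf:
  fixes M :: "'a measure" and D :: "nat \<Rightarrow> 'a \<Rightarrow> 'r::topological_space" and g :: "'r \<Rightarrow> 'b::euclidean_space"
    and c0 :: "nat \<Rightarrow> nat \<Rightarrow> (nat \<Rightarrow> 'r) \<Rightarrow> real"
  assumes M: "prob_space M" and D: "\<And>j. D j \<in> borel_measurable M" and g [measurable]: "g \<in> borel_measurable borel"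
    and n: "2 \<le> n" and N: "nearest_neighbours M D g n N"
    and c0: "\<And>i j. i < n \<Longrightarrow> j < n \<Longrightarrow> c0 i j \<in> borel_measurable (\<Pi>\<^sub>M j\<in>{..<n}. borel)"
    and c0B: "\<And>i j x. i < n \<Longrightarrow> j < n \<Longrightarrow> \<bar>c0 i j x\<bar> \<le> B" and B0: "0 \<le> B"
    and c0ext: "\<And>i j \<omega>. i < n \<Longrightarrow> j < n \<Longrightarrow> c0 i j (\<lambda>j\<in>{..<n}. D j \<omega>) = c0 i j (\<lambda>j. D j \<omega>)"
  defines "A \<equiv> \<lambda>\<omega>. (\<Sum>i<n. c0 i (N i \<omega>) (\<lambda>j. D j \<omega>))
      - (\<Sum>i<n. \<Sum>j<n. nn_weight {..<n} (\<lambda>j. g (D j \<omega>)) i j * c0 i j (\<lambda>j. D j \<omega>))"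
  shows "\<exists>A'. A' \<in> borel_measurable M \<and> (AE \<omega> in M. A' \<omega> = A \<omega>) \<and> (\<forall>l. integrable M (\<lambda>\<omega>. exp (l * A' \<omega>)))
    \<and> (\<forall>l. (\<integral>\<omega>. exp (l * A' \<omega>) \<partial>M) \<le> exp (n * (l\<^sup>2 * B\<^sup>2 / 2)))"
proof -
  interpret prob_space M by fact
  let ?Px = "\<Pi>\<^sub>M j\<in>{..<n}. (borel :: 'r measure)"
  \<comment> \<open>Outside \<open>{..<n}\<close> nothing is known about \<open>c0\<close>.\<close>
  define c where "c i j x = (if i < n \<and> j < n then c0 i j x else 0)" for i j x
  have c [measurable]: "c i j \<in> borel_measurable ?Px" for i j
    unfolding c_def using c0[of i j] by (cases "i < n \<and> j < n") auto
  have cB: "\<bar>c i j x\<bar> \<le> B" for i j x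
    unfolding c_def using c0B B0 by auto
  have cext: "c i j (\<lambda>j\<in>{..<n}. D j \<omega>) = c0 i j (\<lambda>j. D j \<omega>)" if "i < n" "j < n" for i j \<omega>
    using c0ext[OF that] that by (simp add: c_def)
  define X where "X \<omega> = (\<lambda>j\<in>{..<n}. D j \<omega>)" for \<omega>
  have X [measurable]: "X \<in> M \<rightarrow>\<^sub>M ?Px" unfolding X_def using D by (intro measurable_restrict)
  define F where "F = sigma_gen M X ?Px"
  interpret F: finite_measure_subalgebra M F unfolding F_def by (rule sigma_gen_subalgebra[OF X])
  have XF: "X \<in> F \<rightarrow>\<^sub>M ?Px" unfolding F_def by (rule measurable_sigma_gen[OF X])
  have N_meas [measurable]: "N i \<in> M \<rightarrow>\<^sub>M count_space UNIV" if "i < n" for i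
    using N that by (simp add: nearest_neighbours_def)
  define w where "w i j x = nn_weight {..<n} (\<lambda>j. g (x j)) i j" for i j and x :: "nat \<Rightarrow> 'r"
  have w_meas [measurable]: "w i j \<in> borel_measurable ?Px" if "i < n" for i j
    unfolding w_def using that by (intro borel_measurable_nn_weight) auto
  have wX: "nn_weight {..<n} (\<lambda>j. g (D j \<omega>)) i j = w i j (X \<omega>)" if "i < n" for i j \<omega>
    unfolding w_def X_def using that by (intro nn_weight_cong) auto
  have w01: "0 \<le> w i j x" "w i j x \<le> 1" for i j x
    by (auto simp: w_def nn_weight_nonneg nn_weight_le_1)
  have wsum: "(\<Sum>j<n. w i j x) = 1" for i x
    unfolding w_def using n by (intro sum_nn_weight) auto
  \<comment> \<open>Up to a null set, the space is the disjoint union of the events \<open>E m\<close> for \<open>m \<in> Q\<close>.\<close>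
  define Q where "Q = PiE {..<n} (\<lambda>_. {..<n})"
  have finQ: "finite Q" unfolding Q_def by (intro finite_PiE) auto
  define E where "E m = {\<omega> \<in> space M. \<forall>i<n. N i \<omega> = m i}" for m
  have E_meas [measurable]: "E m \<in> sets M" for m
  proof -
    have "E m = (\<Inter>i\<in>{..<n}. {\<omega> \<in> space M. N i \<omega> = m i})"
    proof (intro set_eqI iffI)
      fix \<omega> assume \<omega>: "\<omega> \<in> (\<Inter>i\<in>{..<n}. {\<omega> \<in> space M. N i \<omega> = m i})"
      have "0 \<in> {..<n}" using n by simp
      then have "\<omega> \<in> space M" using \<omega> by blast
      then show "\<omega> \<in> E m" using \<omega> by (simp add: E_def)
    qed (simp add: E_def)
    moreover have "{\<omega> \<in> space M. N i \<omega> = m i} \<in> sets M" if "i < n" for i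
      using measurable_sets[OF N_meas[OF that], of "{m i}"] by (simp add: vimage_def Int_def conj_commute)
    moreover have "{..<n} \<noteq> {}" using n by (simp add: lessThan_empty_iff)
    ultimately show ?thesis by (auto intro!: sets.finite_INT)
  qed
  define p where "p m x = (\<Prod>i<n. w i (m i) x)" for m x
  have p_meas [measurable]: "p m \<in> borel_measurable ?Px" for m
    unfolding p_def by (intro borel_measurable_prod w_meas) auto
  have p01: "0 \<le> p m x" "p m x \<le> 1" for m x
    unfolding p_def using w01 by (auto intro!: prod_nonneg prod_le_1)
  have cond: "AE \<omega> in M. real_cond_exp M F (indicator (E m)) \<omega> = p m (X \<omega>)" for m
  proof -
    have "AE \<omega> in M. cond_prob_on M F (E m) \<omega> = (\<Prod>i<n. pmf (pmf_of_set (nearest_set n (\<lambda>j. g (D j \<omega>)) i)) (m i))"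
      using N unfolding nearest_neighbours_def F_def X_def E_def by blast
    moreover have "(\<Prod>i<n. pmf (pmf_of_set (nearest_set n (\<lambda>j. g (D j \<omega>)) i)) (m i)) = p m (X \<omega>)" for \<omega>
      unfolding p_def
    proof (rule prod.cong[OF refl])
      fix i assume i: "i \<in> {..<n}"
      have "nn_set {..<n} (\<lambda>j. g (D j \<omega>)) i \<noteq> {}"
      proof (rule nn_set_nonempty)
        have "(if i = 0 then 1 else 0) \<in> {..<n} - {i}" using n by auto
        then show "{..<n} - {i} \<noteq> {}" by blast
      qed simp
      then show "pmf (pmf_of_set (nearest_set n (\<lambda>j. g (D j \<omega>)) i)) (m i) = w i (m i) (X \<omega>)"
        using i wX by (simp add: nearest_set_eq nn_weight_eq_pmf)
    qed
    ultimately show ?thesis by (simp add: cond_prob_on_def)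
  qed
  have intg: "(\<integral>\<omega>. \<phi> (X \<omega>) * indicator (E m) \<omega> \<partial>M) = (\<integral>\<omega>. \<phi> (X \<omega>) * p m (X \<omega>) \<partial>M)"
    if [measurable]: "\<phi> \<in> borel_measurable ?Px" and b: "\<And>x. \<bar>\<phi> x\<bar> \<le> b" for \<phi> b m
  proof -
    have b0: "0 \<le> b" using b[of undefined] by linarith
    have "(\<integral>\<omega>. \<phi> (X \<omega>) * indicator (E m) \<omega> \<partial>M) = (\<integral>\<omega>. \<phi> (X \<omega>) * real_cond_exp M F (indicator (E m)) \<omega> \<partial>M)"
    proof (rule F.real_cond_exp_intg(2)[symmetric])
      show "integrable M (\<lambda>\<omega>. \<phi> (X \<omega>) * indicator (E m) \<omega>)"
        using b b0 by (intro integrable_const_bound[of _ b]) (auto simp: indicator_def)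
      show "(\<lambda>\<omega>. \<phi> (X \<omega>)) \<in> borel_measurable F" using XF by measurable
    qed measurable
    also have "\<dots> = (\<integral>\<omega>. \<phi> (X \<omega>) * p m (X \<omega>) \<partial>M)"
    proof (rule integral_cong_AE)
      show "(\<lambda>\<omega>. \<phi> (X \<omega>) * real_cond_exp M F (indicator (E m)) \<omega>) \<in> borel_measurable M"
        by (intro borel_measurable_times measurable_compose[OF X that(1)] borel_measurable_cond_exp2)
      show "AE \<omega> in M. \<phi> (X \<omega>) * real_cond_exp M F (indicator (E m)) \<omega> = \<phi> (X \<omega>) * p m (X \<omega>)"
        using cond[of m] by eventually_elim simp
    qed measurable
    finally show ?thesis .
  qed
  \<comment> \<open>The conditional mean of the \<open>i\<close>-th summand given the data.\<close>
  define s where "s i x = (\<Sum>j<n. w i j x * c i j x)" for i x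
  have s_meas [measurable]: "s i \<in> borel_measurable ?Px" if "i < n" for i
    unfolding s_def using that by (intro borel_measurable_sum borel_measurable_times w_meas c) auto
  have sB: "\<bar>s i x\<bar> \<le> B" for i x
  proof -
    have "\<bar>s i x\<bar> \<le> (\<Sum>j<n. w i j x * B)" unfolding s_def
      by (rule order_trans[OF sum_abs]) (intro sum_mono, simp add: abs_mult w01 cB mult_left_mono)
    also have "\<dots> = B" by (simp add: sum_distrib_right[symmetric] wsum)
    finally show ?thesis .
  qed
  \<comment> \<open>The deviation on the event \<open>E m\<close>.\<close>
  define d where "d m x = (\<Sum>i<n. c i (m i) x - s i x)" for m x
  have d_meas [measurable]: "d m \<in> borel_measurable ?Px" for m
    unfolding d_def by (intro borel_measurable_sum borel_measurable_diff s_meas c) auto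
  have dB: "\<bar>d m x\<bar> \<le> n * (2 * B)" for m x
  proof -
    have "\<bar>d m x\<bar> \<le> (\<Sum>i<n. 2 * B)" unfolding d_def
    proof (rule order_trans[OF sum_abs], rule sum_mono)
      fix i show "\<bar>c i (m i) x - s i x\<bar> \<le> 2 * B"
        using cB[of i "m i" x] sB[of i x] by linarith
    qed
    then show ?thesis by simp
  qed
  define A' where "A' \<omega> = (\<Sum>m\<in>Q. indicator (E m) \<omega> * d m (X \<omega>))" for \<omega>
  have A'_meas [measurable]: "A' \<in> borel_measurable M" unfolding A'_def by measurable
  have E_unique: "m = m'" if "\<omega> \<in> E m" "\<omega> \<in> E m'" "m \<in> Q" "m' \<in> Q" for m m' \<omega>
  proof (rule PiE_ext)
    show "m \<in> PiE {..<n} (\<lambda>_. {..<n})" "m' \<in> PiE {..<n} (\<lambda>_. {..<n})" using that by (auto simp: Q_def)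
    show "m i = m' i" if "i \<in> {..<n}" for i
      using \<open>\<omega> \<in> E m\<close> \<open>\<omega> \<in> E m'\<close> that by (auto simp: E_def)
  qed
  have single: "(\<Sum>m\<in>Q. indicator (E m) \<omega> * f m) = f m'" if "\<omega> \<in> E m'" "m' \<in> Q" for f :: "(nat \<Rightarrow> nat) \<Rightarrow> real" and \<omega> m'
  proof -
    have "(\<Sum>m\<in>Q. indicator (E m) \<omega> * f m) = (\<Sum>m\<in>{m'}. indicator (E m) \<omega> * f m)"
      using finQ that E_unique by (intro sum.mono_neutral_right) (auto simp: indicator_def)
    then show ?thesis using that by simp
  qed
  have total: "AE \<omega> in M. \<omega> \<in> (\<Union>m\<in>Q. E m)"
  proof -
    have "prob (\<Union>m\<in>Q. E m) = (\<Sum>m\<in>Q. prob (E m))"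
      using finQ E_unique by (intro finite_measure_finite_Union) (auto simp: disjoint_family_on_def)
    also have "\<dots> = (\<Sum>m\<in>Q. \<integral>\<omega>. p m (X \<omega>) \<partial>M)"
      using intg[of "\<lambda>_. 1" 1] by (intro sum.cong refl) simp
    also have "\<dots> = (\<integral>\<omega>. (\<Sum>m\<in>Q. p m (X \<omega>)) \<partial>M)"
      using p01 by (intro Bochner_Integration.integral_sum[symmetric] integrable_const_bound[of _ 1]) auto
    also have "(\<lambda>\<omega>. \<Sum>m\<in>Q. p m (X \<omega>)) = (\<lambda>_. 1)"
      unfolding p_def Q_def by (subst prod_sum_PiE[symmetric]) (auto simp: wsum)
    finally have "prob (\<Union>m\<in>Q. E m) = 1" by (simp add: prob_space)
    then show ?thesis using finQ by (subst (asm) prob_eq_1) auto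
  qed
  have AE_A: "AE \<omega> in M. A' \<omega> = A \<omega>"
    using total
  proof eventually_elim
    case (elim \<omega>)
    then obtain m where m: "m \<in> Q" "\<omega> \<in> E m" by blast
    have "A' \<omega> = d m (X \<omega>)" unfolding A'_def using m by (intro single) auto
    also have "\<dots> = A \<omega>"
    proof -
      have mi: "m i < n" if "i < n" for i using m that by (auto simp: Q_def)
      have c': "c i j (X \<omega>) = c0 i j (\<lambda>j. D j \<omega>)" if "i < n" "j < n" for i j
        using cext[OF that] by (simp add: X_def)
      have "c0 i (N i \<omega>) (\<lambda>j. D j \<omega>) = c i (m i) (X \<omega>)" if "i < n" for i
        using m that mi c' by (auto simp: E_def)
      then show ?thesis by (simp add: A_def d_def s_def sum_subtractf wX c')
    qed
    finally show ?case .
  qed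
  have A'B: "\<bar>A' \<omega>\<bar> \<le> n * (2 * B)" for \<omega>
  proof (cases "\<omega> \<in> (\<Union>m\<in>Q. E m)")
    case True
    then obtain m where m: "m \<in> Q" "\<omega> \<in> E m" by blast
    have "A' \<omega> = d m (X \<omega>)" unfolding A'_def using m by (intro single) auto
    then show ?thesis using dB by simp
  next
    case False
    then have "A' \<omega> = 0" by (auto simp: A'_def indicator_def)
    then show ?thesis using B0 by simp
  qed
  have expB: "\<bar>exp (l * u)\<bar> \<le> exp (\<bar>l\<bar> * (n * (2 * B)))" if "\<bar>u\<bar> \<le> n * (2 * B)" for l u :: real
  proof -
    have "l * u \<le> \<bar>l\<bar> * \<bar>u\<bar>" by (metis abs_ge_self abs_mult)
    also have "\<dots> \<le> \<bar>l\<bar> * (n * (2 * B))" using that by (intro mult_left_mono) auto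
    finally show ?thesis by simp
  qed
  have int: "integrable M (\<lambda>\<omega>. exp (l * A' \<omega>))" for l
    using expB A'B by (intro integrable_const_bound[of _ "exp (\<bar>l\<bar> * (n * (2 * B)))"] AE_I2) auto
  have mgf: "(\<integral>\<omega>. exp (l * A' \<omega>) \<partial>M) \<le> exp (n * (l\<^sup>2 * B\<^sup>2 / 2))" for l
  proof -
    have "(\<integral>\<omega>. exp (l * A' \<omega>) \<partial>M) = (\<integral>\<omega>. (\<Sum>m\<in>Q. exp (l * d m (X \<omega>)) * indicator (E m) \<omega>) \<partial>M)"
    proof (rule integral_cong_AE)
      show "AE \<omega> in M. exp (l * A' \<omega>) = (\<Sum>m\<in>Q. exp (l * d m (X \<omega>)) * indicator (E m) \<omega>)"
        using total
      proof eventually_elim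
        case (elim \<omega>)
        then obtain m where m: "m \<in> Q" "\<omega> \<in> E m" by blast
        have "A' \<omega> = d m (X \<omega>)" unfolding A'_def using m by (intro single) auto
        moreover have "(\<Sum>m\<in>Q. indicator (E m) \<omega> * exp (l * d m (X \<omega>))) = exp (l * d m (X \<omega>))"
          using m by (intro single) auto
        ultimately show ?case by (simp add: mult.commute)
      qed
    qed measurable
    also have "\<dots> = (\<Sum>m\<in>Q. \<integral>\<omega>. exp (l * d m (X \<omega>)) * indicator (E m) \<omega> \<partial>M)"
      using expB[OF dB]
      by (intro Bochner_Integration.integral_sum integrable_const_bound[of _ "exp (\<bar>l\<bar> * (n * (2 * B)))"] AE_I2)
        (auto simp: indicator_def)
    also have "\<dots> = (\<Sum>m\<in>Q. \<integral>\<omega>. exp (l * d m (X \<omega>)) * p m (X \<omega>) \<partial>M)"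
    proof (rule sum.cong[OF refl])
      fix m
      show "(\<integral>\<omega>. exp (l * d m (X \<omega>)) * indicator (E m) \<omega> \<partial>M) = (\<integral>\<omega>. exp (l * d m (X \<omega>)) * p m (X \<omega>) \<partial>M)"
        by (rule intg[of "\<lambda>x. exp (l * d m x)" "exp (\<bar>l\<bar> * (n * (2 * B)))" m]) (use expB[OF dB] in auto)
    qed
    also have "\<dots> = (\<integral>\<omega>. (\<Sum>m\<in>Q. exp (l * d m (X \<omega>)) * p m (X \<omega>)) \<partial>M)"
    proof (intro Bochner_Integration.integral_sum[symmetric] integrable_const_bound[of _ "exp (\<bar>l\<bar> * (n * (2 * B)))"] AE_I2)
      fix m \<omega>
      have "\<bar>exp (l * d m (X \<omega>)) * p m (X \<omega>)\<bar> \<le> exp (\<bar>l\<bar> * (n * (2 * B))) * 1"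
        unfolding abs_mult using p01 by (intro mult_mono expB[OF dB]) auto
      then show "norm (exp (l * d m (X \<omega>)) * p m (X \<omega>)) \<le> exp (\<bar>l\<bar> * (n * (2 * B)))" by simp
    qed measurable
    also have "\<dots> \<le> (\<integral>\<omega>. exp (n * (l\<^sup>2 * B\<^sup>2 / 2)) \<partial>M)"
    proof -
      have le: "(\<Sum>m\<in>Q. exp (l * d m x) * p m x) \<le> exp (n * (l\<^sup>2 * B\<^sup>2 / 2))" for x
      proof -
        have "(\<Sum>m\<in>Q. exp (l * d m x) * p m x) = (\<Sum>m\<in>Q. \<Prod>i<n. w i (m i) x * exp (l * (c i (m i) x - s i x)))"
          by (intro sum.cong refl) (simp add: d_def p_def sum_distrib_left exp_sum prod.distrib mult.commute)
        also have "\<dots> = (\<Prod>i<n. \<Sum>j<n. w i j x * exp (l * (c i j x - s i x)))"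
          unfolding Q_def by (rule prod_sum_PiE[symmetric]) auto
        also have "\<dots> \<le> (\<Prod>i<n. exp (l\<^sup>2 * B\<^sup>2 / 2))"
        proof (rule prod_mono)
          fix i
          have "(\<Sum>j<n. w i j x * exp (l * (c i j x - s i x))) \<le> exp (l\<^sup>2 * B\<^sup>2 / 2)"
            unfolding s_def w_def using n cB by (intro nn_weight_mgf) auto
          moreover have "0 \<le> (\<Sum>j<n. w i j x * exp (l * (c i j x - s i x)))"
            using w01 by (intro sum_nonneg) auto
          ultimately show "0 \<le> (\<Sum>j<n. w i j x * exp (l * (c i j x - s i x))) \<and>
              (\<Sum>j<n. w i j x * exp (l * (c i j x - s i x))) \<le> exp (l\<^sup>2 * B\<^sup>2 / 2)" by simp
        qed
        also have "\<dots> = exp (n * (l\<^sup>2 * B\<^sup>2 / 2))" by (simp only: exp_of_nat_mult prod_constant card_lessThan)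
        finally show ?thesis .
      qed
      have "integrable M (\<lambda>\<omega>. \<Sum>m\<in>Q. exp (l * d m (X \<omega>)) * p m (X \<omega>))"
      proof (intro integrable_const_bound[of _ "exp (n * (l\<^sup>2 * B\<^sup>2 / 2))"] AE_I2)
        fix \<omega>
        have "0 \<le> (\<Sum>m\<in>Q. exp (l * d m (X \<omega>)) * p m (X \<omega>))" using p01 by (intro sum_nonneg) auto
        then show "norm (\<Sum>m\<in>Q. exp (l * d m (X \<omega>)) * p m (X \<omega>)) \<le> exp (n * (l\<^sup>2 * B\<^sup>2 / 2))"
          using le[of "X \<omega>"] by simp
      qed measurable
      then show ?thesis using le by (intro integral_mono) auto
    qed
    finally show ?thesis by (simp add: prob_space)
  qed
  show ?thesis using A'_meas AE_A int mgf by blast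
qed

section \<open>Upper orthants determine the response\<close>

text \<open>
  The exceptional points \<open>v\<close> form an initial segment of \<open>A\<close>. It is covered by countably many of the null
  sets \<open>A \<inter> {..v}\<close>, taken below rationals, and one more if it has a largest element.
\<close>

lemma AE_lower_section_positive:
  fixes \<nu> :: "real measure"
  assumes "finite_measure \<nu>" and sets: "sets \<nu> = sets borel" and A: "A \<in> sets borel"
  shows "AE v in \<nu>. v \<in> A \<longrightarrow> 0 < emeasure \<nu> (A \<inter> {..v})"
proof -
  note [measurable_cong] = sets
  have [measurable]: "A \<in> sets \<nu>" using A sets by simp
  define B where "B = {v \<in> A. emeasure \<nu> (A \<inter> {..v}) = 0}"
  have null: "A \<inter> {..b} \<in> null_sets \<nu>" if "b \<in> B" for b
    using that by (auto simp: B_def null_sets_def)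
  define Q where "Q = {q \<in> \<rat>. \<exists>b\<in>B. q \<le> b}"
  have "countable Q" unfolding Q_def using countable_rat by (auto intro: countable_subset)
  moreover have "A \<inter> {..q} \<in> null_sets \<nu>" if q: "q \<in> Q" for q
  proof -
    obtain b where "b \<in> B" "q \<le> b" using q by (auto simp: Q_def)
    then show ?thesis by (intro null_sets_subset[OF null[of b]]) auto
  qed
  ultimately have N1: "(\<Union>q\<in>Q. A \<inter> {..q}) \<in> null_sets \<nu>" by (rule null_sets_UN')
  obtain m where N2: "m \<in> null_sets \<nu>" and m: "\<And>v. v \<in> B \<Longrightarrow> (\<And>b. b \<in> B \<Longrightarrow> b \<le> v) \<Longrightarrow> v \<in> m"
  proof (cases "\<exists>s\<in>B. \<forall>b\<in>B. b \<le> s")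
    case True
    then obtain s where s: "s \<in> B" "\<forall>b\<in>B. b \<le> s" by blast
    then show thesis by (intro that[of "A \<inter> {..s}"] null) (auto simp: B_def)
  next
    case False
    then show thesis by (intro that[of "{}"]) auto
  qed
  have cover: "B \<subseteq> (\<Union>q\<in>Q. A \<inter> {..q}) \<union> m"
  proof
    fix v assume v: "v \<in> B"
    show "v \<in> (\<Union>q\<in>Q. A \<inter> {..q}) \<union> m"
    proof (cases "\<exists>b\<in>B. v < b")
      case True
      then obtain b where b: "b \<in> B" "v < b" by blast
      obtain q where "q \<in> \<rat>" "v < q" "q < b" using Rats_dense_in_real[OF b(2)] by blast
      then have "q \<in> Q" "v \<in> A \<inter> {..q}" using v b by (auto simp: Q_def B_def intro: less_imp_le)
      then show ?thesis by blast
    next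
      case False
      then have "v \<in> m" using v by (intro m) (auto simp: not_less)
      then show ?thesis by blast
    qed
  qed
  have "(\<Union>q\<in>Q. A \<inter> {..q}) \<union> m \<in> null_sets \<nu>" using N1 N2 by (rule null_sets.Un)
  then have "AE v in \<nu>. v \<notin> (\<Union>q\<in>Q. A \<inter> {..q}) \<union> m" by (rule AE_not_in)
  then show ?thesis
  proof eventually_elim
    case (elim v)
    then have "v \<notin> B" using cover by blast
    then show ?case by (auto simp: B_def zero_less_iff_neq_zero)
  qed
qed


lemma emeasure_marginal_product_box:
  fixes Y :: "'a \<Rightarrow> real ^ 'd"
  assumes "prob_space M" and Y [measurable]: "Y \<in> borel_measurable M"
    and A: "\<And>j. A j \<in> sets borel"
  shows "emeasure (marginal_product M Y) {y. \<forall>j. y $ j \<in> A j}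
    = (\<Prod>j\<in>UNIV. emeasure (distr M borel (\<lambda>\<omega>. Y \<omega> $ j)) (A j))"
proof -
  interpret M: prob_space M by fact
  let ?N = "\<lambda>j. distr M borel (\<lambda>\<omega>. Y \<omega> $ j)"
  interpret N: product_prob_space ?N UNIV
    by (intro product_prob_spaceI M.prob_space_distr) measurable
  note [measurable] = A
  have m: "(\<lambda>f::'d \<Rightarrow> real. \<chi> j. f j) \<in> (\<Pi>\<^sub>M j\<in>UNIV. ?N j) \<rightarrow>\<^sub>M borel" by measurable
  have "Measurable.pred borel (\<lambda>y::real^'d. \<forall>j\<in>UNIV. y $ j \<in> A j)"
    by (intro pred_intros_finite) measurable
  then have S: "{y::real^'d. \<forall>j. y $ j \<in> A j} \<in> sets borel" by (simp add: pred_def)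
  have "(\<lambda>f. \<chi> j. f j) -` {y::real^'d. \<forall>j. y $ j \<in> A j} \<inter> space (\<Pi>\<^sub>M j\<in>UNIV. ?N j) = PiE UNIV A"
    by (auto simp: space_PiM PiE_def Pi_def extensional_def)
  then have "emeasure (marginal_product M Y) {y. \<forall>j. y $ j \<in> A j} = emeasure (\<Pi>\<^sub>M j\<in>UNIV. ?N j) (PiE UNIV A)"
    unfolding marginal_product_def using m S by (subst emeasure_distr) auto
  also have "\<dots> = (\<Prod>j\<in>UNIV. emeasure (?N j) (A j))"
    by (rule N.emeasure_PiM) auto
  finally show ?thesis .
qed

text \<open>
  The box is a product of half-lines and one interval, and each factor has positive mass almost
  surely.
\<close>

lemma AE_marginal_product_box_positive:
  fixes Y :: "'a \<Rightarrow> real ^ 'd"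
  assumes "prob_space M" and Y [measurable]: "Y \<in> borel_measurable M"
  shows "AE \<omega> in M. t < Y \<omega> $ j \<longrightarrow> 0 < emeasure (marginal_product M Y) {y. y \<le> Y \<omega> \<and> t < y $ j}"
proof -
  interpret M: prob_space M by fact
  let ?N = "\<lambda>j. distr M borel (\<lambda>\<omega>. Y \<omega> $ j)"
  have fin: "finite_measure (?N l)" for l by (intro M.finite_measure_distr) measurable
  have AE1: "AE \<omega> in M. Y \<omega> $ l \<in> A \<longrightarrow> 0 < emeasure (?N l) (A \<inter> {..Y \<omega> $ l})"
    if "A \<in> sets borel" for l A
  proof -
    have "AE v in ?N l. v \<in> A \<longrightarrow> 0 < emeasure (?N l) (A \<inter> {..v})"
      using fin that by (intro AE_lower_section_positive) auto
    then show ?thesis by (intro AE_distrD[where M = M and f = "\<lambda>\<omega>. Y \<omega> $ l"]) auto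
  qed
  have "AE \<omega> in M. \<forall>l. 0 < emeasure (?N l) {..Y \<omega> $ l}"
    using AE1[of UNIV] by (subst AE_all_countable) auto
  moreover have "AE \<omega> in M. t < Y \<omega> $ j \<longrightarrow> 0 < emeasure (?N j) ({t<..} \<inter> {..Y \<omega> $ j})"
    using AE1[of "{t<..}" j] by simp
  ultimately show ?thesis
  proof eventually_elim
    case (elim \<omega>)
    show ?case
    proof
      assume t: "t < Y \<omega> $ j"
      define A where "A l = (if l = j then {t<..} \<inter> {..Y \<omega> $ l} else {..Y \<omega> $ l})" for l
      have "{y. y \<le> Y \<omega> \<and> t < y $ j} = {y. \<forall>l. y $ l \<in> A l}"
        by (auto simp: A_def less_eq_vec_def split: if_splits)
      moreover have "A l \<in> sets borel" for l by (simp add: A_def)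
      ultimately have "emeasure (marginal_product M Y) {y. y \<le> Y \<omega> \<and> t < y $ j}
          = (\<Prod>l\<in>UNIV. emeasure (?N l) (A l))"
        using assms by (simp add: emeasure_marginal_product_box)
      also have "0 < \<dots>"
        using elim t by (auto simp: A_def zero_less_iff_neq_zero)
      finally show "0 < emeasure (marginal_product M Y) {y. y \<le> Y \<omega> \<and> t < y $ j}" .
    qed
  qed
qed

text \<open>
  For a threshold \<open>t\<close> and a coordinate \<open>j\<close> let \<open>U\<close> be the mass, under the product of the marginals, of the
  vectors \<open>y \<le> Y\<close> with \<open>t < y $ j\<close>. It is an integral of indicators of \<open>y \<le> Y\<close>, each almost
  surely a function of \<open>V\<close>, so \<open>U\<close> is orthogonal to its own residual and hence a function of \<open>V\<close>
  as well. Almost surely \<open>U\<close> is positive exactly if \<open>t < Y $ j\<close>. Rational thresholds recover \<open>Y\<close>.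
\<close>

lemma factor_if_upper_events_factor:
  fixes Y :: "'a \<Rightarrow> real ^ 'd" and V :: "'a \<Rightarrow> 'b::topological_space"
  assumes M: "prob_space M" and Y [measurable]: "Y \<in> borel_measurable M" and V [measurable]: "V \<in> borel_measurable M"
    and h [measurable]: "\<And>y. h y \<in> borel_measurable borel" and h01: "\<And>y b. 0 \<le> h y b" "\<And>y b. h y b \<le> (1::real)"
    and eq: "AE y in marginal_product M Y. AE \<omega> in M. of_bool (y \<le> Y \<omega>) = h y (V \<omega>)"
  shows "\<exists>f. f \<in> borel_measurable borel \<and> (AE \<omega> in M. Y \<omega> = f (V \<omega>))"
proof -
  interpret prob_space M by fact
  let ?nu = "marginal_product M Y"
  interpret nu: prob_space ?nu by (rule prob_space_marginal_product) fact+
  interpret pr: pair_prob_space M ?nu ..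
  have "\<exists>k :: 'b \<Rightarrow> real. k \<in> borel_measurable borel \<and> (AE \<omega> in M. t < Y \<omega> $ j \<longleftrightarrow> 0 < k (V \<omega>))" for t :: real and j
  proof -
    define \<psi> :: "real ^ 'd \<Rightarrow> real" where "\<psi> y = of_bool (t < y $ j)" for y
    have [measurable]: "\<psi> \<in> borel_measurable borel" unfolding \<psi>_def by measurable
    have \<psi>01: "0 \<le> \<psi> y" "\<psi> y \<le> 1" for y by (auto simp: \<psi>_def)
    define U where "U \<omega> = (\<integral>y. \<psi> y * of_bool (y \<le> Y \<omega>) \<partial>?nu)" for \<omega>
    have U_eq: "U \<omega> = measure ?nu {y. y \<le> Y \<omega> \<and> t < y $ j}" for \<omega>
    proof -
      have "(\<lambda>y. \<psi> y * of_bool (y \<le> Y \<omega>)) = indicator {y. y \<le> Y \<omega> \<and> t < y $ j}"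
        by (auto simp: \<psi>_def indicator_def fun_eq_iff)
      then show ?thesis by (simp add: U_def)
    qed
    have U01: "0 \<le> U \<omega>" "U \<omega> \<le> 1" for \<omega> by (auto simp: U_eq)
    have Um [measurable]: "U \<in> borel_measurable M" unfolding U_def by measurable
    obtain k where k [measurable]: "k \<in> borel_measurable borel" and k01: "\<And>b. 0 \<le> k b" "\<And>b. k b \<le> 1"
      and kU: "\<forall>\<phi> \<in> borel_measurable borel. \<forall>B. (\<forall>b. \<bar>\<phi> b\<bar> \<le> B) \<longrightarrow>
        (\<integral>\<omega>. \<phi> (V \<omega>) * U \<omega> \<partial>M) = (\<integral>\<omega>. \<phi> (V \<omega>) * k (V \<omega>) \<partial>M)"
      using cond_exp_factor[OF V Um U01] by blast
    let ?d = "\<lambda>\<omega>. U \<omega> - k (V \<omega>)"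
    have d1: "\<bar>?d \<omega>\<bar> \<le> 1" for \<omega> using U01 k01 by (intro abs_diff_unit_interval)
    have intB: "integrable M (\<lambda>\<omega>. a \<omega> * b \<omega>)"
      if "\<And>\<omega>. \<bar>a \<omega>\<bar> \<le> 1" "\<And>\<omega>. \<bar>b \<omega>\<bar> \<le> 1" "a \<in> borel_measurable M" "b \<in> borel_measurable M" for a b :: "'a \<Rightarrow> real"
      using that by (intro integrable_const_bound[of _ 1]) (auto simp: abs_mult mult_le_one)
    have orth: "(\<integral>\<omega>. ?d \<omega> * \<phi> (V \<omega>) \<partial>M) = 0" if [measurable]: "\<phi> \<in> borel_measurable borel" and b: "\<And>b. \<bar>\<phi> b\<bar> \<le> 1" for \<phi>
    proof -
      have "integrable M (\<lambda>\<omega>. \<phi> (V \<omega>) * U \<omega>)" "integrable M (\<lambda>\<omega>. \<phi> (V \<omega>) * k (V \<omega>))"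
        using b U01 k01 by (auto intro!: intB)
      then have "(\<integral>\<omega>. \<phi> (V \<omega>) * U \<omega> - \<phi> (V \<omega>) * k (V \<omega>) \<partial>M) = 0"
        using kU[rule_format, OF that] by simp
      then show ?thesis by (simp add: algebra_simps)
    qed
    have "(\<integral>\<omega>. ?d \<omega> * U \<omega> \<partial>M) = (\<integral>\<omega>. (\<integral>y. ?d \<omega> * (\<psi> y * of_bool (y \<le> Y \<omega>)) \<partial>?nu) \<partial>M)"
      by (simp add: U_def[abs_def])
    also have "\<dots> = (\<integral>y. (\<integral>\<omega>. ?d \<omega> * (\<psi> y * of_bool (y \<le> Y \<omega>)) \<partial>M) \<partial>?nu)"
    proof (rule pr.Fubini_integral[symmetric])
      have "\<bar>?d \<omega> * (\<psi> y * of_bool (y \<le> Y \<omega>))\<bar> \<le> 1" for \<omega> y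
        using d1[of \<omega>] \<psi>01[of y] by (auto simp: abs_mult intro: mult_le_one)
      then show "integrable (M \<Otimes>\<^sub>M ?nu) (\<lambda>(\<omega>, y). ?d \<omega> * (\<psi> y * of_bool (y \<le> Y \<omega>)))"
        by (intro pr.integrable_const_bound[of _ 1]) auto
    qed
    also have "\<dots> = (\<integral>y. 0 \<partial>?nu)"
    proof (rule integral_cong_AE)
      show "AE y in ?nu. (\<integral>\<omega>. ?d \<omega> * (\<psi> y * of_bool (y \<le> Y \<omega>)) \<partial>M) = 0"
        using eq
      proof eventually_elim
        case (elim y)
        have "(\<integral>\<omega>. ?d \<omega> * (\<psi> y * of_bool (y \<le> Y \<omega>)) \<partial>M) = (\<integral>\<omega>. \<psi> y * (?d \<omega> * h y (V \<omega>)) \<partial>M)"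
          using elim by (intro integral_cong_AE) (auto elim!: eventually_mono)
        also have "\<dots> = 0" using orth[of "h y"] h01 by simp
        finally show ?case .
      qed
    qed measurable
    finally have dU: "(\<integral>\<omega>. ?d \<omega> * U \<omega> \<partial>M) = 0" by simp
    have dk: "(\<integral>\<omega>. ?d \<omega> * k (V \<omega>) \<partial>M) = 0" using orth[of k] k01 by simp
    have "(\<integral>\<omega>. ?d \<omega> * U \<omega> - ?d \<omega> * k (V \<omega>) \<partial>M) = 0"
    proof -
      have "integrable M (\<lambda>\<omega>. ?d \<omega> * U \<omega>)" "integrable M (\<lambda>\<omega>. ?d \<omega> * k (V \<omega>))"
        using d1 U01 k01 by (auto intro!: intB)
      then show ?thesis using dU dk by simp
    qed
    then have "(\<integral>\<omega>. (?d \<omega>)\<^sup>2 \<partial>M) = 0" by (simp add: power2_eq_square right_diff_distrib)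
    moreover have "integrable M (\<lambda>\<omega>. (?d \<omega>)\<^sup>2)"
      unfolding power2_eq_square using d1 by (intro intB) auto
    ultimately have "AE \<omega> in M. (?d \<omega>)\<^sup>2 = 0" by (simp add: integral_nonneg_eq_0_iff_AE)
    then have "AE \<omega> in M. t < Y \<omega> $ j \<longleftrightarrow> 0 < k (V \<omega>)"
      using AE_marginal_product_box_positive[OF M Y, of t j]
    proof eventually_elim
      case (elim \<omega>)
      have "0 < U \<omega> \<longleftrightarrow> t < Y \<omega> $ j"
      proof
        assume "0 < U \<omega>"
        then have "{y. y \<le> Y \<omega> \<and> t < y $ j} \<noteq> {}" unfolding U_eq by (metis measure_empty less_irrefl)
        then show "t < Y \<omega> $ j" by (auto simp: less_eq_vec_def intro: less_le_trans)
      next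
        assume "t < Y \<omega> $ j"
        then show "0 < U \<omega>" using elim by (simp add: U_eq nu.emeasure_eq_measure)
      qed
      then show ?case using elim by simp
    qed
    with k show ?thesis by (intro exI[of _ k] conjI)
  qed
  then have "\<forall>tj. \<exists>k :: 'b \<Rightarrow> real. k \<in> borel_measurable borel \<and> (AE \<omega> in M. fst tj < Y \<omega> $ snd tj \<longleftrightarrow> 0 < k (V \<omega>))"
    by simp
  from choice[OF this] obtain k' :: "real \<times> 'd \<Rightarrow> 'b \<Rightarrow> real" where
    "\<forall>tj. k' tj \<in> borel_measurable borel \<and> (AE \<omega> in M. fst tj < Y \<omega> $ snd tj \<longleftrightarrow> 0 < k' tj (V \<omega>))" ..
  then have k [measurable]: "\<And>t j. k' (t, j) \<in> borel_measurable borel"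
    and kY: "\<And>t j. AE \<omega> in M. t < Y \<omega> $ j \<longleftrightarrow> 0 < k' (t, j) (V \<omega>)" by (force, fastforce)
  define f where "f b = (\<chi> j. real_of_ereal (SUP q. if 0 < k' (real_of_rat q, j) b then ereal (real_of_rat q) else -\<infinity>))" for b
  have "f \<in> borel_measurable borel" unfolding f_def by measurable
  moreover have "AE \<omega> in M. \<forall>q j. real_of_rat q < Y \<omega> $ j \<longleftrightarrow> 0 < k' (real_of_rat q, j) (V \<omega>)"
    using kY by (simp add: AE_all_countable)
  then have "AE \<omega> in M. Y \<omega> = f (V \<omega>)"
  proof eventually_elim
    case (elim \<omega>)
    have "(SUP q. if 0 < k' (real_of_rat q, j) (V \<omega>) then ereal (real_of_rat q) else -\<infinity>) = ereal (Y \<omega> $ j)" for j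
    proof (rule SUP_eqI)
      fix q :: rat
      show "(if 0 < k' (real_of_rat q, j) (V \<omega>) then ereal (real_of_rat q) else -\<infinity>) \<le> ereal (Y \<omega> $ j)"
        using elim by (auto intro: less_imp_le)
    next
      fix z assume z: "\<And>q. q \<in> UNIV \<Longrightarrow> (if 0 < k' (real_of_rat q, j) (V \<omega>) then ereal (real_of_rat q) else -\<infinity>) \<le> z"
      show "ereal (Y \<omega> $ j) \<le> z"
      proof (rule ccontr)
        assume "\<not> ereal (Y \<omega> $ j) \<le> z"
        then have zY: "z < ereal (Y \<omega> $ j)" by simp
        obtain q where "z < ereal (real_of_rat q)" "real_of_rat q < Y \<omega> $ j"
        proof (cases z)
          case (real r)
          then obtain q where "r < real_of_rat q" "real_of_rat q < Y \<omega> $ j"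
            using of_rat_dense[of r "Y \<omega> $ j"] zY by auto
          then show ?thesis using that real by simp
        next
          case MInf
          obtain q where "real_of_rat q < Y \<omega> $ j"
            using of_rat_dense[of "Y \<omega> $ j - 1" "Y \<omega> $ j"] by auto
          then show ?thesis using that MInf by simp
        qed (use zY in simp)
        then show False using z[of q] elim by (auto simp: not_le[symmetric])
      qed
    qed
    then show ?case by (simp add: f_def vec_eq_iff)
  qed
  ultimately show ?thesis by blast
qed

text \<open>
  The integrand is the mean square of the residual of the indicator given \<open>V\<close>. If the integral is zero,
  these residuals vanish for almost every \<open>y\<close>.
\<close>

lemma (in prob_space) residual_variance_nonzero:
  fixes Y :: "'a \<Rightarrow> real ^ 'd" and V :: "'a \<Rightarrow> 'b::topological_space" and h :: "real ^ 'd \<Rightarrow> 'b \<Rightarrow> real"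
  assumes Y [measurable]: "Y \<in> borel_measurable M" and V [measurable]: "V \<in> borel_measurable M"
    and h [measurable]: "\<And>y. h y \<in> borel_measurable borel" and h01: "\<And>y b. 0 \<le> h y b" "\<And>y b. h y b \<le> 1"
    and cond: "\<And>y. (\<integral>\<omega>. h y (V \<omega>) * of_bool (y \<le> Y \<omega>) \<partial>M) = (\<integral>\<omega>. h y (V \<omega>) * h y (V \<omega>) \<partial>M)"
    and int: "integrable (marginal_product M Y) (\<lambda>y. prob (upper_event M Y y) - (\<integral>\<omega>. (h y (V \<omega>))\<^sup>2 \<partial>M))"
    and not: "\<nexists>f. f \<in> borel_measurable borel \<and> (AE \<omega> in M. Y \<omega> = f (V \<omega>))"
  shows "(\<integral>y. prob (upper_event M Y y) - (\<integral>\<omega>. (h y (V \<omega>))\<^sup>2 \<partial>M) \<partial>marginal_product M Y) \<noteq> 0"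
proof
  assume zero: "(\<integral>y. prob (upper_event M Y y) - (\<integral>\<omega>. (h y (V \<omega>))\<^sup>2 \<partial>M) \<partial>marginal_product M Y) = 0"
  let ?b = "\<lambda>y \<omega>. of_bool (y \<le> Y \<omega>) :: real"
  have i: "integrable M (?b y)" "integrable M (\<lambda>\<omega>. h y (V \<omega>) * ?b y \<omega>)" "integrable M (\<lambda>\<omega>. h y (V \<omega>) * h y (V \<omega>))"
    for y using h01 by (auto intro!: integrable_const_bound[of _ 1] simp: abs_mult mult_le_one)
  note P = prob_upper_event(3)[OF Y, symmetric]
  have sq: "(?b y \<omega> - h y (V \<omega>))\<^sup>2 = ?b y \<omega> - 2 * (h y (V \<omega>) * ?b y \<omega>) + h y (V \<omega>) * h y (V \<omega>)" for y \<omega>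
    by (auto simp: power2_eq_square algebra_simps)
  have isq: "integrable M (\<lambda>\<omega>. (?b y \<omega> - h y (V \<omega>))\<^sup>2)" for y unfolding sq using i by auto
  have eq: "prob (upper_event M Y y) - (\<integral>\<omega>. (h y (V \<omega>))\<^sup>2 \<partial>M) = (\<integral>\<omega>. (?b y \<omega> - h y (V \<omega>))\<^sup>2 \<partial>M)" for y
    unfolding P sq using i cond[of y] by (simp add: power2_eq_square)
  have "AE y in marginal_product M Y. prob (upper_event M Y y) - (\<integral>\<omega>. (h y (V \<omega>))\<^sup>2 \<partial>M) = 0"
    using zero by (subst (asm) integral_nonneg_eq_0_iff_AE[OF int]) (auto simp: eq)
  then have "AE y in marginal_product M Y. AE \<omega> in M. ?b y \<omega> = h y (V \<omega>)"
  proof eventually_elim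
    case (elim y)
    then have "AE \<omega> in M. (?b y \<omega> - h y (V \<omega>))\<^sup>2 = 0"
      unfolding eq by (subst (asm) integral_nonneg_eq_0_iff_AE[OF isq]) auto
    then show ?case by eventually_elim simp
  qed
  from factor_if_upper_events_factor[OF prob_space_axioms Y V h h01 this] not show False by blast
qed

section \<open>Almost sure limits of the rank sums\<close>

lemma R_tilde_nonneg: "0 \<le> R_tilde n \<pi> y v"
  by (simp add: R_tilde_def sum_nonneg)

lemma R_tilde_le: "R_tilde n \<pi> y v \<le> n"
proof -
  have "R_tilde n \<pi> y v \<le> (\<Sum>i<n. 1)" unfolding R_tilde_def by (intro sum_mono) auto
  then show ?thesis by simp
qed

lemma R_tilde_inf:
  "R_tilde n \<pi> y (inf a b) = (\<Sum>k<n. of_bool (Y_tilde \<pi> y k \<le> a) * of_bool (Y_tilde \<pi> y k \<le> b))"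
  by (simp add: R_tilde_def of_bool_conj)

lemma sum_R_tilde: "(\<Sum>i<n. R_tilde n \<pi> y (y i)) = (\<Sum>k<n. L_check n \<pi> y k)"
  unfolding R_tilde_def L_check_def by (rule sum.swap)

text \<open>
  Exchanging the sums turns an average over permuted vectors into the conditional mean, given the
  data, of the rank sum at randomly chosen neighbours.
\<close>

lemma sum_nn_form_R_tilde:
  "(\<Sum>k<n. nn_form {..<n} z (\<lambda>i. of_bool (Y_tilde \<pi> y k \<le> y i)))
    = (\<Sum>i<n. \<Sum>j<n. nn_weight {..<n} z i j * R_tilde n \<pi> y (inf (y i) (y j)))"
proof -
  have "(\<Sum>k<n. nn_form {..<n} z (\<lambda>i. of_bool (Y_tilde \<pi> y k \<le> y i)))
     = (\<Sum>i<n. \<Sum>k<n. \<Sum>j<n. nn_weight {..<n} z i j * of_bool (Y_tilde \<pi> y k \<le> y i) * of_bool (Y_tilde \<pi> y k \<le> y j))"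
    unfolding nn_form_def by (rule sum.swap)
  also have "\<dots> = (\<Sum>i<n. \<Sum>j<n. \<Sum>k<n. nn_weight {..<n} z i j * of_bool (Y_tilde \<pi> y k \<le> y i) * of_bool (Y_tilde \<pi> y k \<le> y j))"
    by (intro sum.cong refl sum.swap)
  also have "\<dots> = (\<Sum>i<n. \<Sum>j<n. nn_weight {..<n} z i j * R_tilde n \<pi> y (inf (y i) (y j)))"
    unfolding R_tilde_inf by (simp only: sum_distrib_left mult.assoc)
  finally show ?thesis .
qed

text \<open>
  For a constant feature all other points are nearest neighbours, so every ordered pair of distinct
  indices has weight \<open>1 / (n - 1)\<close>.
\<close>

lemma nn_form_constant:
  fixes f :: "nat \<Rightarrow> real" and c :: "'b::metric_space"
  assumes "2 \<le> n" and f: "\<And>i. f i * f i = f i"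
  shows "real (n - 1) * nn_form {..<n} (\<lambda>_. c) f = (\<Sum>i<n. f i)\<^sup>2 - (\<Sum>i<n. f i)"
proof -
  have S: "nn_set {..<n} (\<lambda>_. c) i = {..<n} - {i}" for i by (auto simp: nn_set_def)
  have "real (n - 1) * (nn_weight {..<n} (\<lambda>_. c) i j * f i * f j) = f i * f j - (if i = j then f i else 0)"
    if "i < n" "j < n" for i j
    using that assms by (cases "i = j") (auto simp: nn_weight_def S)
  then have "real (n - 1) * nn_form {..<n} (\<lambda>_. c) f = (\<Sum>i<n. \<Sum>j<n. f i * f j - (if i = j then f i else 0))"
    unfolding nn_form_def sum_distrib_left by (intro sum.cong refl) simp
  also have "\<dots> = (\<Sum>i<n. \<Sum>j<n. f i * f j) - (\<Sum>i<n. f i)"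
    by (simp add: sum_subtractf)
  also have "(\<Sum>i<n. \<Sum>j<n. f i * f j) = (\<Sum>i<n. f i)\<^sup>2"
    by (simp add: power2_eq_square sum_product)
  finally show ?thesis .
qed

text \<open>
  An independent sample, possibly on a larger probability space that also carries the random indices,
  with one family of permutations for each sample size. The records live in an arbitrary space, and \<open>yv\<close>
  extracts the response.
\<close>

locale permuted_sample = M: prob_space M + mu: prob_space \<mu>
  for M :: "'a measure" and \<mu> :: "('r::topological_space) measure" +
  fixes D :: "nat \<Rightarrow> 'a \<Rightarrow> 'r" and yv :: "'r \<Rightarrow> real ^ 'd" and \<pi> :: "nat \<Rightarrow> 'd \<Rightarrow> nat \<Rightarrow> nat"
  assumes D [measurable]: "\<And>j. D j \<in> borel_measurable M"
    and sets_mu [measurable_cong]: "sets \<mu> = sets borel"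
    and yv [measurable]: "yv \<in> borel_measurable borel"
    and law: "\<And>n. 0 < n \<Longrightarrow>
      distr M (\<Pi>\<^sub>M i\<in>{..<n}. \<mu>) (\<lambda>\<omega>. \<lambda>i\<in>{..<n}. D i \<omega>) = (\<Pi>\<^sub>M i\<in>{..<n}. \<mu>)"
    and perm: "\<And>n d. n \<ge> CARD('d) \<Longrightarrow> bij_betw (\<pi> n d) {..<n} {..<n}"
    and perm_distinct: "\<And>n d1 d2 i. n \<ge> CARD('d) \<Longrightarrow> i < n \<Longrightarrow> d1 \<noteq> d2 \<Longrightarrow> \<pi> n d1 i \<noteq> \<pi> n d2 i"
begin

abbreviation Ys :: "'a \<Rightarrow> nat \<Rightarrow> real ^ 'd" where "Ys \<omega> \<equiv> (\<lambda>i. yv (D i \<omega>))"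

lemma D_mu: "D j \<in> M \<rightarrow>\<^sub>M \<mu>" by measurable

lemma yv_mu: "yv \<in> borel_measurable \<mu>" by measurable

lemma sum_L_check_tendsto:
  fixes p :: "real ^ 'd \<Rightarrow> real"
  defines "p \<equiv> (\<lambda>y. \<integral>r. of_bool (y \<le> yv r) \<partial>\<mu>)"
  shows "p \<in> borel_measurable (marginal_product \<mu> yv)"
    and "AE \<omega> in M. (\<lambda>n. (\<Sum>k<n. L_check n (\<pi> n) (Ys \<omega>) k) / (real n)\<^sup>2)
      \<longlonglongrightarrow> (\<integral>y. p y \<partial>marginal_product \<mu> yv)"
proof -
  interpret SF: stable_functional \<mu> yv "\<lambda>I x y. \<Sum>i\<in>I. of_bool (y \<le> yv (x i))" 1
    by (rule stable_functional_count[OF mu.prob_space_axioms yv_mu])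
  have E: "(\<integral>x. (\<Sum>i<n. of_bool (y \<le> yv (x i))) \<partial>SF.PI {..<n}) = n * p y" for n y
    unfolding p_def
    using expectation_PiM_sum(2)[OF mu.prob_space_axioms, of "{..<n}" "\<lambda>r. of_bool (y \<le> yv r)" 1] by simp
  have lim: "(\<lambda>n. (\<integral>x. (\<Sum>i<n. of_bool (y \<le> yv (x i))) \<partial>SF.PI {..<n}) / real n) \<longlonglongrightarrow> p y" for y
    unfolding E
  proof (rule tendsto_eventually)
    show "eventually (\<lambda>n. real n * p y / real n = p y) sequentially"
      using eventually_gt_at_top[of 0] by eventually_elim simp
  qed
  show "p \<in> borel_measurable (marginal_product \<mu> yv)" using lim by (rule SF.limit_borel_measurable)
  show "AE \<omega> in M. (\<lambda>n. (\<Sum>k<n. L_check n (\<pi> n) (Ys \<omega>) k) / (real n)\<^sup>2)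
      \<longlonglongrightarrow> (\<integral>y. p y \<partial>marginal_product \<mu> yv)"
    using SF.shuffled_average_tendsto[OF M.prob_space_axioms D_mu law perm perm_distinct lim]
    by (simp add: SF.shuffled_average_def L_check_def)
qed

context
  fixes g :: "'r \<Rightarrow> 'b::euclidean_space" and h :: "real ^ 'd \<Rightarrow> 'b \<Rightarrow> real"
  assumes g [measurable]: "g \<in> borel_measurable borel"
    and h [measurable]: "\<And>y. h y \<in> borel_measurable borel"
    and h01: "\<And>y b. 0 \<le> h y b" "\<And>y b. h y b \<le> 1"
    and cond: "\<And>y \<phi>. \<phi> \<in> borel_measurable borel \<Longrightarrow> (\<And>b. \<bar>\<phi> b\<bar> \<le> 1) \<Longrightarrow>
      (\<integral>r. \<phi> (g r) * of_bool (y \<le> yv r) \<partial>\<mu>) = (\<integral>r. \<phi> (g r) * h y (g r) \<partial>\<mu>)"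
begin

lemma sum_nn_form_tendsto:
  shows "(\<lambda>y. \<integral>r. (h y (g r))\<^sup>2 \<partial>\<mu>) \<in> borel_measurable (marginal_product \<mu> yv)"
    and "AE \<omega> in M. (\<lambda>n. (\<Sum>k<n. nn_form {..<n} (\<lambda>i. g (D i \<omega>))
        (\<lambda>i. of_bool (Y_tilde (\<pi> n) (Ys \<omega>) k \<le> Ys \<omega> i))) / (real n)\<^sup>2)
      \<longlonglongrightarrow> (\<integral>y. (\<integral>r. (h y (g r))\<^sup>2 \<partial>\<mu>) \<partial>marginal_product \<mu> yv)"
proof -
  have g_mu: "g \<in> borel_measurable \<mu>" by measurable
  obtain K where "stable_functional \<mu> yv
      (\<lambda>I x y. nn_form I (\<lambda>i. g (x i)) (\<lambda>i. of_bool (y \<le> yv (x i)))) K"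
    using stable_functional_nn_form[OF mu.prob_space_axioms yv_mu g_mu] by blast
  then interpret SF: stable_functional \<mu> yv
      "\<lambda>I x y. nn_form I (\<lambda>i. g (x i)) (\<lambda>i. of_bool (y \<le> yv (x i)))" K .
  have lim: "(\<lambda>n. (\<integral>x. nn_form {..<n} (\<lambda>i. g (x i)) (\<lambda>i. of_bool (y \<le> yv (x i))) \<partial>SF.PI {..<n}) / real n)
      \<longlonglongrightarrow> (\<integral>r. (h y (g r))\<^sup>2 \<partial>\<mu>)" for y
    using h01 cond by (intro expectation_nn_form_tendsto mu.prob_space_axioms g_mu) auto
  show "(\<lambda>y. \<integral>r. (h y (g r))\<^sup>2 \<partial>\<mu>) \<in> borel_measurable (marginal_product \<mu> yv)"
    using lim by (rule SF.limit_borel_measurable)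
  show "AE \<omega> in M. (\<lambda>n. (\<Sum>k<n. nn_form {..<n} (\<lambda>i. g (D i \<omega>))
        (\<lambda>i. of_bool (Y_tilde (\<pi> n) (Ys \<omega>) k \<le> Ys \<omega> i))) / (real n)\<^sup>2)
      \<longlonglongrightarrow> (\<integral>y. (\<integral>r. (h y (g r))\<^sup>2 \<partial>\<mu>) \<partial>marginal_product \<mu> yv)"
    using SF.shuffled_average_tendsto[OF M.prob_space_axioms D_mu law perm perm_distinct lim]
    by (simp add: SF.shuffled_average_def)
qed

text \<open>
  The rank sum differs from its conditional mean given the data by a centred sum of \<open>n\<close> independent
  choices, each of size at most \<open>1 / n\<close>.
\<close>

theorem sum_R_tilde_neighbour_tendsto:
  assumes N: "\<And>n. 2 \<le> n \<Longrightarrow> nearest_neighbours M D g n (N n)"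
  shows "AE \<omega> in M. (\<lambda>n. (\<Sum>i<n. R_tilde n (\<pi> n) (Ys \<omega>) (inf (Ys \<omega> i) (Ys \<omega> (N n i \<omega>)))) / (real n)\<^sup>2)
      \<longlonglongrightarrow> (\<integral>y. (\<integral>r. (h y (g r))\<^sup>2 \<partial>\<mu>) \<partial>marginal_product \<mu> yv)"
proof -
  define c where "c n i j x = R_tilde n (\<pi> n) (\<lambda>i. yv (x i)) (inf (yv (x i)) (yv (x j))) / (real n)\<^sup>2"
    for n i j and x :: "nat \<Rightarrow> 'r"
  define T where "T n \<omega> = (\<Sum>i<n. R_tilde n (\<pi> n) (Ys \<omega>) (inf (Ys \<omega> i) (Ys \<omega> (N n i \<omega>)))) / (real n)\<^sup>2" for n \<omega>
  define S where "S n \<omega> = (\<Sum>k<n. nn_form {..<n} (\<lambda>i. g (D i \<omega>))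
        (\<lambda>i. of_bool (Y_tilde (\<pi> n) (Ys \<omega>) k \<le> Ys \<omega> i))) / (real n)\<^sup>2" for n \<omega>
  define n0 where "n0 = max 2 CARD('d)"
  have mem: "\<pi> n d k < n" if "n \<ge> CARD('d)" "k < n" for n d k
    using bij_betw_apply[OF perm[OF that(1)]] that by auto
  have T_S: "T n \<omega> - S n \<omega> = (\<Sum>i<n. c n i (N n i \<omega>) (\<lambda>j. D j \<omega>))
      - (\<Sum>i<n. \<Sum>j<n. nn_weight {..<n} (\<lambda>j. g (D j \<omega>)) i j * c n i j (\<lambda>j. D j \<omega>))" for n \<omega>
    unfolding T_def S_def sum_nn_form_R_tilde c_def
    by (simp add: sum_divide_distrib)
  have "\<exists>A'. A' \<in> borel_measurable M \<and> (AE \<omega> in M. A' \<omega> = T n \<omega> - S n \<omega>)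
      \<and> (\<forall>l. integrable M (\<lambda>\<omega>. exp (l * A' \<omega>)))
      \<and> (\<forall>l. (\<integral>\<omega>. exp (l * A' \<omega>) \<partial>M) \<le> exp (n * (l\<^sup>2 * (1 / n)\<^sup>2 / 2)))" if n: "n0 \<le> n" for n
    unfolding T_S
  proof (rule tie_breaking_mgf)
    have n2: "2 \<le> n" and nd: "CARD('d) \<le> n" using n by (auto simp: n0_def)
    show "2 \<le> n" by fact
    show "nearest_neighbours M D g n (N n)" using N[OF n2] .
    fix i j :: nat
    { fix x
      have "\<bar>c n i j x\<bar> \<le> n / (real n)\<^sup>2"
        unfolding c_def by (simp add: R_tilde_nonneg) (intro divide_right_mono R_tilde_le; simp)
      then show "\<bar>c n i j x\<bar> \<le> 1 / n" using n2 by (simp add: power2_eq_square split: if_splits) }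
    assume ij: "i < n" "j < n"
    have Yt: "(\<lambda>x. Y_tilde (\<pi> n) (\<lambda>i. yv (x i)) k) \<in> borel_measurable (\<Pi>\<^sub>M j\<in>{..<n}. (borel :: 'r measure))"
      if "k < n" for k
      unfolding Y_tilde_def using mem[OF nd that]
      by (intro borel_measurable_vec_lambda measurable_compose[OF _ borel_measurable_nth]
          measurable_compose[OF _ yv] measurable_component_singleton) auto
    have comp: "(\<lambda>x. yv (x m)) \<in> borel_measurable (\<Pi>\<^sub>M j\<in>{..<n}. (borel :: 'r measure))" if "m < n" for m
      using that by (intro measurable_compose[OF _ yv] measurable_component_singleton) auto
    have "(\<lambda>x. of_bool (Y_tilde (\<pi> n) (\<lambda>i. yv (x i)) k \<le> yv (x m)) :: real)
        \<in> borel_measurable (\<Pi>\<^sub>M j\<in>{..<n}. (borel :: 'r measure))" if "k < n" "m < n" for k m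
    proof -
      note [measurable] = Yt[OF that(1)] comp[OF that(2)]
      show ?thesis by measurable
    qed
    then show "c n i j \<in> borel_measurable (\<Pi>\<^sub>M j\<in>{..<n}. borel)"
      unfolding c_def R_tilde_inf using ij
      by (intro borel_measurable_divide borel_measurable_sum borel_measurable_times) auto
    show "c n i j (\<lambda>j\<in>{..<n}. D j \<omega>) = c n i j (\<lambda>j. D j \<omega>)" for \<omega>
    proof -
      have "Y_tilde (\<pi> n) (\<lambda>i. yv ((\<lambda>j\<in>{..<n}. D j \<omega>) i)) k = Y_tilde (\<pi> n) (Ys \<omega>) k" if "k < n" for k
        using mem[OF nd that] by (simp add: Y_tilde_def vec_eq_iff)
      then show ?thesis using ij by (simp add: c_def R_tilde_def)
    qed
  qed (auto intro: M.prob_space_axioms)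
  then have "\<forall>n. \<exists>A'. n0 \<le> n \<longrightarrow> A' \<in> borel_measurable M \<and> (AE \<omega> in M. A' \<omega> = T n \<omega> - S n \<omega>)
      \<and> (\<forall>l. integrable M (\<lambda>\<omega>. exp (l * A' \<omega>)))
      \<and> (\<forall>l. (\<integral>\<omega>. exp (l * A' \<omega>) \<partial>M) \<le> exp (n * (l\<^sup>2 * (1 / n)\<^sup>2 / 2)))" by blast
  from choice[OF this] obtain A where A: "\<And>n. n0 \<le> n \<Longrightarrow> A n \<in> borel_measurable M"
    "\<And>n. n0 \<le> n \<Longrightarrow> AE \<omega> in M. A n \<omega> = T n \<omega> - S n \<omega>"
    "\<And>n l. n0 \<le> n \<Longrightarrow> integrable M (\<lambda>\<omega>. exp (l * A n \<omega>))"
    "\<And>n l. n0 \<le> n \<Longrightarrow> (\<integral>\<omega>. exp (l * A n \<omega>) \<partial>M) \<le> exp (n * (l\<^sup>2 * (1 / n)\<^sup>2 / 2))" by blast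
  have "AE \<omega> in M. (\<lambda>n. A n \<omega>) \<longlonglongrightarrow> 0"
  proof (rule M.subgaussian_tendsto_0[where ?n0.0 = n0 and K = "1 / 2"])
    fix n l assume n: "n0 \<le> n"
    then have "0 < n" by (simp add: n0_def)
    then have "real n * (l\<^sup>2 * (1 / n)\<^sup>2 / 2) = 1 / 2 * l\<^sup>2 / n" by (simp add: power2_eq_square)
    then show "(\<integral>\<omega>. exp (l * A n \<omega>) \<partial>M) \<le> exp (1 / 2 * l\<^sup>2 / n)" using A(4)[OF n, of l] by (simp only:)
  qed (use A in auto)
  moreover have "AE \<omega> in M. \<forall>n. n0 \<le> n \<longrightarrow> A n \<omega> = T n \<omega> - S n \<omega>"
    using A(2) by (subst AE_all_countable) auto
  ultimately have "AE \<omega> in M. (\<lambda>n. T n \<omega>) \<longlonglongrightarrow> (\<integral>y. (\<integral>r. (h y (g r))\<^sup>2 \<partial>\<mu>) \<partial>marginal_product \<mu> yv)"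
    using sum_nn_form_tendsto(2)[folded S_def]
  proof eventually_elim
    case (elim \<omega>)
    have "(\<lambda>n. A n \<omega> + S n \<omega>) \<longlonglongrightarrow> 0 + (\<integral>y. (\<integral>r. (h y (g r))\<^sup>2 \<partial>\<mu>) \<partial>marginal_product \<mu> yv)"
      using elim by (intro tendsto_add) auto
    moreover have "eventually (\<lambda>n. A n \<omega> + S n \<omega> = T n \<omega>) sequentially"
      using eventually_ge_at_top[of n0] by eventually_elim (use elim in auto)
    ultimately show ?case by (simp add: tendsto_cong)
  qed
  then show ?thesis unfolding T_def .
qed

end

text \<open>
  The square of a count is the quadratic form of a constant feature up to terms of lower order, and
  the conditional probability given a constant is the probability itself.
\<close>

lemma sum_L_check_squared_tendsto:
  shows "AE \<omega> in M. (\<lambda>n. (\<Sum>k<n. (L_check n (\<pi> n) (Ys \<omega>) k)\<^sup>2) / (real n) ^ 3)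
      \<longlonglongrightarrow> (\<integral>y. (\<integral>r. of_bool (y \<le> yv r) \<partial>\<mu>)\<^sup>2 \<partial>marginal_product \<mu> yv)"
proof -
  define p :: "real ^ 'd \<Rightarrow> real" where "p y = (\<integral>r. of_bool (y \<le> yv r) \<partial>\<mu>)" for y
  have p01: "0 \<le> p y" "p y \<le> 1" for y
  proof -
    have "p y \<le> (\<integral>r. 1 \<partial>\<mu>)" unfolding p_def
      by (intro integral_mono mu.integrable_const_bound[of _ 1]) auto
    then show "p y \<le> 1" by (simp add: mu.prob_space)
    show "0 \<le> p y" unfolding p_def by (intro integral_nonneg_AE) auto
  qed
  define S where "S n \<omega> = (\<Sum>k<n. nn_form {..<n} (\<lambda>i. 0 :: real)
        (\<lambda>i. of_bool (Y_tilde (\<pi> n) (Ys \<omega>) k \<le> Ys \<omega> i))) / (real n)\<^sup>2" for n \<omega>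
  have "AE \<omega> in M. (\<lambda>n. S n \<omega>) \<longlonglongrightarrow> (\<integral>y. (\<integral>r. (p y)\<^sup>2 \<partial>\<mu>) \<partial>marginal_product \<mu> yv)"
    unfolding S_def using p01
    by (intro sum_nn_form_tendsto(2)[where g = "\<lambda>_. 0 :: real" and h = "\<lambda>y _. p y"])
      (auto simp: p_def mu.prob_space)
  moreover note sum_L_check_tendsto(2)
  ultimately show ?thesis
  proof eventually_elim
    case (elim \<omega>)
    let ?L = "\<lambda>n k. L_check n (\<pi> n) (Ys \<omega>) k"
    have eq: "(\<Sum>k<n. (?L n k)\<^sup>2) / (real n) ^ 3 = (1 - 1 / n) * S n \<omega> + (1 / n) * ((\<Sum>k<n. ?L n k) / (real n)\<^sup>2)"
      if n: "2 \<le> n" for n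
    proof -
      have "(?L n k)\<^sup>2 = real (n - 1) * nn_form {..<n} (\<lambda>i. 0 :: real)
        (\<lambda>i. of_bool (Y_tilde (\<pi> n) (Ys \<omega>) k \<le> Ys \<omega> i)) + ?L n k" for k
        unfolding L_check_def using n by (subst nn_form_constant) auto
      then have "(\<Sum>k<n. (?L n k)\<^sup>2) = real (n - 1) * (S n \<omega> * (real n)\<^sup>2) + (\<Sum>k<n. ?L n k)"
        using n by (simp add: sum.distrib sum_distrib_left S_def)
      moreover have "real (n - 1) = real n - 1" using n by (simp add: of_nat_diff)
      moreover have "((m - 1) * (s * m\<^sup>2) + l) / m ^ 3 = (1 - 1 / m) * s + (1 / m) * (l / m\<^sup>2)"
        if "m \<noteq> 0" for m s l :: real
        using that by (simp add: field_simps power2_eq_square power3_eq_cube)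
      ultimately show ?thesis using n by simp
    qed
    have "(\<lambda>n. (1 - 1 / real n) * S n \<omega> + (1 / real n) * ((\<Sum>k<n. ?L n k) / (real n)\<^sup>2))
      \<longlonglongrightarrow> (1 - 0) * (\<integral>y. (\<integral>r. (p y)\<^sup>2 \<partial>\<mu>) \<partial>marginal_product \<mu> yv)
        + 0 * (\<integral>y. p y \<partial>marginal_product \<mu> yv)"
      using elim lim_const_over_n[of "1::real"] unfolding p_def
      by (intro tendsto_add tendsto_mult tendsto_diff tendsto_const) auto
    moreover have "eventually (\<lambda>n. (1 - 1 / real n) * S n \<omega> + (1 / real n) * ((\<Sum>k<n. ?L n k) / (real n)\<^sup>2)
        = (\<Sum>k<n. (?L n k)\<^sup>2) / (real n) ^ 3) sequentially"
      using eventually_ge_at_top[of 2] by eventually_elim (simp add: eq)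
    ultimately show ?case by (simp add: tendsto_cong p_def mu.prob_space)
  qed
qed

end

lemma integral_unit_interval:
  assumes "prob_space M" "\<And>x. 0 \<le> f x" "\<And>x. f x \<le> (1::real)" "f \<in> borel_measurable M"
  shows "integrable M f" "0 \<le> (\<integral>x. f x \<partial>M)" "(\<integral>x. f x \<partial>M) \<le> 1"
proof -
  interpret prob_space M by fact
  show i: "integrable M f" using assms by (intro integrable_const_bound[of _ 1]) auto
  show "0 \<le> (\<integral>x. f x \<partial>M)" using assms by (intro integral_nonneg_AE) auto
  have "(\<integral>x. f x \<partial>M) \<le> (\<integral>x. 1 \<partial>M)" using i assms by (intro integral_mono) auto
  then show "(\<integral>x. f x \<partial>M) \<le> 1" by (simp add: prob_space)
qed

lemma (in prob_space) variance_unit_interval: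
  fixes u :: "'a \<Rightarrow> real"
  assumes [measurable]: "u \<in> borel_measurable M" and u: "AE \<omega> in M. 0 \<le> u \<omega> \<and> u \<omega> \<le> 1"
  shows "variance u = expectation (\<lambda>\<omega>. (u \<omega>)\<^sup>2) - (expectation u)\<^sup>2"
proof (rule variance_eq)
  show "integrable M u" using u by (intro integrable_const_bound[of _ 1]) auto
  show "integrable M (\<lambda>\<omega>. (u \<omega>)\<^sup>2)"
  proof (rule integrable_const_bound[of _ 1])
    show "AE \<omega> in M. norm ((u \<omega>)\<^sup>2) \<le> 1"
      using u by eventually_elim (simp add: power_le_one)
  qed measurable
qed


definition cond_prob_second_moment ::
    "'a measure \<Rightarrow> 'a measure \<Rightarrow> ('a \<Rightarrow> real ^ 'd) \<Rightarrow> real ^ 'd \<Rightarrow> real" where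
  "cond_prob_second_moment M F Y y = (\<integral>\<omega>. (cond_prob_on M F (upper_event M Y y) \<omega>)\<^sup>2 \<partial>M)"

text \<open>
  The preceding limits in terms of conditional probabilities. Positivity of the residual is part of the
  statement because it needs the same version of the conditional probability.
\<close>

lemma (in permuted_sample) neighbour_rank_limit:
  fixes T :: "'a \<Rightarrow> 'r" and g :: "'r \<Rightarrow> 'b::euclidean_space"
  assumes T [measurable]: "T \<in> borel_measurable M" and T_law: "\<mu> = distr M borel T"
    and g [measurable]: "g \<in> borel_measurable borel"
  defines "Yt \<equiv> \<lambda>\<omega>. yv (T \<omega>)"
  defines "q \<equiv> cond_prob_second_moment M (sigma_gen M (\<lambda>\<omega>. g (T \<omega>)) borel) Yt"
  shows "q \<in> borel_measurable (marginal_product M Yt)"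
    and "0 \<le> q y" and "q y \<le> 1"
    and "(\<And>n. 2 \<le> n \<Longrightarrow> nearest_neighbours M D g n (N n)) \<Longrightarrow>
      AE \<omega> in M. (\<lambda>n. (\<Sum>i<n. R_tilde n (\<pi> n) (Ys \<omega>) (inf (Ys \<omega> i) (Ys \<omega> (N n i \<omega>)))) / (real n)\<^sup>2)
        \<longlonglongrightarrow> (\<integral>y. q y \<partial>marginal_product M Yt)"
    and "\<nexists>f. f \<in> borel_measurable borel \<and> (AE \<omega> in M. Yt \<omega> = f (g (T \<omega>))) \<Longrightarrow>
      integrable (marginal_product M Yt) (\<lambda>y. M.prob (upper_event M Yt y)) \<Longrightarrow>
      (\<integral>y. M.prob (upper_event M Yt y) - q y \<partial>marginal_product M Yt) \<noteq> 0"
proof -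
  have Y [measurable]: "Yt \<in> borel_measurable M" unfolding Yt_def by measurable
  have V: "(\<lambda>\<omega>. g (T \<omega>)) \<in> borel_measurable M" by measurable
  obtain h :: "real ^ 'd \<Rightarrow> 'b \<Rightarrow> real" where h0: "\<forall>y. h y \<in> borel_measurable borel \<and> (\<forall>b. 0 \<le> h y b \<and> h y b \<le> 1)
    \<and> (AE \<omega> in M. cond_prob_on M (sigma_gen M (\<lambda>\<omega>. g (T \<omega>)) borel) (upper_event M Yt y) \<omega> = h y (g (T \<omega>)))
    \<and> (\<forall>\<phi> \<in> borel_measurable borel. (\<forall>b. \<bar>\<phi> b\<bar> \<le> 1) \<longrightarrow>
      (\<integral>\<omega>. \<phi> (g (T \<omega>)) * of_bool (y \<le> Yt \<omega>) \<partial>M) = (\<integral>\<omega>. \<phi> (g (T \<omega>)) * h y (g (T \<omega>)) \<partial>M))"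
    using M.upper_event_factor[OF Y V] by blast
  have h [measurable]: "\<And>y. h y \<in> borel_measurable borel" and h01: "\<And>y b. 0 \<le> h y b" "\<And>y b. h y b \<le> 1"
    and h_eq: "\<And>y. AE \<omega> in M. cond_prob_on M (sigma_gen M (\<lambda>\<omega>. g (T \<omega>)) borel) (upper_event M Yt y) \<omega> = h y (g (T \<omega>))"
    using h0 by blast+
  have condM: "(\<integral>\<omega>. \<phi> (g (T \<omega>)) * of_bool (y \<le> Yt \<omega>) \<partial>M) = (\<integral>\<omega>. \<phi> (g (T \<omega>)) * h y (g (T \<omega>)) \<partial>M)"
    if "\<phi> \<in> borel_measurable borel" "\<And>b. \<bar>\<phi> b\<bar> \<le> 1" for \<phi> :: "'b \<Rightarrow> real" and y
    using h0 that by blast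
  have cond: "(\<integral>r. \<phi> (g r) * of_bool (y \<le> yv r) \<partial>\<mu>) = (\<integral>r. \<phi> (g r) * h y (g r) \<partial>\<mu>)"
    if [measurable]: "\<phi> \<in> borel_measurable borel" and b: "\<And>b. \<bar>\<phi> b\<bar> \<le> 1" for \<phi> :: "'b \<Rightarrow> real" and y
    unfolding T_law using condM[OF that] by (simp add: integral_distr Yt_def)
  have nu_eq: "marginal_product \<mu> yv = marginal_product M Yt"
    unfolding T_law Yt_def by (rule marginal_product_distr) measurable
  have q_eq: "q = (\<lambda>y. \<integral>r. (h y (g r))\<^sup>2 \<partial>\<mu>)"
  proof
    fix y
    have "q y = (\<integral>\<omega>. (h y (g (T \<omega>)))\<^sup>2 \<partial>M)"
      unfolding q_def cond_prob_second_moment_def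
    proof (rule integral_cong_AE)
      show "(\<lambda>\<omega>. (cond_prob_on M (sigma_gen M (\<lambda>\<omega>. g (T \<omega>)) borel) (upper_event M Yt y) \<omega>)\<^sup>2) \<in> borel_measurable M"
        unfolding cond_prob_on_def by (intro borel_measurable_power borel_measurable_cond_exp2)
      show "AE \<omega> in M. (cond_prob_on M (sigma_gen M (\<lambda>\<omega>. g (T \<omega>)) borel) (upper_event M Yt y) \<omega>)\<^sup>2 = (h y (g (T \<omega>)))\<^sup>2"
        using h_eq[of y] by eventually_elim simp
    qed measurable
    also have "\<dots> = (\<integral>r. (h y (g r))\<^sup>2 \<partial>\<mu>)"
      unfolding T_law by (subst integral_distr) auto
    finally show "q y = (\<integral>r. (h y (g r))\<^sup>2 \<partial>\<mu>)" .
  qed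
  show m: "q \<in> borel_measurable (marginal_product M Yt)"
    unfolding q_eq nu_eq[symmetric] by (rule sum_nn_form_tendsto(1)[OF g h h01 cond])
  have q01: "0 \<le> q y" "q y \<le> 1" for y
    unfolding q_eq using h01 integral_unit_interval(2,3)[OF mu.prob_space_axioms, of "\<lambda>r. (h y (g r))\<^sup>2"]
    by (auto simp: power_le_one)
  then show "0 \<le> q y" "q y \<le> 1" by auto
  show "AE \<omega> in M. (\<lambda>n. (\<Sum>i<n. R_tilde n (\<pi> n) (Ys \<omega>) (inf (Ys \<omega> i) (Ys \<omega> (N n i \<omega>)))) / (real n)\<^sup>2)
        \<longlonglongrightarrow> (\<integral>y. q y \<partial>marginal_product M Yt)"
    if "\<And>n. 2 \<le> n \<Longrightarrow> nearest_neighbours M D g n (N n)"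
    unfolding q_eq nu_eq[symmetric] by (rule sum_R_tilde_neighbour_tendsto[OF g h h01 cond that])
  show "(\<integral>y. M.prob (upper_event M Yt y) - q y \<partial>marginal_product M Yt) \<noteq> 0"
    if not: "\<nexists>f. f \<in> borel_measurable borel \<and> (AE \<omega> in M. Yt \<omega> = f (g (T \<omega>)))"
      and int: "integrable (marginal_product M Yt) (\<lambda>y. M.prob (upper_event M Yt y))"
  proof -
    have qM: "q = (\<lambda>y. \<integral>\<omega>. (h y (g (T \<omega>)))\<^sup>2 \<partial>M)"
      unfolding q_eq T_law by (auto simp: integral_distr)
    have "integrable (marginal_product M Yt) q"
      using q01 m by (intro integral_unit_interval(1) prob_space_marginal_product M.prob_space_axioms Y) auto
    then have "integrable (marginal_product M Yt) (\<lambda>y. M.prob (upper_event M Yt y) - q y)"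
      using int by simp
    then show ?thesis
      unfolding qM using h01 condM[OF h] not
      by (intro M.residual_variance_nonzero[OF Y V h h01]) auto
  qed
qed

section \<open>Convergence of the two coefficients\<close>

theorem theorem3:
  fixes M :: "'a measure"
    and Y :: "'a \<Rightarrow> real ^ 'dy" and X :: "'a \<Rightarrow> real ^ 'dx" and Z :: "'a \<Rightarrow> real ^ 'dz"
    and Ys :: "nat \<Rightarrow> 'a \<Rightarrow> real ^ 'dy" and Xs :: "nat \<Rightarrow> 'a \<Rightarrow> real ^ 'dx"
    and Zs :: "nat \<Rightarrow> 'a \<Rightarrow> real ^ 'dz"
    and \<pi> :: "nat \<Rightarrow> 'dy \<Rightarrow> nat \<Rightarrow> nat"
    and MZ MX MXZ :: "nat \<Rightarrow> nat \<Rightarrow> 'a \<Rightarrow> nat"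
  defines "D \<equiv> (\<lambda>i \<omega>. (Ys i \<omega>, Xs i \<omega>, Zs i \<omega>))"
  assumes prob: "prob_space M"
    and Y_meas: "Y \<in> borel_measurable M"
    and X_meas: "X \<in> borel_measurable M"
    and Z_meas: "Z \<in> borel_measurable M"
    and indep: "prob_space.indep_vars M (\<lambda>_. borel) D UNIV"
    and same_law: "\<And>i. distr M borel (D i) = distr M borel (\<lambda>\<omega>. (Y \<omega>, X \<omega>, Z \<omega>))"
    and perm: "\<And>n d. n \<ge> CARD('dy) \<Longrightarrow> bij_betw (\<pi> n d) {..<n} {..<n}"
    and perm_distinct:
      "\<And>n d1 d2 i. n \<ge> CARD('dy) \<Longrightarrow> i < n \<Longrightarrow> d1 \<noteq> d2 \<Longrightarrow> \<pi> n d1 i \<noteq> \<pi> n d2 i"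
    and MZ: "\<And>n. n \<ge> 2 \<Longrightarrow> nearest_neighbours M D (\<lambda>(y, x, z). z) n (MZ n)"
    and MX: "\<And>n. n \<ge> 2 \<Longrightarrow> nearest_neighbours M D (\<lambda>(y, x, z). x) n (MX n)"
    and MXZ: "\<And>n. n \<ge> 2 \<Longrightarrow> nearest_neighbours M D (\<lambda>(y, x, z). (x, z)) n (MXZ n)"
  shows "((\<nexists>c. AE \<omega> in M. Y \<omega> = c) \<longrightarrow>
           (AE \<omega> in M.
             (\<lambda>n. T_AC_hat n (\<pi> n) (\<lambda>i. Ys i \<omega>) (\<lambda>i. MZ n i \<omega>)) \<longlonglongrightarrow> T_AC M Y Z)) \<and>
         ((\<nexists>f. f \<in> borel_measurable borel \<and> (AE \<omega> in M. Y \<omega> = f (X \<omega>))) \<longrightarrow>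
           (AE \<omega> in M.
             (\<lambda>n. T_AC_cond_hat n (\<pi> n) (\<lambda>i. Ys i \<omega>) (\<lambda>i. MX n i \<omega>) (\<lambda>i. MXZ n i \<omega>))
               \<longlonglongrightarrow> T_AC_cond M Y X Z))"
proof -
  interpret prob_space M by fact
  note [measurable] = Y_meas X_meas Z_meas
  define T where "T \<omega> = (Y \<omega>, X \<omega>, Z \<omega>)" for \<omega>
  have T [measurable]: "T \<in> borel_measurable M" unfolding T_def by measurable
  define \<mu> where "\<mu> = distr M borel T"
  let ?y = "\<lambda>(y, x, z). y :: real ^ 'dy" and ?x = "\<lambda>(y, x, z). x :: real ^ 'dx"
    and ?z = "\<lambda>(y, x, z). z :: real ^ 'dz" and ?xz = "\<lambda>(y :: real ^ 'dy, x :: real ^ 'dx, z :: real ^ 'dz). (x, z)"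
  have coord [measurable]:
    "(?y :: (real^'dy) \<times> (real^'dx) \<times> (real^'dz) \<Rightarrow> real^'dy) \<in> borel_measurable borel"
    "(?x :: (real^'dy) \<times> (real^'dx) \<times> (real^'dz) \<Rightarrow> real^'dx) \<in> borel_measurable borel"
    "(?z :: (real^'dy) \<times> (real^'dx) \<times> (real^'dz) \<Rightarrow> real^'dz) \<in> borel_measurable borel"
    "?xz \<in> borel_measurable borel"
    unfolding split_beta' by (rule borel_measurable_continuous_onI; intro continuous_intros)+
  have yT: "?y (T \<omega>) = Y \<omega>" and xT: "?x (T \<omega>) = X \<omega>" and zT: "?z (T \<omega>) = Z \<omega>"
    and xzT: "?xz (T \<omega>) = (X \<omega>, Z \<omega>)" for \<omega> by (simp_all add: T_def)
  have D_meas: "D j \<in> borel_measurable M" for j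
    using indep by (simp add: indep_vars_def)
  have mu: "prob_space \<mu>" unfolding \<mu>_def by (rule prob_space_distr) measurable
  have sets_mu: "sets \<mu> = sets borel" by (simp add: \<mu>_def)
  have law: "distr M (\<Pi>\<^sub>M i\<in>{..<n}. \<mu>) (\<lambda>\<omega>. \<lambda>i\<in>{..<n}. D i \<omega>) = (\<Pi>\<^sub>M i\<in>{..<n}. \<mu>)" if n: "0 < n" for n
  proof -
    have "indep_vars (\<lambda>_. borel) D {..<n}" using indep by (rule indep_vars_subset) simp
    then have "distr M (\<Pi>\<^sub>M i\<in>{..<n}. borel) (\<lambda>\<omega>. \<lambda>i\<in>{..<n}. D i \<omega>) = (\<Pi>\<^sub>M i\<in>{..<n}. distr M borel (D i))"
      using n D_meas by (subst (asm) indep_vars_iff_distr_eq_PiM') (auto simp: lessThan_empty_iff)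
    moreover have "distr M (\<Pi>\<^sub>M i\<in>{..<n}. \<mu>) (\<lambda>\<omega>. \<lambda>i\<in>{..<n}. D i \<omega>) = distr M (\<Pi>\<^sub>M i\<in>{..<n}. borel) (\<lambda>\<omega>. \<lambda>i\<in>{..<n}. D i \<omega>)"
      by (intro distr_cong refl sets_PiM_cong) (simp_all add: sets_mu)
    ultimately show ?thesis by (simp add: same_law \<mu>_def T_def[abs_def])
  qed
  interpret S: permuted_sample M \<mu> D ?y \<pi>
    using D_meas sets_mu law perm perm_distinct coord(1) prob mu
    by (auto simp: permuted_sample_def permuted_sample_axioms_def)
  have nu_eq: "marginal_product \<mu> ?y = marginal_product M Y"
    unfolding \<mu>_def by (subst marginal_product_distr) (auto simp: T_def)
  define \<nu> where "\<nu> = marginal_product M Y"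
  have nu: "prob_space \<nu>" unfolding \<nu>_def by (rule prob_space_marginal_product) fact+
  let ?A = "upper_event M Y"
  note A_sets [measurable] = prob_upper_event(1)[OF Y_meas]
  define P where "P y = prob (?A y)" for y
  have P_exp: "expectation (indicator (?A y)) = P y" for y
    unfolding P_def by (rule prob_upper_event(2)[OF Y_meas])
  have P_mu: "(\<integral>r. of_bool (y \<le> ?y r) \<partial>\<mu>) = P y" for y
  proof -
    have "(\<integral>r. of_bool (y \<le> ?y r) \<partial>\<mu>) = (\<integral>\<omega>. (of_bool (y \<le> ?y (T \<omega>)) :: real) \<partial>M)"
      unfolding \<mu>_def by (rule integral_distr) measurable
    also have "\<dots> = P y" unfolding yT P_def by (rule prob_upper_event(3)[OF Y_meas])
    finally show ?thesis .
  qed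
  have P_meas [measurable]: "P \<in> borel_measurable \<nu>"
    using S.sum_L_check_tendsto(1) unfolding nu_eq P_mu \<nu>_def by simp
  have P01: "0 \<le> P y" "P y \<le> 1" for y by (auto simp: P_def)
  have intP: "integrable \<nu> P" "integrable \<nu> (\<lambda>y. (P y)\<^sup>2)"
    using P01 by (auto intro!: integral_unit_interval(1)[OF nu] simp: power_le_one)
  have SY: "S.Ys \<omega> = (\<lambda>i. Ys i \<omega>)" for \<omega> by (simp add: D_def)
  define SL where "SL n \<omega> = (\<Sum>k<n. L_check n (\<pi> n) (\<lambda>i. Ys i \<omega>) k) / (real n)\<^sup>2" for n \<omega>
  define SL2 where "SL2 n \<omega> = (\<Sum>k<n. (L_check n (\<pi> n) (\<lambda>i. Ys i \<omega>) k)\<^sup>2) / (real n) ^ 3" for n \<omega>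
  define SR where "SR N n \<omega> = (\<Sum>i<n. R_tilde n (\<pi> n) (\<lambda>i. Ys i \<omega>) (inf (Ys i \<omega>) (Ys (N n i \<omega>) \<omega>))) / (real n)\<^sup>2"
    for N :: "nat \<Rightarrow> nat \<Rightarrow> 'a \<Rightarrow> nat" and n \<omega>
  have L1: "AE \<omega> in M. (\<lambda>n. SL n \<omega>) \<longlonglongrightarrow> (\<integral>y. P y \<partial>\<nu>)"
    using S.sum_L_check_tendsto(2) unfolding nu_eq P_mu \<nu>_def SY SL_def .
  have L2: "AE \<omega> in M. (\<lambda>n. SL2 n \<omega>) \<longlonglongrightarrow> (\<integral>y. (P y)\<^sup>2 \<partial>\<nu>)"
    using S.sum_L_check_squared_tendsto unfolding nu_eq P_mu \<nu>_def SY SL2_def .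
  let ?c = "\<lambda>V y. cond_prob_on M (sigma_gen M V borel) (?A y)"
  let ?cZ = "?c Z" and ?cX = "?c X" and ?cXZ = "\<lambda>y. cond_prob_on M (sigma_gen M (\<lambda>\<omega>. (Z \<omega>, X \<omega>)) borel) (?A y)"
  let ?E2 = "\<lambda>c y. expectation (\<lambda>\<omega>. (c y \<omega>)\<^sup>2)"
  define aZ where "aZ = cond_prob_second_moment M (sigma_gen M Z borel) Y"
  define aX where "aX = cond_prob_second_moment M (sigma_gen M X borel) Y"
  define aXZ where "aXZ = cond_prob_second_moment M (sigma_gen M (\<lambda>\<omega>. (Z \<omega>, X \<omega>)) borel) Y"
  note a_eq = aZ_def aX_def aXZ_def cond_prob_second_moment_def
  note limZ = S.neighbour_rank_limit[OF T \<mu>_def coord(3), unfolded yT zT SY, folded \<nu>_def aZ_def]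
  note limX = S.neighbour_rank_limit[OF T \<mu>_def coord(2), unfolded yT xT SY, folded \<nu>_def aX_def]
  note limXZ = S.neighbour_rank_limit[OF T \<mu>_def coord(4), unfolded yT xzT SY sigma_gen_swap[of M X Z], folded \<nu>_def aXZ_def]
  have RZ: "AE \<omega> in M. (\<lambda>n. SR MZ n \<omega>) \<longlonglongrightarrow> (\<integral>y. aZ y \<partial>\<nu>)"
    using limZ(4)[OF MZ] by (simp add: SR_def D_def)
  have RX: "AE \<omega> in M. (\<lambda>n. SR MX n \<omega>) \<longlonglongrightarrow> (\<integral>y. aX y \<partial>\<nu>)"
    using limX(4)[OF MX] by (simp add: SR_def D_def)
  have RXZ: "AE \<omega> in M. (\<lambda>n. SR MXZ n \<omega>) \<longlonglongrightarrow> (\<integral>y. aXZ y \<partial>\<nu>)"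
    using limXZ(4)[OF MXZ] by (simp add: SR_def D_def)
  have ints: "integrable \<nu> aZ" "integrable \<nu> aX" "integrable \<nu> aXZ"
    using limZ(1-3) limX(1-3) limXZ(1-3) by (auto intro!: integral_unit_interval(1)[OF nu])
  note cp = cond_prob_unit_interval[OF _ A_sets]
  have XZ_m: "(\<lambda>\<omega>. (Z \<omega>, X \<omega>)) \<in> borel_measurable M" by measurable
  have varZ: "variance (?cZ y) = aZ y - (P y)\<^sup>2" for y
    using variance_unit_interval[OF cp(3,1)[OF Z_meas]] cp(2)[OF Z_meas] by (simp add: a_eq P_def)
  have ind2: "(indicator (?A y) \<omega>)\<^sup>2 = (indicator (?A y) \<omega> :: real)" for y \<omega>
    by (simp add: indicator_def)
  have var_ind: "variance (indicator (?A y)) = P y - (P y)\<^sup>2" for y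
    using variance_unit_interval[of "indicator (?A y)"] P_exp[of y] by (simp add: ind2)
  have cv_ind: "expectation (cond_var_on M (sigma_gen M X borel) (indicator (?A y))) = P y - aX y" for y
    using expectation_cond_var[OF X_meas, of "indicator (?A y)"] P_exp[of y]
    by (simp add: ind2 a_eq cond_prob_on_def)
  have cv_XZ: "expectation (cond_var_on M (sigma_gen M X borel) (?cXZ y)) = aXZ y - aX y" for y
  proof -
    have "expectation (\<lambda>\<omega>. (real_cond_exp M (sigma_gen M X borel) (?cXZ y) \<omega>)\<^sup>2) = ?E2 ?cX y"
    proof (rule integral_cong_AE)
      show "AE \<omega> in M. (real_cond_exp M (sigma_gen M X borel) (?cXZ y) \<omega>)\<^sup>2 = (?cX y \<omega>)\<^sup>2"
        using cond_prob_tower[OF X_meas Z_meas A_sets[of y]] by eventually_elim simp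
    qed (auto simp: cond_prob_on_def intro!: borel_measurable_power borel_measurable_cond_exp2)
    then show ?thesis
      using expectation_cond_var[OF X_meas cp(3,1)[OF XZ_m], of y] by (simp add: a_eq)
  qed
  have T1: "T_AC M Y Z = ((\<integral>y. aZ y \<partial>\<nu>) - (\<integral>y. (P y)\<^sup>2 \<partial>\<nu>)) / ((\<integral>y. P y \<partial>\<nu>) - (\<integral>y. (P y)\<^sup>2 \<partial>\<nu>))"
    unfolding T_AC_def varZ var_ind \<nu>_def[symmetric] using ints intP by simp
  have T2: "T_AC_cond M Y X Z = ((\<integral>y. aXZ y \<partial>\<nu>) - (\<integral>y. aX y \<partial>\<nu>)) / ((\<integral>y. P y \<partial>\<nu>) - (\<integral>y. aX y \<partial>\<nu>))"
    unfolding T_AC_cond_def cv_XZ cv_ind \<nu>_def[symmetric] using ints intP by simp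
  have hat1: "T_AC_hat n (\<pi> n) (\<lambda>i. Ys i \<omega>) (\<lambda>i. MZ n i \<omega>) = (SR MZ n \<omega> - SL2 n \<omega>) / (SL n \<omega> - SL2 n \<omega>)"
    if n: "0 < n" for n \<omega>
  proof -
    have alg: "(m * a - b) / (m * c - b) = (a / m\<^sup>2 - b / m ^ 3) / (c / m\<^sup>2 - b / m ^ 3)"
      if "m \<noteq> 0" for m a b c :: real
    proof -
      have "a / m\<^sup>2 - b / m ^ 3 = (m * a - b) / m ^ 3" "c / m\<^sup>2 - b / m ^ 3 = (m * c - b) / m ^ 3"
        using that by (simp_all add: field_simps power2_eq_square power3_eq_cube)
      then show ?thesis using that by simp
    qed
    let ?R = "\<lambda>i. R_tilde n (\<pi> n) (\<lambda>i. Ys i \<omega>) (inf (Ys i \<omega>) (Ys (MZ n i \<omega>) \<omega>))"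
      and ?L = "L_check n (\<pi> n) (\<lambda>i. Ys i \<omega>)"
    have "(\<Sum>i<n. real n * ?R i - (?L i)\<^sup>2) = real n * (\<Sum>i<n. ?R i) - (\<Sum>i<n. (?L i)\<^sup>2)"
      by (simp add: sum_subtractf sum_distrib_left)
    moreover have "(\<Sum>i<n. (real n - ?L i) * ?L i) = real n * (\<Sum>i<n. ?L i) - (\<Sum>i<n. (?L i)\<^sup>2)"
      by (simp add: sum_subtractf sum_distrib_left left_diff_distrib power2_eq_square)
    ultimately show ?thesis
      unfolding T_AC_hat_def SR_def SL_def SL2_def using n by (simp only:) (rule alg, simp)
  qed
  have hat2: "T_AC_cond_hat n (\<pi> n) (\<lambda>i. Ys i \<omega>) (\<lambda>i. MX n i \<omega>) (\<lambda>i. MXZ n i \<omega>)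
      = (SR MXZ n \<omega> - SR MX n \<omega>) / (SL n \<omega> - SR MX n \<omega>)"
    if n: "0 < n" for n \<omega>
  proof -
    have "(\<Sum>i<n. R_tilde n (\<pi> n) (\<lambda>i. Ys i \<omega>) (Ys i \<omega>)) = (\<Sum>k<n. L_check n (\<pi> n) (\<lambda>i. Ys i \<omega>) k)"
      by (rule sum_R_tilde)
    then show ?thesis
      using n by (simp add: T_AC_cond_hat_def SR_def SL_def sum_subtractf diff_divide_distrib[symmetric])
  qed
  show ?thesis
  proof (intro conjI impI)
    assume not: "\<nexists>c. AE \<omega> in M. Y \<omega> = c"
    have den: "(\<integral>y. P y \<partial>\<nu>) - (\<integral>y. (P y)\<^sup>2 \<partial>\<nu>) \<noteq> 0"
    proof -
      \<comment> \<open>Not being constant means not being a function of a constant.\<close>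
      have zero: "(\<lambda>\<omega>. 0 :: real) \<in> borel_measurable M" by simp
      have "(\<integral>y. P y - (\<integral>\<omega>. (P y)\<^sup>2 \<partial>M) \<partial>\<nu>) \<noteq> 0"
        unfolding P_def \<nu>_def
      proof (rule residual_variance_nonzero[OF Y_meas zero, of "\<lambda>y _. prob (?A y)"])
        show "integrable (marginal_product M Y) (\<lambda>y. prob (?A y) - (\<integral>\<omega>. (prob (?A y))\<^sup>2 \<partial>M))"
          using Bochner_Integration.integrable_diff[OF intP] by (simp add: P_def \<nu>_def prob_space)
        show "(\<integral>\<omega>. prob (?A y) * of_bool (y \<le> Y \<omega>) \<partial>M) = (\<integral>\<omega>. prob (?A y) * prob (?A y) \<partial>M)" for y
          by (simp add: prob_upper_event(3)[OF Y_meas] prob_space)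
        show "\<nexists>f. f \<in> borel_measurable borel \<and> (AE \<omega> in M. Y \<omega> = f (0::real))" using not by blast
      qed auto
      then show ?thesis using intP by (simp add: prob_space)
    qed
    show "AE \<omega> in M. (\<lambda>n. T_AC_hat n (\<pi> n) (\<lambda>i. Ys i \<omega>) (\<lambda>i. MZ n i \<omega>)) \<longlonglongrightarrow> T_AC M Y Z"
      using RZ L1 L2
    proof eventually_elim
      case (elim \<omega>)
      have "(\<lambda>n. (SR MZ n \<omega> - SL2 n \<omega>) / (SL n \<omega> - SL2 n \<omega>)) \<longlonglongrightarrow> T_AC M Y Z"
        unfolding T1 using elim den by (intro tendsto_divide tendsto_diff)
      moreover have "eventually (\<lambda>n. (SR MZ n \<omega> - SL2 n \<omega>) / (SL n \<omega> - SL2 n \<omega>)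
          = T_AC_hat n (\<pi> n) (\<lambda>i. Ys i \<omega>) (\<lambda>i. MZ n i \<omega>)) sequentially"
        using eventually_gt_at_top[of 0] by eventually_elim (simp add: hat1)
      ultimately show ?case by (rule Lim_transform_eventually)
    qed
  next
    assume not: "\<nexists>f. f \<in> borel_measurable borel \<and> (AE \<omega> in M. Y \<omega> = f (X \<omega>))"
    have den: "(\<integral>y. P y \<partial>\<nu>) - (\<integral>y. aX y \<partial>\<nu>) \<noteq> 0"
      using limX(5)[OF not] intP(1) ints(2) by (simp add: P_def[symmetric])
    show "AE \<omega> in M. (\<lambda>n. T_AC_cond_hat n (\<pi> n) (\<lambda>i. Ys i \<omega>) (\<lambda>i. MX n i \<omega>) (\<lambda>i. MXZ n i \<omega>))
        \<longlonglongrightarrow> T_AC_cond M Y X Z"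
      using RX RXZ L1
    proof eventually_elim
      case (elim \<omega>)
      have "(\<lambda>n. (SR MXZ n \<omega> - SR MX n \<omega>) / (SL n \<omega> - SR MX n \<omega>)) \<longlonglongrightarrow> T_AC_cond M Y X Z"
        unfolding T2 using elim den by (intro tendsto_divide tendsto_diff)
      moreover have "eventually (\<lambda>n. (SR MXZ n \<omega> - SR MX n \<omega>) / (SL n \<omega> - SR MX n \<omega>)
          = T_AC_cond_hat n (\<pi> n) (\<lambda>i. Ys i \<omega>) (\<lambda>i. MX n i \<omega>) (\<lambda>i. MXZ n i \<omega>)) sequentially"
        using eventually_gt_at_top[of 0] by eventually_elim (simp add: hat2)
      ultimately show ?case by (rule Lim_transform_eventually)
    qed
  qed
qed

end
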